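(* Let $K$ be a field of characteristic different from $2$, let $a,d\in K^*$ with $a\neq d$, and let $E_{a,d}$ be the twisted Edwards curve $ax^2+y^2=1+dx^2y^2$ over $K$. Let $P_1,P_2\in E_{a,d}(K)$ be affine points, and let $P_3=P_1+P_2=(X_3:Y_3:Z_3)$ be their sum in the group law with neutral element $\mathcal{O}=(0,1)$; assume that $P_3$ is affine. Let $l_1=Z_3Y-Y_3Z$ and $l_2=X$ be the polynomials of the horizontal line through $P_3$ and of the vertical line through $\mathcal{O}$, respectively. Let $\phi=c_{Z^2}(Z^2+YZ)+c_{XY}XY+c_{XZ}XZ$ be the polynomial, unique up to multiplication by a scalar, of the conic passing through $\Omega_1=(1:0:0)$, $\Omega_2=(0:1:0)$, $\mathcal{O}'=(0:-1:1)$, $P_1$ and $P_2$ (counted with multiplicity). Then $$\operatorname{div}\left(\frac{\phi}{l_1l_2}\right)=(P_1)+(P_2)-(P_3)-(\mathcal{O}).$$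
   Context: The curve $E_{a,d}$ is regarded as the plane projective quartic $aX^2Z^2+Y^2Z^2=Z^4+dX^2Y^2$ with $x=X/Z$, $y=Y/Z$; a point is affine if $Z\neq0$. Its points at infinity $\Omega_1=(1:0:0)$ and $\Omega_2=(0:1:0)$ are singular and blow up to two points each on the smooth model. All affine points are nonsingular. Divisors of functions in the function field of $E_{a,d}$ are taken on the smooth projective model, which is an elliptic curve. A sum such as $(P_1)+(P_2)$ is a formal sum in the divisor group, while $P_1+P_2$ is the group law. Group law: $E_{a,d}$ carries the elliptic-curve group law with neutral element $\mathcal{O}=(0,1)=(0:1:1)$. On affine points it is given by $$(x_1,y_1)+(x_2,y_2)=\left(\frac{x_1y_2+y_1x_2}{1+dx_1x_2y_1y_2},\ \frac{y_1y_2-ax_1x_2}{1-dx_1x_2y_1y_2}\right)$$ when the denominators are nonzero. The negative of $(x_1,y_1)$ is $(-x_1,y_1)$, and $\mathcal{O}'=(0,-1)$ has order $2$. Conic: a conic is a possibly degenerate plane conic given by a nonzero homogeneous polynomial of degree $2$ in $K[X,Y,Z]$. Those through $\Omega_1,\Omega_2,\mathcal{O}'$ are exactly the ones given by polynomials $\phi=c_{Z^2}(Z^2+YZ)+c_{XY}XY+c_{XZ}XZ$ with $(c_{Z^2}:c_{XY}:c_{XZ})\in\mathbb{P}^2(K)$. "Passing through the points counted with multiplicity" means that at each affine point occurring $m$ times in the list $\mathcal{O}',P_1,P_2$ the intersection multiplicity of the conic with $E_{a,d}$ is at least $m$. Writing $P_i=(X_i:Y_i:Z_i)$ for $i=1,2$,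 the coefficients are, up to a common scalar: - if $P_1\neq P_2$, $P_1\neq\mathcal{O}'$, $P_2\neq\mathcal{O}'$: $c_{Z^2}=X_1X_2(Y_1Z_2-Y_2Z_1)$, $c_{XY}=Z_1Z_2(X_1Z_2-X_2Z_1+X_1Y_2-X_2Y_1)$, $c_{XZ}=X_2Y_2Z_1^2-X_1Y_1Z_2^2+Y_1Y_2(X_2Z_1-X_1Z_2)$; - if $P_1\neq P_2=\mathcal{O}'$: $c_{Z^2}=-X_1$, $c_{XY}=Z_1$, $c_{XZ}=Z_1$ (and symmetrically with the roles of $P_1,P_2$ exchanged); - if $P_1=P_2$: $c_{Z^2}=X_1Z_1(Z_1-Y_1)$, $c_{XY}=dX_1^2Y_1-Z_1^3$, $c_{XZ}=Z_1(Z_1Y_1-aX_1^2)$. *)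

theory Defs
  imports
    "HOL-Computational_Algebra.Polynomial"
    "HOL-Computational_Algebra.Fraction_Field"
    "HOL-Library.Poly_Mapping"
    "HOL-Library.Extended_Nat"
begin

section \<open>Polynomials in two and three variables\<close>

text \<open>
  \<open>K[x, y]\<close> is represented as \<open>K[x][y]\<close> and \<open>K[X, Y, Z]\<close> as \<open>K[X][Y][Z]\<close>: the first
  variable is the innermost one. Setting \<open>Z = 1\<close> is therefore evaluation of the outermost
  variable at 1.
\<close>

definition eval2 :: "'k::comm_ring_1 poly poly \<Rightarrow> 'k \<times> 'k \<Rightarrow> 'k" where
  "eval2 p P = poly (poly p [:snd P:]) (fst P)"

definition eval3 :: "'k::comm_ring_1 poly poly poly \<Rightarrow> 'k \<Rightarrow> 'k \<Rightarrow> 'k \<Rightarrow> 'k" where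
  "eval3 G x y z = poly (poly (poly G [:[:z:]:]) [:y:]) x"

definition const2 :: "'k::comm_ring_1 \<Rightarrow> 'k poly poly" where
  "const2 c = [:[:c:]:]"

definition const3 :: "'k::comm_ring_1 \<Rightarrow> 'k poly poly poly" where
  "const3 c = [:[:[:c:]:]:]"

definition VX :: "'k::comm_ring_1 poly poly poly" where "VX = [:[:[:0, 1:]:]:]"
definition VY :: "'k::comm_ring_1 poly poly poly" where "VY = [:[:0, 1:]:]"
definition VZ :: "'k::comm_ring_1 poly poly poly" where "VZ = [:0, 1:]"

definition homogeneous :: "nat \<Rightarrow> 'k::comm_ring_1 poly poly poly \<Rightarrow> bool" where
  "homogeneous n G \<longleftrightarrow>
    (\<forall>i j k. coeff (coeff (coeff G k) j) i \<noteq> 0 \<longrightarrow> i + j + k = n)"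

definition dehomogenize :: "'k::comm_ring_1 poly poly poly \<Rightarrow> 'k poly poly" where
  "dehomogenize G = poly G 1"


section \<open>Function fields of plane curves and divisors\<close>

text \<open>
  \<open>\<pi>\<close> exhibits the field \<open>'f\<close> as the field of fractions of \<open>K[x, y] / (f)\<close>; this determines
  \<open>('f, \<pi>)\<close> up to unique isomorphism. The field of constants embeds via \<open>c \<mapsto> \<pi> (const2 c)\<close>.
\<close>

definition is_function_field ::
  "'k::field poly poly \<Rightarrow> ('k poly poly \<Rightarrow> 'f::field) \<Rightarrow> bool" where
  "is_function_field f \<pi> \<longleftrightarrow>
    \<pi> 1 = 1 \<and>
    (\<forall>p q. \<pi> (p + q) = \<pi> p + \<pi> q) \<and>
    (\<forall>p q. \<pi> (p * q) = \<pi> p * \<pi> q) \<and>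
    (\<forall>p. \<pi> p = 0 \<longleftrightarrow> f dvd p) \<and>
    (\<forall>z. \<exists>p q. \<pi> q \<noteq> 0 \<and> z = \<pi> p / \<pi> q)"

text \<open>The function given by the quotient of two homogeneous polynomials of the same degree.\<close>

definition ratio ::
  "('k::field poly poly \<Rightarrow> 'f::field) \<Rightarrow> 'k poly poly poly \<Rightarrow> 'k poly poly poly \<Rightarrow> 'f" where
  "ratio \<pi> G H = \<pi> (dehomogenize G) / \<pi> (dehomogenize H)"

definition units_of_subring :: "'f::field set \<Rightarrow> 'f set" where
  "units_of_subring R = {u \<in> R. u \<noteq> 0 \<and> inverse u \<in> R}"

text \<open>
  If a subring \<open>R\<close> of the field \<open>'f\<close> has a uniformizer in the following sense, then it is a
  discrete valuation ring with field of fractions \<open>'f\<close>, and conversely.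
\<close>

definition uniformizer :: "'f::field set \<Rightarrow> 'f \<Rightarrow> bool" where
  "uniformizer R t \<longleftrightarrow>
    t \<in> R \<and> t \<noteq> 0 \<and> inverse t \<notin> R \<and>
    (\<forall>z. z \<noteq> 0 \<longrightarrow> (\<exists>n. \<exists>u\<in>units_of_subring R. z = u * t powi n))"

text \<open>
  The (closed) points of the smooth projective model of the curve with function field \<open>'f\<close>
  are the discrete valuation rings of \<open>'f\<close> that contain the field of constants.
\<close>

definition places :: "('k::field poly poly \<Rightarrow> 'f::field) \<Rightarrow> 'f set set" where
  "places \<pi> = {R. (\<forall>c. \<pi> (const2 c) \<in> R) \<and>
    (\<forall>x\<in>R. \<forall>y\<in>R. x + y \<in> R \<and> x * y \<in> R) \<and> (\<exists>t. uniformizer R t)}"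

text \<open>The order of vanishing of a nonzero function at a place.\<close>

definition ord_at :: "'f::field set \<Rightarrow> 'f \<Rightarrow> int" where
  "ord_at R z = (THE n. \<exists>t. uniformizer R t \<and> (\<exists>u\<in>units_of_subring R. z = u * t powi n))"

text \<open>
  Divisors are elements of the free abelian group on the places, that is, finitely supported
  integer-valued functions. A nonzero function has finitely many zeros and poles, so that
  \<open>Abs_poly_mapping\<close> is applied to a function with finite support.
\<close>

definition divisor_of ::
  "('k::field poly poly \<Rightarrow> 'f::field) \<Rightarrow> 'f \<Rightarrow> 'f set \<Rightarrow>\<^sub>0 int" where
  "divisor_of \<pi> z = Abs_poly_mapping (\<lambda>R. if R \<in> places \<pi> then ord_at R z else 0)"

text \<open>
  A nonsingular affine point of the curve, as a point of the smooth model, is its local ring.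
\<close>

definition place_of_point ::
  "('k::field poly poly \<Rightarrow> 'f::field) \<Rightarrow> 'k \<times> 'k \<Rightarrow> 'f set" where
  "place_of_point \<pi> P = {\<pi> p / \<pi> q | p q. eval2 q P \<noteq> 0}"

definition point_divisor ::
  "('k::field poly poly \<Rightarrow> 'f::field) \<Rightarrow> 'k \<times> 'k \<Rightarrow> 'f set \<Rightarrow>\<^sub>0 int" where
  "point_divisor \<pi> P = frag_of (place_of_point \<pi> P)"


section \<open>Intersection multiplicities\<close>

text \<open>
  The dimension of \<open>V / W\<close> for subspaces \<open>W \<subseteq> V\<close>: the supremum of the lengths of sequences in
  \<open>V\<close> that are linearly independent modulo \<open>W\<close>.
\<close>

definition quotient_dim ::
  "('k::field \<Rightarrow> 'v::ab_group_add \<Rightarrow> 'v) \<Rightarrow> 'v set \<Rightarrow> 'v set \<Rightarrow> enat" where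
  "quotient_dim scale V W = Sup {enat n | n. \<exists>u :: nat \<Rightarrow> 'v. (\<forall>i<n. u i \<in> V) \<and>
    (\<forall>c. (\<Sum>i<n. scale (c i) (u i)) \<in> W \<longrightarrow> (\<forall>i<n. c i = 0))}"

text \<open>The local ring of the affine plane at a point, inside \<open>K(x, y)\<close>.\<close>

definition plane_local_ring :: "'k::field \<times> 'k \<Rightarrow> 'k poly poly fract set" where
  "plane_local_ring P = {Fract p q | p q. eval2 q P \<noteq> 0}"

text \<open>
  The intersection multiplicity of the projective plane curves \<open>F = 0\<close> and \<open>G = 0\<close> at the
  affine point \<open>P\<close>, i.e. the dimension over \<open>K\<close> of the quotient of the local ring at \<open>P\<close> by the
  ideal generated by the dehomogenizations of \<open>F\<close> and \<open>G\<close>.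
\<close>

definition intersection_mult ::
  "'k::field poly poly poly \<Rightarrow> 'k poly poly poly \<Rightarrow> 'k \<times> 'k \<Rightarrow> enat" where
  "intersection_mult F G P =
    quotient_dim (\<lambda>c z. Fract (const2 c) 1 * z) (plane_local_ring P)
      {Fract (dehomogenize F) 1 * r + Fract (dehomogenize G) 1 * s | r s.
        r \<in> plane_local_ring P \<and> s \<in> plane_local_ring P}"


section \<open>Twisted Edwards curves\<close>

definition edwards_quartic :: "'k::field \<Rightarrow> 'k \<Rightarrow> 'k poly poly poly" where
  "edwards_quartic a d =
    const3 a * VX ^ 2 * VZ ^ 2 + VY ^ 2 * VZ ^ 2 - VZ ^ 4 - const3 d * VX ^ 2 * VY ^ 2"

definition edwards_points :: "'k::field \<Rightarrow> 'k \<Rightarrow> ('k \<times> 'k) set" where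
  "edwards_points a d = {(x, y). a * x ^ 2 + y ^ 2 = 1 + d * x ^ 2 * y ^ 2}"

text \<open>
  The sum of two affine rational points in the elliptic curve group law with neutral element
  \<open>(0, 1)\<close>; the value is \<open>None\<close> iff the sum lies at infinity. The first formula is the usual
  addition law. Unless \<open>a\<close> is a square and \<open>d\<close> a nonsquare, it may be undefined for affine points,
  even when their sum is affine. The second formula (Hisil, Wong, Carter, Dawson) describes
  the same group law. As shown by Bernstein and Lange, the two laws together are complete (in
  \<open>\<P>\<^sup>1 \<times> \<P>\<^sup>1\<close>), so that a sum for which each of them has a zero denominator is at infinity.
\<close>

definition edwards_add ::
  "'k::field \<Rightarrow> 'k \<Rightarrow> 'k \<times> 'k \<Rightarrow> 'k \<times> 'k \<Rightarrow> ('k \<times> 'k) option" where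
  "edwards_add a d P Q =
    (case (P, Q) of ((x1, y1), (x2, y2)) \<Rightarrow>
      if 1 + d * x1 * x2 * y1 * y2 \<noteq> 0 \<and> 1 - d * x1 * x2 * y1 * y2 \<noteq> 0
      then Some ((x1 * y2 + y1 * x2) / (1 + d * x1 * x2 * y1 * y2),
                 (y1 * y2 - a * x1 * x2) / (1 - d * x1 * x2 * y1 * y2))
      else if a * x1 * x2 + y1 * y2 \<noteq> 0 \<and> x1 * y2 - y1 * x2 \<noteq> 0
      then Some ((x1 * y1 + x2 * y2) / (a * x1 * x2 + y1 * y2),
                 (x1 * y1 - x2 * y2) / (x1 * y2 - y1 * x2))
      else None)"

text \<open>
  \<open>\<phi>\<close> defines a plane conic passing through \<open>(1 : 0 : 0)\<close> and \<open>(0 : 1 : 0)\<close> and, counted with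
  multiplicity, through \<open>(0, -1)\<close>, \<open>P1\<close> and \<open>P2\<close>.
\<close>

definition conic_through ::
  "'k::field \<Rightarrow> 'k \<Rightarrow> 'k \<times> 'k \<Rightarrow> 'k \<times> 'k \<Rightarrow> 'k poly poly poly \<Rightarrow> bool" where
  "conic_through a d P1 P2 \<phi> \<longleftrightarrow>
    \<phi> \<noteq> 0 \<and> homogeneous 2 \<phi> \<and>
    eval3 \<phi> 1 0 0 = 0 \<and> eval3 \<phi> 0 1 0 = 0 \<and>
    (\<forall>P \<in> {(0, -1), P1, P2}.
      intersection_mult (edwards_quartic a d) \<phi> P \<ge> enat (count_list [(0, -1), P1, P2] P))"

definition conic_poly :: "'k::field \<Rightarrow> 'k \<Rightarrow> 'k \<Rightarrow> 'k poly poly poly" where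
  "conic_poly cZZ cXY cXZ =
    const3 cZZ * (VZ ^ 2 + VY * VZ) + const3 cXY * VX * VY + const3 cXZ * VX * VZ"

end

theory Submission
  imports Defs
begin

text \<open>
  Dehomogenize the conic to \<open>\<phi> = c (1 + y) + x (e y + g)\<close>. Its norms with respect to the
  involutions \<open>x \<mapsto> -x\<close> and \<open>y \<mapsto> -y\<close> of the curve are, up to simple factors, cubics in \<open>y\<close> and in
  \<open>x\<close> with roots \<open>y1, y2, y3\<close> and \<open>x1, x2, -x3\<close>. Hence \<open>\<phi>\<close> and its conjugates together have the
  expected order at every place. At places that are not affine rational points (in particular at
  infinity) a lower bound for both conjugates then settles the order of \<open>\<phi>\<close>. At affine
  rational points the two norms, together with the vanishing of \<open>\<phi>\<close> at \<open>(0, -1)\<close>, \<open>P1\<close>, \<open>P2\<close>, show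
  that the remaining zero of \<open>\<phi>\<close> is \<open>-P3\<close>; it is cancelled by one of the zeros \<open>\<plusminus>P3\<close> of
  \<open>l1\<close>, and the zero \<open>(0, -1)\<close> is cancelled by one of the zeros of \<open>l2\<close>.
\<close>

section \<open>The conic and the cubics of its norms\<close>

text \<open>The places over \<open>(1 : 0 : 0)\<close> and \<open>(0 : 1 : 0)\<close> lie over
  \<open>y ^ 2 = a / d\<close> and \<open>x ^ 2 = 1 / d\<close>, so their number and rationality
  depend on which elements of \<open>K\<close> are squares. Bounding both conjugates and comparing
  with their product avoids this distinction. A single norm only gives the sum of the orders at two
  conjugate places, which is why two involutions are combined at rational points. Apart from
  degenerate positions, two roots of each cubic are known because \<open>\<phi>\<close> vanishes at
  \<open>P1\<close> and \<open>P2\<close>. By Vieta the third is then fixed by the quadratic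
  coefficient, and its agreement with the addition law is a polynomial identity modulo the curve
  equations. Vanishing with multiplicity becomes a linear system in \<open>(c, e, g)\<close> with a
  one-dimensional solution space; this yields existence, uniqueness and explicit coefficients of the
  conic together.\<close>

definition cubic_with_roots :: "'k::comm_ring_1 \<Rightarrow> 'k \<Rightarrow> 'k \<Rightarrow> 'k \<Rightarrow> 'k \<Rightarrow> 'k \<Rightarrow> 'k \<Rightarrow> bool" where
  "cubic_with_roots p3 p2 p1 p0 r s t \<longleftrightarrow>
    p2 = - p3 * (r + s + t) \<and> p1 = p3 * (r * s + r * t + s * t) \<and> p0 = - p3 * r * s * t"

text \<open>Dividing the difference of the two root equations by \<open>r - s\<close> gives the
  linear coefficient, and one root equation then gives the constant one. Only the quadratic
  coefficient remains to be compared with the addition law.\<close>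

lemma cubic_with_roots_distinct:
  fixes r s :: "'k::field"
  assumes "r \<noteq> s" and "p2 = - p3 * (r + s + t)"
    and r: "p3 * r ^ 3 + p2 * r ^ 2 + p1 * r + p0 = 0"
    and s: "p3 * s ^ 3 + p2 * s ^ 2 + p1 * s + p0 = 0"
  shows "cubic_with_roots p3 p2 p1 p0 r s t"
proof -
  have "(r - s) * (p1 - p3 * (r * s + r * t + s * t)) = 0"
    using r s unfolding assms(2) by algebra
  then have p1: "p1 = p3 * (r * s + r * t + s * t)"
    using \<open>r \<noteq> s\<close> by simp
  then have "p0 = - p3 * r * s * t"
    using r unfolding assms(2) by algebra
  then show ?thesis
    using p1 assms(2) by (simp add: cubic_with_roots_def)
qed

text \<open>For a double root the vanishing derivative replaces the second root equation.\<close>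

lemma cubic_with_roots_double:
  fixes r :: "'k::field"
  assumes "p2 = - p3 * (r + r + t)"
    and r: "p3 * r ^ 3 + p2 * r ^ 2 + p1 * r + p0 = 0"
    and r': "3 * p3 * r ^ 2 + 2 * p2 * r + p1 = 0"
  shows "cubic_with_roots p3 p2 p1 p0 r r t"
proof -
  have p1: "p1 = p3 * (r * r + r * t + r * t)"
    using r' unfolding assms(1) by algebra
  then have "p0 = - p3 * r * r * t"
    using r unfolding assms(1) by algebra
  then show ?thesis
    using p1 assms(1) by (simp add: cubic_with_roots_def)
qed

lemma cubic_with_roots_scale:
  "cubic_with_roots p3 p2 p1 p0 r s t \<Longrightarrow>
    cubic_with_roots (l * p3) (l * p2) (l * p1) (l * p0) r s t"
  unfolding cubic_with_roots_def by (elim conjE, hypsubst) (simp add: algebra_simps)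

text \<open>A vector orthogonal to \<open>u\<close> and \<open>v\<close> has zero cross product with
  \<open>u x v\<close>, hence is a multiple of it when that is nonzero. This is the source of the
  uniqueness of the conic up to a scalar.\<close>

lemma orthogonal_to_cross_product:
  fixes u1 :: "'k::field"
  assumes c: "c = u2 * v3 - u3 * v2" and e: "e = u3 * v1 - u1 * v3" and g: "g = u1 * v2 - u2 * v1"
    and nz: "(c, e, g) \<noteq> (0, 0, 0)"
  shows "(u1 * c' + u2 * e' + u3 * g' = 0 \<and> v1 * c' + v2 * e' + v3 * g' = 0) \<longleftrightarrow>
    (\<exists>l. c' = l * c \<and> e' = l * e \<and> g' = l * g)" (is "?L \<longleftrightarrow> ?R")
proof
  assume L: ?L
  have 1: "c' * e = e' * c" using L unfolding c e g by algebra
  have 2: "c' * g = g' * c" using L unfolding c e g by algebra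
  have 3: "e' * g = g' * e" using L unfolding c e g by algebra
  consider "c \<noteq> 0" | "e \<noteq> 0" | "g \<noteq> 0" using nz by blast
  then show ?R
  proof cases
    case 1
    then show ?thesis using \<open>c' * e = e' * c\<close> 2 
      by (intro exI[of _ "c' / c"]) (auto simp: field_simps)
  next
    case e: 2
    then show ?thesis using 1 3
      by (intro exI[of _ "e' / e"]) (auto simp: field_simps)
  next
    case g: 3
    then show ?thesis using 2 3
      by (intro exI[of _ "g' / g"]) (auto simp: field_simps)
  qed
next
  assume ?R
  then obtain l where "c' = l * c" "e' = l * e" "g' = l * g" by blast
  then show ?L unfolding c e g by (intro conjI) algebra+
qed

text \<open>
  Write \<open>\<phi> = c (1 + y) + x (e y + g)\<close> for the dehomogenized conic. Then \<open>on_conic\<close> is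
  \<open>\<phi>(P) = 0\<close>, and \<open>tangent_conic\<close> says that the Jacobian determinant of the curve equation and
  \<open>\<phi>\<close> vanishes at \<open>P\<close>.
\<close>

definition on_conic :: "'k::field \<Rightarrow> 'k \<Rightarrow> 'k \<Rightarrow> 'k \<times> 'k \<Rightarrow> bool" where
  "on_conic c e g P \<longleftrightarrow> c * (1 + snd P) + fst P * (e * snd P + g) = 0"

definition tangent_conic :: "'k::field \<Rightarrow> 'k \<Rightarrow> 'k \<Rightarrow> 'k \<Rightarrow> 'k \<Rightarrow> 'k \<times> 'k \<Rightarrow> bool" where
  "tangent_conic a d c e g P \<longleftrightarrow>
    snd P * (1 - d * fst P ^ 2) * (e * snd P + g) = fst P * (a - d * snd P ^ 2) * (c + e * fst P)"

text \<open>These conditions are linear in \<open>(c, e, g)\<close>. At \<open>(0, -1)\<close>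
  vanishing is automatic, so a coincidence of \<open>P1\<close> or \<open>P2\<close> with this point
  asks for order two, which is \<open>e = g\<close>, and a double coincidence for order three, which
  adds \<open>c = 0\<close>.\<close>

definition conic_conditions ::
  "'k::field \<Rightarrow> 'k \<Rightarrow> 'k \<times> 'k \<Rightarrow> 'k \<times> 'k \<Rightarrow> 'k \<Rightarrow> 'k \<Rightarrow> 'k \<Rightarrow> bool" where
  "conic_conditions a d P1 P2 c e g \<longleftrightarrow>
    on_conic c e g P1 \<and> on_conic c e g P2 \<and> (P1 = P2 \<longrightarrow> tangent_conic a d c e g P1) \<and>
    (P1 = (0, -1) \<or> P2 = (0, -1) \<longrightarrow> e = g) \<and> (P1 = (0, -1) \<and> P2 = (0, -1) \<longrightarrow> c = 0)"

text \<open>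
  The norms of \<open>\<phi>\<close> with respect to \<open>x \<mapsto> -x\<close> and \<open>y \<mapsto> -y\<close> are
  \<open>(1 + y) B(y) / (a - d y\<^sup>2)\<close> and \<open>x A(x) / (1 - d x\<^sup>2)\<close> for the following cubics \<open>B\<close> and \<open>A\<close>.
\<close>

definition norm_cubic_y :: "'k::comm_ring_1 \<Rightarrow> 'k \<Rightarrow> 'k \<Rightarrow> 'k \<Rightarrow> 'k \<Rightarrow> 'k \<Rightarrow> 'k \<Rightarrow> 'k \<Rightarrow> bool" where
  "norm_cubic_y a d c e g r s t \<longleftrightarrow>
    cubic_with_roots (e ^ 2 - d * c ^ 2) (2 * e * g - e ^ 2 - d * c ^ 2)
      (g ^ 2 - 2 * e * g + a * c ^ 2) (a * c ^ 2 - g ^ 2) r s t"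

definition norm_cubic_x :: "'k::comm_ring_1 \<Rightarrow> 'k \<Rightarrow> 'k \<Rightarrow> 'k \<Rightarrow> 'k \<Rightarrow> 'k \<Rightarrow> 'k \<Rightarrow> 'k \<Rightarrow> bool" where
  "norm_cubic_x a d c e g r s t \<longleftrightarrow>
    cubic_with_roots (a * e ^ 2 - d * g ^ 2) (2 * c * (a * e - d * g))
      (g ^ 2 - e ^ 2 + (a - d) * c ^ 2) (2 * c * (g - e)) r s t"

lemma norm_cubic_y_scale:
  assumes "norm_cubic_y a d c e g r s t"
  shows "norm_cubic_y a d (l * c) (l * e) (l * g) r s t"
  using cubic_with_roots_scale[OF assms[unfolded norm_cubic_y_def], of "l ^ 2"]
  unfolding norm_cubic_y_def by (simp add: algebra_simps power2_eq_square)

lemma norm_cubic_x_scale: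
  assumes "norm_cubic_x a d c e g r s t"
  shows "norm_cubic_x a d (l * c) (l * e) (l * g) r s t"
  using cubic_with_roots_scale[OF assms[unfolded norm_cubic_x_def], of "l ^ 2"]
  unfolding norm_cubic_x_def by (simp add: algebra_simps power2_eq_square)

section \<open>Rational points of the curve and the roots of the norm cubics\<close>

locale edwards_curve =
  fixes a d :: "'k::field"
  assumes two: "(2::'k) \<noteq> 0" and a_nonzero: "a \<noteq> 0" and d_nonzero: "d \<noteq> 0" and a_neq_d: "a \<noteq> d"
begin

lemma points_iff: "(x, y) \<in> edwards_points a d \<longleftrightarrow> a * x ^ 2 + y ^ 2 = 1 + d * x ^ 2 * y ^ 2"
  by (simp add: edwards_points_def)

text \<open>The curve equation reads \<open>x ^ 2 * (a - d * y ^ 2) = 1 - y ^ 2\<close>, so this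
  factor could vanish only together with \<open>1 - y ^ 2\<close>, forcing \<open>a = d\<close>. It
  is the denominator of the norm to \<open>K(y)\<close>, which is therefore a unit at affine
  rational points.\<close>

lemma y_coeff_nonzero:
  assumes "(x, y) \<in> edwards_points a d"
  shows "a - d * y ^ 2 \<noteq> 0"
proof
  assume "a - d * y ^ 2 = 0"
  then have "y ^ 2 = 1" "a = d * y ^ 2"
    using assms unfolding points_iff by algebra+
  then show False using a_neq_d by simp
qed

lemma x_coeff_nonzero:
  assumes "(x, y) \<in> edwards_points a d"
  shows "1 - d * x ^ 2 \<noteq> 0"
proof
  assume "1 - d * x ^ 2 = 0"
  then have "a * x ^ 2 = 1" "d * x ^ 2 = 1"
    using assms unfolding points_iff by algebra+
  then have "x ^ 2 * (a - d) = 0" by algebra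
  then show False using a_neq_d \<open>a * x ^ 2 = 1\<close> by auto
qed

text \<open>The Vieta relations are not normalized: a zero leading coefficient would make all four
  coefficients vanish, which leaves only \<open>c = e = g = 0\<close>. Hence the constant in front
  of the norm contributes no zeros or poles.\<close>

lemma norm_cubic_y_lead_nonzero:
  assumes "norm_cubic_y a d c e g r s t" and "(c, e, g) \<noteq> (0, 0, 0)"
  shows "e ^ 2 - d * c ^ 2 \<noteq> 0"
proof
  assume "e ^ 2 - d * c ^ 2 = 0"
  then have e: "e ^ 2 = d * c ^ 2" and eg: "2 * e * g = 2 * e ^ 2" and "g ^ 2 - 2 * e * g + a * c ^ 2 = 0"
    and g: "g ^ 2 = a * c ^ 2"
    using assms(1) unfolding norm_cubic_y_def cubic_with_roots_def by auto
  then have "2 * (c ^ 2 * (a - d)) = 0" by algebra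
  then have "c = 0" using two a_neq_d by simp
  then show False using e g assms(2) by simp
qed

lemma norm_cubic_x_lead_nonzero:
  assumes "norm_cubic_x a d c e g r s t" and "(c, e, g) \<noteq> (0, 0, 0)"
  shows "a * e ^ 2 - d * g ^ 2 \<noteq> 0"
proof
  assume l: "a * e ^ 2 - d * g ^ 2 = 0"
  then have 1: "2 * c * (g - e) = 0" and 2: "g ^ 2 - e ^ 2 + (a - d) * c ^ 2 = 0"
    using assms(1) unfolding norm_cubic_x_def cubic_with_roots_def by auto
  have "c = 0"
  proof (rule ccontr)
    assume "c \<noteq> 0"
    then have "g = e" using 1 two by simp
    then show False using 2 a_neq_d \<open>c \<noteq> 0\<close> by simp
  qed
  then have "g ^ 2 = e ^ 2" using 2 by simp
  then have "(a - d) * e ^ 2 = 0" using l by algebra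
  then show False using assms(2) a_neq_d \<open>c = 0\<close> \<open>g ^ 2 = e ^ 2\<close> by simp
qed

text \<open>The norm vanishes at \<open>y\<close>, and its factor \<open>1 + y\<close>, which comes
  from the fixed zero \<open>(0, -1)\<close> of \<open>\<phi>\<close>, can be cancelled when
  \<open>y \<noteq> -1\<close>.\<close>

lemma norm_cubic_y_root:
  assumes "(x, y) \<in> edwards_points a d" and "y \<noteq> -1" and "on_conic c e g (x, y)"
  shows "(e ^ 2 - d * c ^ 2) * y ^ 3 + (2 * e * g - e ^ 2 - d * c ^ 2) * y ^ 2 +
      (g ^ 2 - 2 * e * g + a * c ^ 2) * y + (a * c ^ 2 - g ^ 2) = 0" (is "?B = 0")
proof -
  have E: "x ^ 2 * (a - d * y ^ 2) = 1 - y ^ 2"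
    using assms(1) unfolding points_iff by algebra
  have "(1 + y) * ?B = (c * (1 + y)) ^ 2 * (a - d * y ^ 2) - (1 - y ^ 2) * (e * y + g) ^ 2"
    by algebra
  also have "\<dots> = (e * y + g) ^ 2 * (x ^ 2 * (a - d * y ^ 2) - (1 - y ^ 2))"
    using assms(3) unfolding on_conic_def by simp algebra
  finally have "(1 + y) * ?B = 0" using E by simp
  moreover have "1 + y \<noteq> 0" using assms(2) by (simp add: add_eq_0_iff)
  ultimately show ?thesis by simp
qed

lemma norm_cubic_x_root:
  assumes "(x, y) \<in> edwards_points a d" and "y \<noteq> -1" and "on_conic c e g (x, y)"
  shows "(a * e ^ 2 - d * g ^ 2) * x ^ 3 + (2 * c * (a * e - d * g)) * x ^ 2 +
      (g ^ 2 - e ^ 2 + (a - d) * c ^ 2) * x + 2 * c * (g - e) = 0" (is "?A = 0")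
proof (cases "x = 0")
  case True
  \<comment> \<open>The factor \<open>x\<close> of the norm cannot be cancelled here; instead
    \<open>c = 0\<close> makes the constant term of the cubic vanish.\<close>
  have "1 + y \<noteq> 0" using assms(2) by (simp add: add_eq_0_iff)
  then show ?thesis using True assms(3) by (simp add: on_conic_def)
next
  case False
  have E: "y ^ 2 * (1 - d * x ^ 2) = 1 - a * x ^ 2"
    using assms(1) unfolding points_iff by algebra
  have "x * ?A = (c + x * g) ^ 2 * (1 - d * x ^ 2) - (1 - a * x ^ 2) * (c + x * e) ^ 2"
    by algebra
  also have "\<dots> = (c + x * e) ^ 2 * (y ^ 2 * (1 - d * x ^ 2) - (1 - a * x ^ 2))"
    using assms(3) unfolding on_conic_def by simp algebra
  finally have "x * ?A = 0" using E by simp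
  then show ?thesis using False by simp
qed

lemma y_minus_one:
  assumes "(x, -1) \<in> edwards_points a d"
  shows "x = 0"
proof -
  have "(a - d) * x ^ 2 = 0" using assms unfolding points_iff by algebra
  then show ?thesis using a_neq_d by simp
qed

lemma x_eq_0_imp:
  assumes "(0, y) \<in> edwards_points a d"
  shows "y = 1 \<or> y = -1"
  using assms by (simp add: points_iff power2_eq_1_iff)

lemma same_y:
  assumes "(x, y) \<in> edwards_points a d" "(x', y) \<in> edwards_points a d"
  shows "x' = x \<or> x' = - x"
proof -
  have "(a - d * y ^ 2) * (x' ^ 2 - x ^ 2) = 0" using assms unfolding points_iff by algebra
  then show ?thesis using y_coeff_nonzero[OF assms(1)] by (simp add: power2_eq_iff)
qed

lemma same_x:
  assumes "(x, y) \<in> edwards_points a d" "(x, y') \<in> edwards_points a d"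
  shows "y' = y \<or> y' = - y"
proof -
  have "(1 - d * x ^ 2) * (y' ^ 2 - y ^ 2) = 0" using assms unfolding points_iff by algebra
  then show ?thesis using x_coeff_nonzero[OF assms(1)] by (simp add: power2_eq_iff)
qed

text \<open>Denominators are cleared to obtain polynomial equations. The second case does not record
  that the first law fails; the identities below hold without this information.\<close>

lemma edwards_add_cases:
  assumes "edwards_add a d (x1, y1) (x2, y2) = Some (x3, y3)"
  obtains "1 + d * x1 * x2 * y1 * y2 \<noteq> 0" "1 - d * x1 * x2 * y1 * y2 \<noteq> 0"
      "x3 * (1 + d * x1 * x2 * y1 * y2) = x1 * y2 + y1 * x2"
      "y3 * (1 - d * x1 * x2 * y1 * y2) = y1 * y2 - a * x1 * x2"
    | "a * x1 * x2 + y1 * y2 \<noteq> 0" "x1 * y2 - y1 * x2 \<noteq> 0"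
      "x3 * (a * x1 * x2 + y1 * y2) = x1 * y1 + x2 * y2"
      "y3 * (x1 * y2 - y1 * x2) = x1 * y1 - x2 * y2"
  using assms that unfolding edwards_add_def by (auto split: if_splits)

lemma edwards_add_closed:
  assumes P1: "(x1, y1) \<in> edwards_points a d" and P2: "(x2, y2) \<in> edwards_points a d"
    and "edwards_add a d (x1, y1) (x2, y2) = Some (x3, y3)"
  shows "(x3, y3) \<in> edwards_points a d"
  using assms(3)
proof (cases rule: edwards_add_cases)
  case 1
  define D where "D = d * x1 * x2 * y1 * y2"
  \<comment> \<open>The cofactors of the two curve equations here and below come from a Groebner basis computation.\<close>
  have "(1 + D) ^ 2 * (1 - D) ^ 2 * (a * x3 ^ 2 + y3 ^ 2 - (1 + d * x3 ^ 2 * y3 ^ 2)) =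
      a * (x3 * (1 + D)) ^ 2 * (1 - D) ^ 2 + (y3 * (1 - D)) ^ 2 * (1 + D) ^ 2 - (1 - D * D) ^ 2
      - d * (x3 * (1 + D)) ^ 2 * (y3 * (1 - D)) ^ 2"
    by algebra
  also have "\<dots> = a * (x1 * y2 + y1 * x2) ^ 2 * (1 - D) ^ 2
      + (y1 * y2 - a * x1 * x2) ^ 2 * (1 + D) ^ 2 - (1 - D * D) ^ 2
      - d * (x1 * y2 + y1 * x2) ^ 2 * (y1 * y2 - a * x1 * x2) ^ 2"
    using 1(3,4) unfolding D_def by simp
  also have "\<dots> = (a*d^2*x1^2*y1^2*x2^4*y2^2 - a*d*x1^2*x2^2*y2^2 - a*d*y1^2*x2^4 + a*x2^2
        + d^2*x1^2*y1^2*x2^2*y2^4 - d^2*x1^2*y1^2*x2^2*y2^2 + d^2*y1^2*x2^4*y2^2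
        - 2*d*y1^2*x2^2*y2^2 + d*y1^2*x2^2 - d*x2^2*y2^2 + y2^2)
        * (a*x1^2 + y1^2 - (1 + d*x1^2*y1^2))
      + (d^3*x1^4*y1^4*x2^2*y2^2 - d^2*x1^2*y1^4*x2^2 - d*x1^2*y1^2*y2^2 + d*y1^4*x2^2
        - d*y1^2*x2^2 + 1) * (a*x2^2 + y2^2 - (1 + d*x2^2*y2^2))"
    unfolding D_def by algebra
  also have "\<dots> = 0"
    using P1 P2 unfolding points_iff by simp
  finally show ?thesis
    using 1(1,2) unfolding points_iff D_def by simp
next
  case 2
  define m where "m = a * x1 * x2 + y1 * y2"
  define n where "n = x1 * y2 - y1 * x2"
  have "m ^ 2 * n ^ 2 * (a * x3 ^ 2 + y3 ^ 2 - (1 + d * x3 ^ 2 * y3 ^ 2)) =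
      a * (x3 * m) ^ 2 * n ^ 2 + (y3 * n) ^ 2 * m ^ 2 - m ^ 2 * n ^ 2
      - d * (x3 * m) ^ 2 * (y3 * n) ^ 2"
    by algebra
  also have "\<dots> = a * (x1 * y1 + x2 * y2) ^ 2 * n ^ 2 + (x1 * y1 - x2 * y2) ^ 2 * m ^ 2
      - m ^ 2 * n ^ 2 - d * (x1 * y1 + x2 * y2) ^ 2 * (x1 * y1 - x2 * y2) ^ 2"
    using 2(3,4) unfolding m_def n_def by simp
  also have "\<dots> = (a*x1^2*y1^2*x2^2 - a*x1^2*x2^2*y2^2 - a*y1^2*x2^4 + a*x2^4*y2^2
        - d*x1^2*y1^2*x2^2*y2^2 + d*y1^2*x2^4*y2^2 + x1^2*y1^2*y2^2 - 2*y1^2*x2^2*y2^2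
        + y1^2*x2^2 + x2^2*y2^4 - x2^2*y2^2) * (a*x1^2 + y1^2 - (1 + d*x1^2*y1^2))
      + (d*x1^4*y1^4 - d*x1^2*y1^4*x2^2 - x1^2*y1^2*y2^2 + y1^4*x2^2 - y1^2*x2^2 + x2^2*y2^2)
        * (a*x2^2 + y2^2 - (1 + d*x2^2*y2^2))"
    unfolding m_def n_def by algebra
  also have "\<dots> = 0"
    using P1 P2 unfolding points_iff by simp
  finally show ?thesis
    using 2(1,2) unfolding points_iff m_def n_def by simp
qed

section \<open>Symmetry in the two points, and the explicit conics with the roots of their norm
  cubics\<close>

lemma conic_conditions_commute:
  "conic_conditions a d P2 P1 c e g \<longleftrightarrow> conic_conditions a d P1 P2 c e g"
  unfolding conic_conditions_def by auto

lemma norm_cubic_commute: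
  "norm_cubic_y a d c e g s r t \<longleftrightarrow> norm_cubic_y a d c e g r s t"
  "norm_cubic_x a d c e g s r t \<longleftrightarrow> norm_cubic_x a d c e g r s t"
  unfolding norm_cubic_y_def norm_cubic_x_def cubic_with_roots_def by (auto simp: algebra_simps)

lemma edwards_add_commute: "edwards_add a d P Q = edwards_add a d Q P"
proof -
  obtain x1 y1 x2 y2 where [simp]: "P = (x1, y1)" "Q = (x2, y2)" by (cases P, cases Q)
  have 2: "x1 * y2 - y1 * x2 = - (x2 * y1 - y2 * x1)" by (simp add: algebra_simps)
  \<comment> \<open>Numerator and denominator of the second formula for \<open>y\<close> both change
    sign.\<close>
  have 3: "(x2 * y2 - x1 * y1) / (x2 * y1 - y2 * x1) = (x1 * y1 - x2 * y2) / (x1 * y2 - y1 * x2)"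
    by (subst minus_divide_divide[symmetric]) (simp only: minus_diff_eq mult.commute)
  show ?thesis unfolding edwards_add_def using 2 3 by (simp add: ac_simps)
qed

text \<open>With \<open>e = g\<close> the conic splits as \<open>(1 + y) * (c + e * x)\<close>: the
  horizontal line through \<open>(0, -1)\<close> and the vertical line through the other point.
  Adding \<open>(0, -1)\<close> negates both coordinates.\<close>

lemma conic_solution_order_two:
  assumes P: "(x, y) \<in> edwards_points a d"
    and add: "edwards_add a d (0, -1) (x, y) = Some (x3, y3)"
  shows "conic_conditions a d (0, -1) (x, y) c e g \<longleftrightarrow> (\<exists>l. c = l * - x \<and> e = l * 1 \<and> g = l * 1)"
    and "norm_cubic_y a d (- x) 1 1 (- 1) y y3"
    and "norm_cubic_x a d (- x) 1 1 0 x (- x3)"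
proof -
  have P3: "x3 = - x" "y3 = - y"
    using add by (simp_all add: edwards_add_def)
  have E: "a * x ^ 2 = 1 + d * x ^ 2 * y ^ 2 - y ^ 2"
    using P unfolding points_iff by algebra
  show "norm_cubic_y a d (- x) 1 1 (- 1) y y3"
    unfolding norm_cubic_y_def cubic_with_roots_def P3 using E
    by (simp add: algebra_simps power2_eq_square)
  show "norm_cubic_x a d (- x) 1 1 0 x (- x3)"
    unfolding norm_cubic_x_def cubic_with_roots_def P3
    by (simp add: algebra_simps power2_eq_square)
  have y: "1 + y = 0 \<longleftrightarrow> y = -1" by (metis add.commute eq_neg_iff_add_eq_0)
  show "conic_conditions a d (0, -1) (x, y) c e g \<longleftrightarrow> (\<exists>l. c = l * - x \<and> e = l * 1 \<and> g = l * 1)"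
  proof
    assume C: "conic_conditions a d (0, -1) (x, y) c e g"
    then have eg: "e = g" by (simp add: conic_conditions_def)
    have "c = - (e * x)"
    proof (cases "y = -1")
      case True
      \<comment> \<open>Both points are \<open>(0, -1)\<close>, and the order-three condition
        supplies \<open>c = 0\<close>.\<close>
      then have "x = 0" using P y_minus_one by simp
      then show ?thesis using True C by (simp add: conic_conditions_def)
    next
      case False
      have "(1 + y) * (c + e * x) = 0"
        using C eg unfolding conic_conditions_def on_conic_def by simp algebra
      then have "c + e * x = 0" using False y by simp
      then show ?thesis by (simp add: eq_neg_iff_add_eq_0)
    qed
    then show "\<exists>l. c = l * - x \<and> e = l * 1 \<and> g = l * 1" using eg by auto
  next
    assume "\<exists>l. c = l * - x \<and> e = l * 1 \<and> g = l * 1"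
    then have "c = - (e * x)" "g = e" by auto
    then show "conic_conditions a d (0, -1) (x, y) c e g"
      unfolding conic_conditions_def on_conic_def tangent_conic_def
      by (auto simp: algebra_simps)
  qed
qed

text \<open>Modulo the curve equation, the coefficient rows of \<open>on_conic\<close> and
  \<open>tangent_conic\<close> have cross product \<open>1 + y\<close> times
  \<open>(c0, e0, g0)\<close>. The double roots of the cubics are checked through value and
  derivative.\<close>

lemma conic_solution_double:
  assumes P: "(x, y) \<in> edwards_points a d" and "y \<noteq> -1"
    and add: "edwards_add a d (x, y) (x, y) = Some (x3, y3)"
    and c0: "c0 = x * (1 - y)" and e0: "e0 = d * x ^ 2 * y - 1" and g0: "g0 = y - a * x ^ 2"
  shows "(c0, e0, g0) \<noteq> (0, 0, 0)"
    and "conic_conditions a d (x, y) (x, y) c e g \<longleftrightarrow> (\<exists>l. c = l * c0 \<and> e = l * e0 \<and> g = l * g0)"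
    and "norm_cubic_y a d c0 e0 g0 y y y3"
    and "norm_cubic_x a d c0 e0 g0 x x (- x3)"
proof -
  have E: "a * x ^ 2 + y ^ 2 = 1 + d * x ^ 2 * y ^ 2" using P by (simp add: points_iff)
  have y: "1 + y \<noteq> 0" using assms(2) by (simp add: add_eq_0_iff)
  show nz: "(c0, e0, g0) \<noteq> (0, 0, 0)"
  proof
    assume "(c0, e0, g0) = (0, 0, 0)"
    then have 0: "x * (1 - y) = 0" "d * x ^ 2 * y = 1" using c0 e0 by auto
    then have "y = 1" by auto
    then have "(a - d) * x ^ 2 = 0" using E by algebra
    then show False using a_neq_d 0 by simp
  qed
  \<comment> \<open>Coefficients in \<open>(c, e, g)\<close>: the row \<open>(1 + y, ?u2, x)\<close>
    belongs to \<open>on_conic\<close>, the row \<open>(?v1, ?v2, ?v3)\<close> to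
    \<open>tangent_conic\<close>.\<close>
  let ?u2 = "x * y" and ?v1 = "- x * (a - d * y ^ 2)"
    and ?v2 = "y ^ 2 * (1 - d * x ^ 2) - x ^ 2 * (a - d * y ^ 2)" and ?v3 = "y * (1 - d * x ^ 2)"
  have *: "(1 + y) * c0 = ?u2 * ?v3 - x * ?v2" "(1 + y) * e0 = x * ?v1 - (1 + y) * ?v3"
    "(1 + y) * g0 = (1 + y) * ?v2 - ?u2 * ?v1"
    unfolding c0 e0 g0 using E by algebra+
  have "conic_conditions a d (x, y) (x, y) c e g \<longleftrightarrow>
      (1 + y) * c + ?u2 * e + x * g = 0 \<and> ?v1 * c + ?v2 * e + ?v3 * g = 0"
  proof -
    have "tangent_conic a d c e g (x, y) \<longleftrightarrow> ?v1 * c + ?v2 * e + ?v3 * g = 0"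
      unfolding tangent_conic_def fst_conv snd_conv by algebra
    moreover have "on_conic c e g (x, y) \<longleftrightarrow> (1 + y) * c + ?u2 * e + x * g = 0"
      unfolding on_conic_def fst_conv snd_conv by algebra
    ultimately show ?thesis using \<open>y \<noteq> -1\<close> by (simp add: conic_conditions_def)
  qed
  also have "\<dots> \<longleftrightarrow> (\<exists>l. c = l * ((1 + y) * c0) \<and> e = l * ((1 + y) * e0) \<and> g = l * ((1 + y) * g0))"
    by (rule orthogonal_to_cross_product[OF *]) (use nz y in auto)
  also have "\<dots> \<longleftrightarrow> (\<exists>l. c = l * c0 \<and> e = l * e0 \<and> g = l * g0)"
  proof
    assume "\<exists>l. c = l * ((1 + y) * c0) \<and> e = l * ((1 + y) * e0) \<and> g = l * ((1 + y) * g0)"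
    then obtain l where "c = l * ((1 + y) * c0)" "e = l * ((1 + y) * e0)" "g = l * ((1 + y) * g0)"
      by blast
    then show "\<exists>l. c = l * c0 \<and> e = l * e0 \<and> g = l * g0"
      by (intro exI[of _ "l * (1 + y)"]) (simp add: mult.assoc)
  next
    assume "\<exists>l. c = l * c0 \<and> e = l * e0 \<and> g = l * g0"
    then obtain l where "c = l * c0" "e = l * e0" "g = l * g0"
      by blast
    then show "\<exists>l. c = l * ((1 + y) * c0) \<and> e = l * ((1 + y) * e0) \<and> g = l * ((1 + y) * g0)"
      using y by (intro exI[of _ "l / (1 + y)"]) simp
  qed
  finally show "conic_conditions a d (x, y) (x, y) c e g \<longleftrightarrow>
    (\<exists>l. c = l * c0 \<and> e = l * e0 \<and> g = l * g0)" .
  define D where "D = d * x ^ 2 * y ^ 2"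
  \<comment> \<open>For equal summands \<open>x1 * y2 - y1 * x2\<close> is \<open>0\<close>, so only
    the first addition law can apply.\<close>
  have D: "1 + D \<noteq> 0" "1 - D \<noteq> 0" "x3 * (1 + D) = 2 * x * y" "y3 * (1 - D) = y ^ 2 - a * x ^ 2"
    using add unfolding D_def
    by (cases rule: edwards_add_cases; simp add: power2_eq_square algebra_simps)+
  \<comment> \<open>Multiplying by the denominator of \<open>y3\<close> turns the Vieta relation for
    the sum of the roots into a polynomial identity modulo the curve equation.\<close>
  have "(1 - D) * (2 * e0 * g0 - e0 ^ 2 - d * c0 ^ 2 + (e0 ^ 2 - d * c0 ^ 2) * (y + y + y3)) = 
      (1 - D) * (2 * e0 * g0 - e0 ^ 2 - d * c0 ^ 2 + (e0 ^ 2 - d * c0 ^ 2) * (y + y))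
      + (e0 ^ 2 - d * c0 ^ 2) * (y3 * (1 - D))"
    by algebra
  also have "\<dots> = (2*d^2*x^4*y^3 - d^2*x^4*y^2 - d*x^2*y^2 - 2*d*x^2*y + d*x^2 + 1)
      * (a * x ^ 2 + y ^ 2 - (1 + d * x ^ 2 * y ^ 2))"
    unfolding D(4) unfolding D_def c0 e0 g0 by algebra
  also have "\<dots> = 0" using E by simp
  finally have "2 * e0 * g0 - e0 ^ 2 - d * c0 ^ 2 + (e0 ^ 2 - d * c0 ^ 2) * (y + y + y3) = 0"
    using D(2) mult_eq_0_iff by blast
  then have By: "2 * e0 * g0 - e0 ^ 2 - d * c0 ^ 2 = - (e0 ^ 2 - d * c0 ^ 2) * (y + y + y3)"
    by algebra
  have "(1 + D) * (2 * c0 * (a * e0 - d * g0) + (a * e0 ^ 2 - d * g0 ^ 2) * (x + x - x3)) = 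
      (1 + D) * (2 * c0 * (a * e0 - d * g0) + (a * e0 ^ 2 - d * g0 ^ 2) * (x + x))
      - (a * e0 ^ 2 - d * g0 ^ 2) * (x3 * (1 + D))"
    by algebra
  also have "\<dots> = (- 2*a*d^2*x^5*y^2 + 2*a*d*x^3*y - 2*a*d*x^3 + 2*d*x*y)
      * (a * x ^ 2 + y ^ 2 - (1 + d * x ^ 2 * y ^ 2))"
    unfolding D(3) unfolding D_def c0 e0 g0 by algebra
  also have "\<dots> = 0" using E by simp
  finally have "2 * c0 * (a * e0 - d * g0) + (a * e0 ^ 2 - d * g0 ^ 2) * (x + x - x3) = 0"
    using D(1) mult_eq_0_iff by blast
  then have Bx: "2 * c0 * (a * e0 - d * g0) = - (a * e0 ^ 2 - d * g0 ^ 2) * (x + x + - x3)"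
    by algebra
  show "norm_cubic_y a d c0 e0 g0 y y y3"
    unfolding norm_cubic_y_def
    by (rule cubic_with_roots_double[OF By]; unfold c0 e0 g0; use E in algebra)
  show "norm_cubic_x a d c0 e0 g0 x x (- x3)"
    unfolding norm_cubic_x_def
    by (rule cubic_with_roots_double[OF Bx]; unfold c0 e0 g0; use E in algebra)
qed

text \<open>The triple \<open>(c0, e0, g0)\<close> is the cross product of the coefficient rows
  \<open>(1 + y, x * y, x)\<close> of the two vanishing conditions. The third root of each cubic
  comes from the sum of the roots, checked for both addition laws.\<close>

lemma conic_solution_distinct:
  assumes P1: "(x1, y1) \<in> edwards_points a d" "y1 \<noteq> -1"
    and P2: "(x2, y2) \<in> edwards_points a d" "y2 \<noteq> -1"
    and neq: "(x1, y1) \<noteq> (x2, y2)"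
    and add: "edwards_add a d (x1, y1) (x2, y2) = Some (x3, y3)"
    and c0: "c0 = x1 * x2 * (y1 - y2)" and e0: "e0 = x1 * (1 + y2) - x2 * (1 + y1)"
    and g0: "g0 = x2 * y2 * (1 + y1) - x1 * y1 * (1 + y2)"
  shows "(c0, e0, g0) \<noteq> (0, 0, 0)"
    and "conic_conditions a d (x1, y1) (x2, y2) c e g \<longleftrightarrow>
      (\<exists>l. c = l * c0 \<and> e = l * e0 \<and> g = l * g0)"
    and "norm_cubic_y a d c0 e0 g0 y1 y2 y3"
    and "norm_cubic_x a d c0 e0 g0 x1 x2 (- x3)"
proof -
  have E1: "a * x1 ^ 2 + y1 ^ 2 - (1 + d * x1 ^ 2 * y1 ^ 2) = 0"
    and E2: "a * x2 ^ 2 + y2 ^ 2 - (1 + d * x2 ^ 2 * y2 ^ 2) = 0"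
    using P1 P2 by (simp_all add: points_iff)
  have y: "1 + y1 \<noteq> 0" "1 + y2 \<noteq> 0"
    using P1(2) P2(2) by (simp_all add: add_eq_0_iff)
  show nz: "(c0, e0, g0) \<noteq> (0, 0, 0)"
  proof
    assume "(c0, e0, g0) = (0, 0, 0)"
    then have 0: "x1 * x2 * (y1 - y2) = 0" "x1 * (1 + y2) = x2 * (1 + y1)"
      using c0 e0 by auto
    then have "x1 = 0 \<and> x2 = 0 \<or> y1 = y2 \<and> x1 = x2"
      using y by auto
    then show False using x_eq_0_imp P1 P2 neq by auto
  qed
  have cross: "c0 = (x1 * y1) * x2 - x1 * (x2 * y2)" "e0 = x1 * (1 + y2) - (1 + y1) * x2"
    "g0 = (1 + y1) * (x2 * y2) - (x1 * y1) * (1 + y2)"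
    unfolding c0 e0 g0 by algebra+
  have conditions: "conic_conditions a d (x1, y1) (x2, y2) c e g \<longleftrightarrow>
      (\<exists>l. c = l * c0 \<and> e = l * e0 \<and> g = l * g0)" for c e g
  proof -
    have "conic_conditions a d (x1, y1) (x2, y2) c e g \<longleftrightarrow>
        (1 + y1) * c + (x1 * y1) * e + x1 * g = 0 \<and> (1 + y2) * c + (x2 * y2) * e + x2 * g = 0"
      using P1(2) P2(2) neq by (auto simp: conic_conditions_def on_conic_def algebra_simps)
    also have "\<dots> \<longleftrightarrow> (\<exists>l. c = l * c0 \<and> e = l * e0 \<and> g = l * g0)"
      by (rule orthogonal_to_cross_product[OF cross nz])
    finally show ?thesis .
  qed
  show "conic_conditions a d (x1, y1) (x2, y2) c e g \<longleftrightarrow>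
      (\<exists>l. c = l * c0 \<and> e = l * e0 \<and> g = l * g0)"
    by (rule conditions)
  have "conic_conditions a d (x1, y1) (x2, y2) c0 e0 g0"
    unfolding conditions by (intro exI[of _ 1]) simp
  then have on: "on_conic c0 e0 g0 (x1, y1)" "on_conic c0 e0 g0 (x2, y2)"
    by (simp_all add: conic_conditions_def)
  note roots_y = norm_cubic_y_root[OF P1 on(1)] norm_cubic_y_root[OF P2 on(2)]
  note roots_x = norm_cubic_x_root[OF P1 on(1)] norm_cubic_x_root[OF P2 on(2)]
  define D where "D = d * x1 * x2 * y1 * y2"
  let ?SY = "2 * e0 * g0 - e0 ^ 2 - d * c0 ^ 2 + (e0 ^ 2 - d * c0 ^ 2) * (y1 + y2 + y3)"
  let ?SX = "2 * c0 * (a * e0 - d * g0) + (a * e0 ^ 2 - d * g0 ^ 2) * (x1 + x2 - x3)"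
  have "?SY = 0 \<and> ?SX = 0"
    using add
  proof (cases rule: edwards_add_cases)
    case 1
    note 1 = 1[folded D_def]
    have "(1 - D) * ?SY = (1 - D) * (2 * e0 * g0 - e0 ^ 2 - d * c0 ^ 2
        + (e0 ^ 2 - d * c0 ^ 2) * (y1 + y2)) + (e0 ^ 2 - d * c0 ^ 2) * (y3 * (1 - D))"
      by algebra
    also have "\<dots> = (-(d*x1*y1^2*x2^3*y2) + d*x1*y1*x2^3*y2^2 - d*x1*y1*x2^3*y2 + d*x1*x2^3*y2^2
          - x1*x2*y2^2 - 2*x1*x2*y2 - x1*x2 + y1*x2^2*y2 + y1*x2^2 + x2^2*y2 + x2^2)
        * (a * x1 ^ 2 + y1 ^ 2 - (1 + d * x1 ^ 2 * y1 ^ 2))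
      + (d*x1^3*y1^2*x2*y2 + d*x1^3*y1^2*x2 - d*x1^3*y1*x2*y2^2 - d*x1^3*y1*x2*y2 + x1^2*y1*y2
          + x1^2*y1 + x1^2*y2 + x1^2 - x1*y1^2*x2 - 2*x1*y1*x2 - x1*x2)
        * (a * x2 ^ 2 + y2 ^ 2 - (1 + d * x2 ^ 2 * y2 ^ 2))"
      unfolding 1(4) unfolding D_def c0 e0 g0 by algebra
    also have "\<dots> = 0" unfolding E1 E2 by simp
    finally have SY: "?SY = 0" using 1(2) mult_eq_0_iff by blast
    have "(1 + D) * ?SX = (1 + D) * (2 * c0 * (a * e0 - d * g0)
        + (a * e0 ^ 2 - d * g0 ^ 2) * (x1 + x2)) - (a * e0 ^ 2 - d * g0 ^ 2) * (x3 * (1 + D))"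
      by algebra
    also have "\<dots> = (d*x1^2*y1*x2*y2^3 + 2*d*x1^2*y1*x2*y2^2 + d*x1^2*y1*x2*y2 - d*x1*y1*x2^2*y2^3
          - 2*d*x1*y1*x2^2*y2^2 - d*x1*y1*x2^2*y2 - x1*y2^3 - x1*y2^2 + x1*y2 + x1 + y1*x2*y2^2
          - y1*x2 + x2*y2^2 - x2)
        * (a * x1 ^ 2 + y1 ^ 2 - (1 + d * x1 ^ 2 * y1 ^ 2))
      + (-(d*x1^2*y1^3*x2*y2) - 2*d*x1^2*y1^2*x2*y2 - d*x1^2*y1*x2*y2 + d*x1*y1^3*x2^2*y2
          + 2*d*x1*y1^2*x2^2*y2 + d*x1*y1*x2^2*y2 + x1*y1^2*y2 + x1*y1^2 - x1*y2 - x1 - y1^3*x2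
          - y1^2*x2 + y1*x2 + x2)
        * (a * x2 ^ 2 + y2 ^ 2 - (1 + d * x2 ^ 2 * y2 ^ 2))"
      unfolding 1(3) unfolding D_def c0 e0 g0 by algebra
    also have "\<dots> = 0" unfolding E1 E2 by simp
    finally have "?SX = 0" using 1(1) mult_eq_0_iff by blast
    then show ?thesis using SY by simp
  next
    case 2
    define m where "m = a * x1 * x2 + y1 * y2"
    define n where "n = x1 * y2 - y1 * x2"
    note 2 = 2[folded m_def n_def]
    have "n * ?SY = n * (2 * e0 * g0 - e0 ^ 2 - d * c0 ^ 2
        + (e0 ^ 2 - d * c0 ^ 2) * (y1 + y2)) + (e0 ^ 2 - d * c0 ^ 2) * (y3 * n)"
      by algebra
    also have "\<dots> = (x1*y1*x2^2*y2 + x1*y1*x2^2 - x1*x2^2*y2^2 - x1*x2^2*y2 - y1^2*x2^3 + y1*x2^3*y2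
          - y1*x2^3 + x2^3*y2)
        * (a * x1 ^ 2 + y1 ^ 2 - (1 + d * x1 ^ 2 * y1 ^ 2))
      + (-(x1^3*y1*y2) - x1^3*y1 + x1^3*y2^2 + x1^3*y2 + x1^2*y1^2*x2 - x1^2*y1*x2*y2 + x1^2*y1*x2
          - x1^2*x2*y2)
        * (a * x2 ^ 2 + y2 ^ 2 - (1 + d * x2 ^ 2 * y2 ^ 2))"
      unfolding 2(4) unfolding n_def c0 e0 g0 by algebra
    also have "\<dots> = 0" unfolding E1 E2 by simp
    finally have SY: "?SY = 0" using 2(2) mult_eq_0_iff by blast
    have "m * ?SX = m * (2 * c0 * (a * e0 - d * g0)
        + (a * e0 ^ 2 - d * g0 ^ 2) * (x1 + x2)) - (a * e0 ^ 2 - d * g0 ^ 2) * (x3 * m)"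
      by algebra
    also have "\<dots> = (a*x1^2*x2*y2^2 + 2*a*x1^2*x2*y2 + a*x1^2*x2 - a*x1*x2^2*y2^2
          - 2*a*x1*x2^2*y2 - a*x1*x2^2 - a*y1^2*x2^3 - 2*a*y1*x2^3 - a*x2^3 + d*y1^2*x2^3*y2^2
          + 2*d*y1*x2^3*y2^2 + d*x2^3*y2^2 + x1*y1*y2^3 + x1*y1*y2^2 - x1*y1*y2 - x1*y1
          - y1^2*x2*y2^2 + y1^2*x2 - y1*x2*y2^3 - 2*y1*x2*y2^2 + y1*x2*y2 + 2*y1*x2 - x2*y2^3
          - x2*y2^2 + x2*y2 + x2)
        * (a * x1 ^ 2 + y1 ^ 2 - (1 + d * x1 ^ 2 * y1 ^ 2))
      + (a*x1*y1^2*x2^2 + 2*a*x1*y1*x2^2 + a*x1*x2^2 - d*x1^2*y1^4*x2 - 2*d*x1^2*y1^3*x2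
          - d*x1^2*y1^2*x2 - x1*y1^3*y2 - x1*y1^3 + x1*y1*y2 + x1*y1 + y1^4*x2 + y1^3*x2*y2
          + 2*y1^3*x2 + y1^2*x2*y2 - y1*x2*y2 - 2*y1*x2 - x2*y2 - x2)
        * (a * x2 ^ 2 + y2 ^ 2 - (1 + d * x2 ^ 2 * y2 ^ 2))"
      unfolding 2(3) unfolding m_def c0 e0 g0 by algebra
    also have "\<dots> = 0" unfolding E1 E2 by simp
    finally have "?SX = 0" using 2(1) mult_eq_0_iff by blast
    then show ?thesis using SY by simp
  qed
  then have sums: "2 * e0 * g0 - e0 ^ 2 - d * c0 ^ 2 = - (e0 ^ 2 - d * c0 ^ 2) * (y1 + y2 + y3)"
    "2 * c0 * (a * e0 - d * g0) = - (a * e0 ^ 2 - d * g0 ^ 2) * (x1 + x2 + - x3)"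
    by (simp_all only: minus_mult_left[symmetric] eq_neg_iff_add_eq_0 diff_conv_add_uminus)
  show "norm_cubic_y a d c0 e0 g0 y1 y2 y3"
  proof (cases "y1 = y2")
    case False
    then show ?thesis unfolding norm_cubic_y_def
      by (rule cubic_with_roots_distinct[OF _ sums(1) roots_y])
  next
    case True
    \<comment> \<open>The two known roots coincide without a derivative condition. Since
      \<open>\<phi>\<close> now splits as \<open>e0 * x * (y - y1)\<close>, the coefficients are
      compared directly, with \<open>y3 = 1\<close> from the sum of the roots.\<close>
    then have x: "x2 = - x1" using same_y P1(1) P2(1) neq by auto
    have c: "c0 = 0" and e: "e0 = 2 * x1 * (1 + y1)" and g: "g0 = - e0 * y1"
      unfolding c0 e0 g0 x using True by (simp_all add: algebra_simps)
    have "x1 \<noteq> 0" using neq x True by auto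
    then have "e0 \<noteq> 0" using e y(1) two by simp
    moreover have "e0 ^ 2 * (1 - y3) = 0"
      using sums(1) unfolding c g True[symmetric] by (simp add: algebra_simps power2_eq_square)
    ultimately have "y3 = 1" by simp
    then show ?thesis unfolding norm_cubic_y_def cubic_with_roots_def c g True[symmetric]
      by (simp add: algebra_simps power2_eq_square)
  qed
  show "norm_cubic_x a d c0 e0 g0 x1 x2 (- x3)"
  proof (cases "x1 = x2")
    case False
    then show ?thesis unfolding norm_cubic_x_def
      by (rule cubic_with_roots_distinct[OF _ sums(2) roots_x])
  next
    case True
    \<comment> \<open>Here \<open>\<phi>\<close> splits as \<open>e0 * (1 + y) * (x - x1)\<close>,
      and the sum of the roots leaves \<open>x3 = 0\<close>.\<close>
    then have y2: "y2 = - y1" using same_x P1(1) P2(1) neq by auto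
    have c: "c0 = - x1 * e0" and e: "e0 = - 2 * x1 * y1" and g: "g0 = e0"
      unfolding c0 e0 g0 y2 using True by (simp_all add: algebra_simps)
    have "y1 \<noteq> 0" using neq y2 True by auto
    moreover have "x1 \<noteq> 0"
    proof
      assume "x1 = 0"
      then have "y1 = 1" "y2 = 1" using True x_eq_0_imp P1 P2 by auto
      then show False using neq True by simp
    qed
    ultimately have "e0 \<noteq> 0" using e two by simp
    moreover have "(a - d) * e0 ^ 2 * x3 = 0"
      using sums(2) unfolding c g True[symmetric] by (auto simp: algebra_simps power2_eq_square)
    ultimately have "x3 = 0" using a_neq_d by simp
    then show ?thesis unfolding norm_cubic_x_def cubic_with_roots_def c g True[symmetric]
      by (simp add: algebra_simps power2_eq_square)
  qed
qed

text \<open>If one of the points is \<open>(0, -1)\<close>, the order-two case applies, also when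
  both are; otherwise the points are equal or distinct. In every case the solution space is a
  line.\<close>

theorem conic_solution:
  assumes P1: "P1 \<in> edwards_points a d" and P2: "P2 \<in> edwards_points a d"
    and add: "edwards_add a d P1 P2 = Some (x3, y3)"
  obtains c0 e0 g0 where "(c0, e0, g0) \<noteq> (0, 0, 0)"
    and "\<And>c e g. conic_conditions a d P1 P2 c e g \<longleftrightarrow>
      (\<exists>l. c = l * c0 \<and> e = l * e0 \<and> g = l * g0)"
    and "norm_cubic_y a d c0 e0 g0 (snd P1) (snd P2) y3"
    and "norm_cubic_x a d c0 e0 g0 (fst P1) (fst P2) (- x3)"
proof -
  obtain x1 y1 x2 y2 where P: "P1 = (x1, y1)" "P2 = (x2, y2)" by (cases P1, cases P2)
  consider "P1 = (0, -1)" | "P2 = (0, -1)" | "y1 \<noteq> -1" "y2 \<noteq> -1" "P1 = P2"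
    | "y1 \<noteq> -1" "y2 \<noteq> -1" "P1 \<noteq> P2"
    using y_minus_one P1 P2 unfolding P by blast
  then show thesis
  proof cases
    case 1
    note conic_solution_order_two[OF P2[unfolded P] add[unfolded 1 P]]
    then show thesis using that[of "- x2" 1 1] 1 P by simp
  next
    case 2
    have add': "edwards_add a d (0, -1) (x1, y1) = Some (x3, y3)"
      using add edwards_add_commute unfolding 2 P by metis
    note conic_solution_order_two[OF P1[unfolded P] add']
    then show thesis using that[of "- x1" 1 1] 2 P
      by (simp add: conic_conditions_commute norm_cubic_commute)
  next
    case 3
    have add': "edwards_add a d (x1, y1) (x1, y1) = Some (x3, y3)" using add 3 P by simp
    note S = conic_solution_double[OF P1[unfolded P] 3(1) add' refl refl refl]
    have "P1 = (x1, y1)" "P2 = (x1, y1)" using 3(3) P by simp_all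
    then show thesis by (intro that[OF S(1)]) (simp_all only: S fst_conv snd_conv)
  next
    case 4
    note S = conic_solution_distinct[OF P1[unfolded P] 4(1) P2[unfolded P] 4(2) 4(3)[unfolded P]
        add[unfolded P] refl refl refl]
    show thesis unfolding P by (rule that[unfolded P fst_conv snd_conv, OF S])
  qed
qed

end

section \<open>Discrete valuation rings\<close>

locale discrete_valuation_ring =
  fixes R :: "'f::field set"
  assumes add_mem: "x \<in> R \<Longrightarrow> y \<in> R \<Longrightarrow> x + y \<in> R"
    and mult_mem: "x \<in> R \<Longrightarrow> y \<in> R \<Longrightarrow> x * y \<in> R"
    and uminus_mem: "x \<in> R \<Longrightarrow> - x \<in> R"
    and ex_uniformizer: "\<exists>t. uniformizer R t"
begin

abbreviation v :: "'f \<Rightarrow> int" where "v \<equiv> ord_at R"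

lemma units_iff: "u \<in> units_of_subring R \<longleftrightarrow> u \<noteq> 0 \<and> u \<in> R \<and> inverse u \<in> R"
  by (auto simp: units_of_subring_def)

lemma unit_mult: "u \<in> units_of_subring R \<Longrightarrow> w \<in> units_of_subring R \<Longrightarrow> u * w \<in> units_of_subring R"
  by (simp add: units_iff mult_mem)

lemma unit_inverse: "u \<in> units_of_subring R \<Longrightarrow> inverse u \<in> units_of_subring R"
  by (simp add: units_iff)

lemma ex_unit_powi:
  assumes "uniformizer R t" and "z \<noteq> 0"
  shows "\<exists>n. \<exists>u\<in>units_of_subring R. z = u * t powi n"
  using assms unfolding uniformizer_def by blast

text \<open>The set \<open>R\<close> is not assumed to contain \<open>1\<close>; factoring
  \<open>1\<close> through a uniformizer produces some unit \<open>u\<close>, and then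
  \<open>u * inverse u\<close> is a unit.\<close>

lemma one_unit: "1 \<in> units_of_subring R"
proof -
  obtain t where "uniformizer R t" using ex_uniformizer by blast
  then obtain u where "u \<in> units_of_subring R" using ex_unit_powi[of t 1] by auto
  then have "u * inverse u \<in> units_of_subring R" using unit_mult unit_inverse by blast
  then show ?thesis using \<open>u \<in> _\<close> by (auto simp: units_iff)
qed

lemma one_mem: "1 \<in> R"
  using one_unit by (simp add: units_iff)

lemma zero_mem: "0 \<in> R"
  using add_mem[OF one_mem uminus_mem[OF one_mem]] by simp

lemma power_mem: "x \<in> R \<Longrightarrow> x ^ n \<in> R"
  by (induction n) (auto intro: one_mem mult_mem)

lemma unit_powi: 
  assumes "u \<in> units_of_subring R"
  shows "u powi n \<in> units_of_subring R"
proof -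
  have *: "w ^ k \<in> units_of_subring R" if "w \<in> units_of_subring R" for w k
    using that by (induction k) (auto intro: one_unit unit_mult)
  show ?thesis using *[OF assms] *[OF unit_inverse[OF assms]] by (auto simp: power_int_def)
qed

text \<open>A nonzero exponent would put \<open>t powi - \<bar>n\<bar>\<close> into
  \<open>R\<close>, and multiplying by the power of \<open>t\<close> with exponent
  \<open>\<bar>n\<bar> - 1\<close> would give \<open>inverse t\<close>.\<close>

lemma uniformizer_powi_unit:
  assumes t: "uniformizer R t" and "t powi n \<in> units_of_subring R"
  shows "n = 0"
proof (rule ccontr)
  assume "n \<noteq> 0"
  have t': "t \<in> R" "t \<noteq> 0" "inverse t \<notin> R" using t by (auto simp: uniformizer_def)
  have "inverse (t powi n) \<in> units_of_subring R" using assms(2) unit_inverse by blast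
  then have "t powi - \<bar>n\<bar> \<in> units_of_subring R"
    using assms(2) by (auto simp: abs_if power_int_minus)
  then have "t powi - \<bar>n\<bar> \<in> R" by (simp add: units_iff)
  moreover have "t ^ nat (\<bar>n\<bar> - 1) \<in> R" using t' power_mem by blast
  ultimately have "t powi - \<bar>n\<bar> * t ^ nat (\<bar>n\<bar> - 1) \<in> R" by (rule mult_mem)
  moreover have "t ^ nat (\<bar>n\<bar> - 1) = t powi (\<bar>n\<bar> - 1)" using \<open>n \<noteq> 0\<close> by (simp add: power_int_def)
  ultimately have "t powi (- \<bar>n\<bar> + (\<bar>n\<bar> - 1)) \<in> R"
    using t'(2) by (subst power_int_add) auto
  then show False using t' by (simp add: power_int_minus)
qed

text \<open>\<open>ord_at\<close> lets the uniformizer vary, so independence of this choice is at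
  stake. Two uniformizers are units times powers of each other with exponents satisfying
  \<open>k * l = 1\<close>, and \<open>k = - 1\<close> would put \<open>inverse t'\<close> into
  \<open>R\<close>.\<close>

lemma ord_eq:
  assumes t: "uniformizer R t" and u: "u \<in> units_of_subring R" and z: "z = u * t powi n"
  shows "v z = n"
  unfolding ord_at_def
proof (rule the_equality)
  show "\<exists>t. uniformizer R t \<and> (\<exists>u\<in>units_of_subring R. z = u * t powi n)"
    using assms by blast
next
  fix m
  assume "\<exists>t. uniformizer R t \<and> (\<exists>u\<in>units_of_subring R. z = u * t powi m)"
  then obtain t' u' where t': "uniformizer R t'" and u': "u' \<in> units_of_subring R"
    and z': "z = u' * t' powi m" by blast
  have t0: "t \<noteq> 0" "t \<in> R" "t' \<noteq> 0" "inverse t' \<notin> R" using t t' by (auto simp: uniformizer_def)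
  obtain k w where w: "w \<in> units_of_subring R" "t' = w * t powi k"
    using ex_unit_powi[OF t t0(3)] by blast
  obtain l w' where w': "w' \<in> units_of_subring R" "t = w' * t' powi l"
    using ex_unit_powi[OF t' t0(1)] by blast
  have nz: "w \<noteq> 0" "w' \<noteq> 0" "u \<noteq> 0" "u' \<noteq> 0" using w w' u u' by (auto simp: units_iff)
  have "t = w' * w powi l * t powi (k * l)"
    by (subst w'(2)) (simp only: w(2) power_int_mult_distrib power_int_mult mult.assoc)
  then have "t powi (k * l - 1) = inverse (w' * w powi l)"
    using t0(1) nz by (simp add: power_int_diff field_simps)
  moreover have "inverse (w' * w powi l) \<in> units_of_subring R"
    using w(1) w'(1) by (intro unit_inverse unit_mult unit_powi)
  ultimately have "t powi (k * l - 1) \<in> units_of_subring R" by simp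
  then have "k * l = 1" using uniformizer_powi_unit[OF t] by fastforce
  moreover have "k \<noteq> - 1"
  proof
    assume "k = - 1"
    then have "inverse t' = inverse w * t" using w(2) by (simp add: power_int_minus)
    then show False using t0 w(1) mult_mem by (simp add: units_iff)
  qed
  ultimately have "k = 1" by (auto simp: zmult_eq_1_iff)
  then have "u * t powi n = u' * w powi m * t powi m"
    using z z' w(2) by (simp add: power_int_mult_distrib mult.assoc)
  then have "t powi (n - m) = u' * w powi m * inverse u"
    using t0(1) nz by (simp add: power_int_diff field_simps)
  moreover have "u' * w powi m * inverse u \<in> units_of_subring R"
    using w(1) u u' by (intro unit_inverse unit_mult unit_powi)
  ultimately have "t powi (n - m) \<in> units_of_subring R" by simp
  then show "m = n" using uniformizer_powi_unit[OF t] by fastforce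
qed

lemma ord_rep:
  assumes "uniformizer R t" and "z \<noteq> 0"
  obtains u where "u \<in> units_of_subring R" "z = u * t powi v z"
proof -
  obtain n u where *: "u \<in> units_of_subring R" "z = u * t powi n" using ex_unit_powi[OF assms] by blast
  with ord_eq[OF assms(1) this] show thesis using that by blast
qed

lemma ord_unit: "u \<in> units_of_subring R \<Longrightarrow> v u = 0"
  using ex_uniformizer ord_eq[of _ u u 0] by auto

lemma ord_uniformizer: "uniformizer R t \<Longrightarrow> v t = 1"
  using ord_eq[of t 1 t 1] one_unit by auto

lemma ord_one [simp]: "v 1 = 0"
  using ord_unit one_unit by blast

lemma ord_mult:
  assumes "z \<noteq> 0" "w \<noteq> 0"
  shows "v (z * w) = v z + v w"
proof -
  obtain t where t: "uniformizer R t" using ex_uniformizer by blast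
  obtain u where u: "u \<in> units_of_subring R" "z = u * t powi v z" using ord_rep[OF t assms(1)] .
  obtain u' where u': "u' \<in> units_of_subring R" "w = u' * t powi v w" using ord_rep[OF t assms(2)] .
  have "t \<noteq> 0" using t by (simp add: uniformizer_def)
  have "z * w = (u * t powi v z) * (u' * t powi v w)" using u(2) u'(2) by simp
  also have "\<dots> = (u * u') * t powi (v z + v w)"
    using \<open>t \<noteq> 0\<close> by (simp add: power_int_add)
  finally show ?thesis by (rule ord_eq[OF t unit_mult[OF u(1) u'(1)]])
qed

lemma ord_inverse: "z \<noteq> 0 \<Longrightarrow> v (inverse z) = - v z"
  using ord_mult[of z "inverse z"] by simp

lemma ord_divide: "z \<noteq> 0 \<Longrightarrow> w \<noteq> 0 \<Longrightarrow> v (z / w) = v z - v w"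
  by (simp add: divide_inverse ord_mult ord_inverse)

lemma ord_power: "z \<noteq> 0 \<Longrightarrow> v (z ^ n) = int n * v z"
  by (induction n) (simp_all add: ord_mult algebra_simps)

lemma mem_iff:
  assumes "z \<noteq> 0"
  shows "z \<in> R \<longleftrightarrow> 0 \<le> v z"
proof -
  obtain t where t: "uniformizer R t" using ex_uniformizer by blast
  then have t': "t \<in> R" "t \<noteq> 0" "inverse t \<notin> R" by (auto simp: uniformizer_def)
  obtain u where u: "u \<in> units_of_subring R" "z = u * t powi v z" using ord_rep[OF t assms] .
  show ?thesis
  proof
    assume "0 \<le> v z"
    then have "t powi v z \<in> R" using power_mem[OF t'(1)] by (simp add: power_int_def)
    then show "z \<in> R" using u mult_mem by (metis units_iff)
  next
    assume "z \<in> R"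
    show "0 \<le> v z"
    proof (rule ccontr)
      assume "\<not> 0 \<le> v z"
      \<comment> \<open>A nonnegative power of \<open>t\<close> raises the exponent to
        \<open>-1\<close>, which yields \<open>inverse t\<close> in \<open>R\<close>.\<close>
      then have "t powi v z * t ^ nat (- v z - 1) = t powi v z * t powi (- v z - 1)"
        by (simp add: power_int_def)
      also have "\<dots> = t powi (v z + (- v z - 1))"
        by (rule power_int_add[symmetric]) (simp add: t'(2))
      also have "\<dots> = inverse t" by (simp add: power_int_minus)
      finally have "inverse t = (inverse u * u) * (t powi v z * t ^ nat (- v z - 1))"
        using u(1) by (simp add: units_iff)
      also have "\<dots> = inverse u * z * t ^ nat (- v z - 1)"
        by (subst (3) u(2)) (simp only: mult.assoc)
      finally have "inverse t = inverse u * z * t ^ nat (- v z - 1)" .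
      moreover have "inverse u * z * t ^ nat (- v z - 1) \<in> R"
        using u(1) t'(1) \<open>z \<in> R\<close> by (intro mult_mem power_mem) (auto simp: units_iff)
      ultimately show False using t'(3) by simp
    qed
  qed
qed

lemma unit_iff: "z \<noteq> 0 \<Longrightarrow> z \<in> units_of_subring R \<longleftrightarrow> v z = 0"
  using mem_iff[of z] mem_iff[of "inverse z"] by (auto simp: units_iff ord_inverse)

text \<open>The order of \<open>0\<close>, which is junk in \<^const>\<open>ord_at\<close>, is infinite here.\<close>

definition ord_ge :: "int \<Rightarrow> 'f \<Rightarrow> bool" where
  "ord_ge n z \<longleftrightarrow> z = 0 \<or> n \<le> v z"

lemma ord_ge_0 [simp]: "ord_ge n 0"
  by (simp add: ord_ge_def)

lemma mem_iff_ord_ge: "z \<in> R \<longleftrightarrow> ord_ge 0 z"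
  by (cases "z = 0") (auto simp: ord_ge_def mem_iff zero_mem)

lemma ord_ge_mono: "ord_ge n z \<Longrightarrow> m \<le> n \<Longrightarrow> ord_ge m z"
  by (auto simp: ord_ge_def)

lemma ord_ge_mult: "ord_ge m z \<Longrightarrow> ord_ge n w \<Longrightarrow> ord_ge (m + n) (z * w)"
  by (cases "z = 0 \<or> w = 0") (auto simp: ord_ge_def ord_mult)

lemma ord_uminus [simp]: "v (- z) = v z"
proof (cases "z = 0")
  case False
  have "inverse (- 1) = (- 1 :: 'f)" by simp
  then have "- 1 \<in> units_of_subring R" using uminus_mem[OF one_mem] by (simp add: units_iff)
  then have "v (- 1 * z) = v z" using False ord_mult[of "- 1" z] ord_unit by simp
  then show ?thesis by simp
qed simp

lemma ord_ge_uminus [simp]: "ord_ge n (- z) \<longleftrightarrow> ord_ge n z"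
  by (simp add: ord_ge_def)

text \<open>Shifting by a power of \<open>t\<close> reduces bounds on orders to membership in
  \<open>R\<close>, so closure under addition becomes the ultrametric inequality.\<close>

lemma ord_ge_scale:
  assumes t: "uniformizer R t"
  shows "ord_ge n z \<longleftrightarrow> z * t powi (- n) \<in> R"
proof (cases "z = 0")
  case False
  have "t \<noteq> 0" using t by (simp add: uniformizer_def)
  moreover have "v (t powi (- n)) = - n" using ord_eq[OF t one_unit] by simp
  ultimately show ?thesis using False by (simp add: ord_ge_def mem_iff ord_mult)
qed (simp add: zero_mem)

lemma ord_ge_add: "ord_ge n z \<Longrightarrow> ord_ge n w \<Longrightarrow> ord_ge n (z + w)"
proof -
  obtain t where t: "uniformizer R t" using ex_uniformizer by blast
  assume "ord_ge n z" "ord_ge n w"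
  then show ?thesis using add_mem unfolding ord_ge_scale[OF t] distrib_right by blast
qed

lemma ord_ge_diff: "ord_ge n z \<Longrightarrow> ord_ge n w \<Longrightarrow> ord_ge n (z - w)"
  using ord_ge_add[of n z "- w"] by simp

lemma ord_add_eq:
  assumes "z \<noteq> 0" and "ord_ge (v z + 1) w"
  shows "z + w \<noteq> 0" and "v (z + w) = v z"
proof -
  have z: "\<not> ord_ge (v z + 1) z" using assms(1) by (simp add: ord_ge_def)
  have *: "\<not> ord_ge (v z + 1) (z + w)"
    using z ord_ge_diff[OF _ assms(2), of "z + w"] by auto
  then show "z + w \<noteq> 0" by auto
  moreover have "ord_ge (v z) (z + w)"
    using ord_ge_add[OF _ ord_ge_mono[OF assms(2)], of "v z" z] by (simp add: ord_ge_def)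
  ultimately show "v (z + w) = v z" using * by (simp add: ord_ge_def)
qed

text \<open>Orders add, so two factors of order \<open>0\<close> have a product of order
  \<open>0\<close>: the maximal ideal is prime.\<close>

lemma ord_ge_1_mult:
  assumes "ord_ge 1 (z * w)" and "z \<in> R" "w \<in> R"
  shows "ord_ge 1 z \<or> ord_ge 1 w"
proof (rule ccontr)
  assume "\<not> ?thesis"
  then have "z \<noteq> 0" "w \<noteq> 0" "v z < 1" "v w < 1" by (auto simp: ord_ge_def)
  moreover then have "v z = 0" "v w = 0" using assms(2,3) mem_iff[of z] mem_iff[of w] by auto
  ultimately show False using assms(1) by (simp add: ord_ge_def ord_mult)
qed

end

section \<open>The function field of an Edwards curve\<close>

definition X2 :: "'k::comm_ring_1 poly poly" where "X2 = [:[:0, 1:]:]"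
definition Y2 :: "'k::comm_ring_1 poly poly" where "Y2 = [:0, 1:]"

lemma const2_simps [simp]:
  "const2 0 = 0" "const2 1 = 1" "const2 (c + c') = const2 c + const2 c'"
  "const2 (c * c') = const2 c * const2 c'" "const2 (- c) = - const2 c"
  "const2 (c - c') = const2 c - const2 c'"
  by (simp_all add: const2_def one_pCons)

lemma const2_power [simp]: "const2 (c ^ n) = const2 c ^ n"
  by (induction n) auto

lemma eval2_simps [simp]:
  "eval2 0 P = 0" "eval2 1 P = 1" "eval2 (p + q) P = eval2 p P + eval2 q P"
  "eval2 (p * q) P = eval2 p P * eval2 q P" "eval2 (- p) P = - eval2 p P"
  "eval2 (p - q) P = eval2 p P - eval2 q P" "eval2 (p ^ n) P = eval2 p P ^ n"
  "eval2 (const2 c) P = c" "eval2 X2 P = fst P" "eval2 Y2 P = snd P"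
  by (simp_all add: eval2_def const2_def X2_def Y2_def poly_power)

text \<open>Division by the linear factor in the outer variable leaves a remainder in
  \<open>K[x]\<close>, which is then divided by the linear factor in \<open>x\<close>. This gives
  generators of the ideal of the point.\<close>

lemma taylor_expansion:
  fixes p :: "'k::field poly poly"
  obtains r s where "p = const2 (eval2 p P) + (X2 - const2 (fst P)) * r + (Y2 - const2 (snd P)) * s"
proof -
  define p0 where "p0 = poly p [:snd P:]"
  have "poly (p - [:p0:]) [:snd P:] = 0" by (simp add: p0_def)
  then obtain s where s: "p - [:p0:] = (Y2 - const2 (snd P)) * s"
    unfolding poly_eq_0_iff_dvd Y2_def const2_def by (auto elim!: dvdE)
  have "poly (p0 - [:eval2 p P:]) (fst P) = 0" by (simp add: p0_def eval2_def)
  then obtain r where "p0 - [:eval2 p P:] = [:- fst P, 1:] * r"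
    unfolding poly_eq_0_iff_dvd by (auto elim!: dvdE)
  then have "[:p0:] - const2 (eval2 p P) = [:[:- fst P, 1:] * r:]"
    by (simp add: const2_def)
  also have "\<dots> = (X2 - const2 (fst P)) * [:r:]"
    by (simp add: X2_def const2_def)
  finally have r: "[:p0:] - const2 (eval2 p P) = (X2 - const2 (fst P)) * [:r:]" .
  have "p = const2 (eval2 p P) + ([:p0:] - const2 (eval2 p P)) + (p - [:p0:])" by simp
  also have "\<dots> = const2 (eval2 p P) + (X2 - const2 (fst P)) * [:r:] + (Y2 - const2 (snd P)) * s"
    by (simp only: r s)
  finally have "p = const2 (eval2 p P) + (X2 - const2 (fst P)) * [:r:] + (Y2 - const2 (snd P)) * s" .
  then show thesis by (rule that)
qed

abbreviation curve_poly :: "'k::field \<Rightarrow> 'k \<Rightarrow> 'k poly poly" where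
  "curve_poly a d \<equiv> dehomogenize (edwards_quartic a d)"

lemma curve_poly_eq:
  "curve_poly a d = const2 a * X2 ^ 2 + Y2 ^ 2 - 1 - const2 d * X2 ^ 2 * Y2 ^ 2"
  by (simp add: dehomogenize_def edwards_quartic_def const3_def const2_def VX_def VY_def VZ_def
      X2_def Y2_def poly_power)

lemma curve_poly_pCons: "curve_poly a d = [:[:- 1, 0, a:], 0, [:1, 0, - d:]:]"
  by (simp add: curve_poly_eq const2_def X2_def Y2_def power2_eq_square one_pCons)

lemma eval2_curve_poly: "eval2 (curve_poly a d) P = 0 \<longleftrightarrow> P \<in> edwards_points a d"
  by (cases P) (simp add: curve_poly_eq edwards_points_def algebra_simps)

section \<open>The function field as a quadratic extension of \<open>K(x)\<close>\<close>

locale edwards_function_field = edwards_curve a d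
  for a d :: "'k::field" +
  fixes \<pi> :: "'k poly poly \<Rightarrow> 'f::field"
  assumes function_field: "is_function_field (curve_poly a d) \<pi>"
begin

lemma \<pi>_one [simp]: "\<pi> 1 = 1"
  and \<pi>_add [simp]: "\<pi> (p + q) = \<pi> p + \<pi> q"
  and \<pi>_mult [simp]: "\<pi> (p * q) = \<pi> p * \<pi> q"
  and \<pi>_eq_0_iff: "\<pi> p = 0 \<longleftrightarrow> curve_poly a d dvd p"
  and \<pi>_surj: "\<exists>p q. \<pi> q \<noteq> 0 \<and> z = \<pi> p / \<pi> q"
  using function_field by (auto simp: is_function_field_def)

lemma \<pi>_zero [simp]: "\<pi> 0 = 0"
  by (simp add: \<pi>_eq_0_iff)

lemma \<pi>_uminus [simp]: "\<pi> (- p) = - \<pi> p"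
  using \<pi>_add[of "- p" p] by (simp add: eq_neg_iff_add_eq_0 del: \<pi>_add)

lemma \<pi>_diff [simp]: "\<pi> (p - q) = \<pi> p - \<pi> q"
  using \<pi>_add[of p "- q"] by (simp del: \<pi>_add)

lemma \<pi>_power [simp]: "\<pi> (p ^ n) = \<pi> p ^ n"
  by (induction n) auto

definition \<kappa> :: "'k \<Rightarrow> 'f" where "\<kappa> c = \<pi> (const2 c)"
definition x :: 'f where "x = \<pi> X2"
definition y :: 'f where "y = \<pi> Y2"

lemma \<kappa>_simps [simp]:
  "\<kappa> 0 = 0" "\<kappa> 1 = 1" "\<kappa> (c + c') = \<kappa> c + \<kappa> c'" "\<kappa> (c * c') = \<kappa> c * \<kappa> c'"
  "\<kappa> (- c) = - \<kappa> c" "\<kappa> (c - c') = \<kappa> c - \<kappa> c'"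
  by (simp_all add: \<kappa>_def)

lemma \<kappa>_power [simp]: "\<kappa> (c ^ n) = \<kappa> c ^ n"
  by (induction n) auto

lemma \<kappa>_2 [simp]: "\<kappa> 2 = 2"
  using \<kappa>_simps(3)[of 1 1] by (simp del: \<kappa>_simps(3))

lemma \<kappa>_eq_0_iff [simp]: "\<kappa> c = 0 \<longleftrightarrow> c = 0"
proof
  show "c = 0" if "\<kappa> c = 0"
  proof (rule ccontr)
    assume "c \<noteq> 0"
    then have "\<kappa> c * \<kappa> (inverse c) = \<kappa> 1" by (metis \<kappa>_simps(4) right_inverse)
    then show False using that by simp
  qed
qed simp

lemma curve_equation: "\<kappa> a * x ^ 2 + y ^ 2 = 1 + \<kappa> d * x ^ 2 * y ^ 2"
proof -
  have "\<pi> (curve_poly a d) = 0" by (simp add: \<pi>_eq_0_iff)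
  then show ?thesis by (simp add: curve_poly_eq x_def y_def \<kappa>_def algebra_simps)
qed

lemma \<pi>_eq_0_imp_eval2:
  assumes "\<pi> p = 0" and "P \<in> edwards_points a d"
  shows "eval2 p P = 0"
  using assms by (auto simp: \<pi>_eq_0_iff eval2_curve_poly[symmetric] elim!: dvdE)

text \<open>The curve polynomial has degree two in \<open>y\<close> and cannot divide a nonzero
  polynomial of smaller degree. Thus \<open>1\<close> and \<open>y\<close> are independent over
  \<open>K[x]\<close>.\<close>

lemma \<pi>_linear_eq_0:
  assumes "\<pi> [:A, B:] = 0"
  shows "A = 0" "B = 0"
proof -
  have "[:A, B:] = 0"
  proof (rule ccontr)
    assume "[:A, B:] \<noteq> 0"
    then have "degree (curve_poly a d) \<le> degree [:A, B:]"
      using assms dvd_imp_degree_le unfolding \<pi>_eq_0_iff by blast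
    then show False by (simp add: curve_poly_pCons split: if_splits)
  qed
  then show "A = 0" "B = 0" by simp_all
qed

lemma \<pi>_const_eq_0: "\<pi> [:A:] = 0 \<Longrightarrow> A = 0"
  using \<pi>_linear_eq_0[of A 0] by simp

lemma x_neq_\<kappa>: "x - \<kappa> c \<noteq> 0"
proof
  assume "x - \<kappa> c = 0"
  then have "\<pi> (X2 - const2 c) = 0" by (simp add: x_def \<kappa>_def)
  then show False using \<pi>_const_eq_0[of "[:- c, 1:]"] by (simp add: X2_def const2_def)
qed

lemma y_neq_\<kappa>: "y - \<kappa> c \<noteq> 0"
proof
  assume "y - \<kappa> c = 0"
  then have "\<pi> (Y2 - const2 c) = 0" by (simp add: y_def \<kappa>_def)
  then show False using \<pi>_linear_eq_0[of "[:- c:]" 1] by (simp add: Y2_def const2_def one_pCons)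
qed

lemma \<pi>_mult_const: "\<pi> [:A * B:] = \<pi> [:A:] * \<pi> [:B:]"
  using \<pi>_mult[of "[:A:]" "[:B:]"] by (simp add: mult.commute del: \<pi>_mult)

lemma \<pi>_pCons: "\<pi> (pCons A p) = \<pi> [:A:] + y * \<pi> p"
proof -
  have "pCons A p = [:A:] + Y2 * p" by (simp add: Y2_def)
  then show ?thesis by (metis \<pi>_add \<pi>_mult y_def)
qed

lemma y_square: "\<pi> [:[:1, 0, - d:]:] * y ^ 2 = \<pi> [:[:1, 0, - a:]:]"
proof -
  have "\<pi> [:[:1, 0, - d:]:] = 1 - \<kappa> d * x ^ 2" "\<pi> [:[:1, 0, - a:]:] = 1 - \<kappa> a * x ^ 2"
  proof -
    have "[:[:1, 0, - c:]:] = 1 - const2 c * X2 ^ 2" for c :: 'k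
      by (simp add: const2_def X2_def power2_eq_square one_pCons)
    then show "\<pi> [:[:1, 0, - d:]:] = 1 - \<kappa> d * x ^ 2" "\<pi> [:[:1, 0, - a:]:] = 1 - \<kappa> a * x ^ 2"
      by (simp_all add: \<kappa>_def x_def)
  qed
  then show ?thesis using curve_equation by algebra
qed

text \<open>The curve polynomial is not monic in \<open>y\<close>: replacing \<open>y ^ 2\<close> by
  a polynomial in \<open>x\<close> costs a factor \<open>1 - d * x ^ 2\<close>.\<close>

lemma reduced_form: "\<exists>n A B. \<pi> [:[:1, 0, - d:]:] ^ n * \<pi> p = \<pi> [:A:] + \<pi> [:B:] * y"
proof (induction p)
  case 0
  show ?case by (intro exI[of _ 0]) simp
next
  case (pCons c p)
  define D where "D = [:1, 0, - d:]"
  define Q where "Q = [:1, 0, - a:]"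
  obtain n A B where *: "\<pi> [:D:] ^ n * \<pi> p = \<pi> [:A:] + \<pi> [:B:] * y"
    using pCons unfolding D_def by blast
  have "\<pi> [:D:] ^ Suc n * \<pi> (pCons c p) =
      \<pi> [:D:] ^ Suc n * \<pi> [:c:] + \<pi> [:D:] * y * (\<pi> [:D:] ^ n * \<pi> p)"
    by (simp add: \<pi>_pCons[of c p] algebra_simps)
  also have "\<dots> = \<pi> [:D ^ Suc n * c:] + \<pi> [:D * A:] * y + \<pi> [:B:] * (\<pi> [:D:] * y ^ 2)"
    unfolding * by (simp add: \<pi>_mult_const poly_const_pow[symmetric] algebra_simps power2_eq_square)
  also have "\<dots> = \<pi> [:D ^ Suc n * c:] + \<pi> [:B * Q:] + \<pi> [:D * A:] * y"
    unfolding y_square[folded D_def Q_def] by (simp add: \<pi>_mult_const)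
  also have "\<pi> [:D ^ Suc n * c:] + \<pi> [:B * Q:] = \<pi> [:D ^ Suc n * c + B * Q:]"
    using \<pi>_add[of "[:D ^ Suc n * c:]" "[:B * Q:]"] by (simp del: \<pi>_add)
  finally show ?case unfolding D_def by blast
qed

text \<open>
  \<open>q\<close> is the norm of \<open>p\<close> to \<open>K(x)\<close> times a power of \<open>1 - d x\<^sup>2\<close>, which clears the denominators.
\<close>

lemma ex_norm:
  assumes "\<pi> p \<noteq> 0"
  obtains p' q where "q \<noteq> 0" "\<pi> p * \<pi> p' = \<pi> [:q:]"
proof -
  define D where "D = [:1, 0, - d:]"
  obtain n A B where *: "\<pi> [:D:] ^ n * \<pi> p = \<pi> [:A:] + \<pi> [:B:] * y"
    using reduced_form unfolding D_def by blast
  have D: "\<pi> [:D:] \<noteq> 0" using \<pi>_const_eq_0[of D] by (auto simp: D_def)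
  \<comment> \<open>\<open>n\<close> factors of \<open>D\<close> bring \<open>p\<close> to the form
    \<open>A + B * y\<close>, and one more turns \<open>y ^ 2\<close> into a polynomial in
    \<open>x\<close>.\<close>
  define p' where "p' = [:D ^ Suc n:] * [:A, - B:]"
  define q where "q = A ^ 2 * D - B ^ 2 * [:1, 0, - a:]"
  have AB: "\<pi> [:A, - B:] = \<pi> [:A:] - \<pi> [:B:] * y"
    using \<pi>_pCons[of A "[:- B:]"] \<pi>_uminus[of "[:B:]"] by simp
  have p': "\<pi> p' = \<pi> [:D:] ^ Suc n * (\<pi> [:A:] - \<pi> [:B:] * y)"
    unfolding p'_def \<pi>_mult AB poly_const_pow[symmetric] \<pi>_power ..
  have "\<pi> p * \<pi> p' = (\<pi> [:D:] ^ n * \<pi> p) * (\<pi> [:D:] * (\<pi> [:A:] - \<pi> [:B:] * y))"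
    unfolding p' by (simp add: algebra_simps)
  also have "\<dots> = \<pi> [:A:] ^ 2 * \<pi> [:D:] - \<pi> [:B:] ^ 2 * (\<pi> [:D:] * y ^ 2)"
    unfolding * by (simp add: algebra_simps power2_eq_square)
  also have "\<dots> = \<pi> [:A ^ 2 * D:] - \<pi> [:B ^ 2 * [:1, 0, - a:]:]"
    unfolding y_square[folded D_def] by (simp only: \<pi>_mult_const power2_eq_square)
  also have "\<dots> = \<pi> [:q:]"
    using \<pi>_diff[of "[:A ^ 2 * D:]" "[:B ^ 2 * [:1, 0, - a:]:]"] by (simp add: q_def)
  finally have eq: "\<pi> p * \<pi> p' = \<pi> [:q:]" .
  have "\<pi> p' \<noteq> 0"
  proof
    assume "\<pi> p' = 0"
    then have "\<pi> [:A, - B:] = 0" using D unfolding p' AB by simp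
    then have "A = 0" "B = 0" using \<pi>_linear_eq_0[of A "- B"] by simp_all
    then show False using * assms D by simp
  qed
  then have "\<pi> [:q:] \<noteq> 0" using assms eq by (metis mult_eq_0_iff)
  then have "q \<noteq> 0" by auto
  then show thesis using eq that by blast
qed

section \<open>Local rings of rational points as discrete valuation rings\<close>

abbreviation local_ring :: "'k \<times> 'k \<Rightarrow> 'f set" where
  "local_ring \<equiv> place_of_point \<pi>"

text \<open>At a point of the curve with nonzero \<open>y\<close>-coordinate the derivative of the
  curve equation in \<open>y\<close> is nonzero, so \<open>x\<close> minus its value is a local
  parameter; where \<open>y\<close> vanishes, the derivative in \<open>x\<close> is nonzero and
  \<open>y\<close> serves instead.\<close>

definition uniformizer_poly :: "'k \<times> 'k \<Rightarrow> 'k poly poly" where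
  "uniformizer_poly P = (if snd P = 0 then Y2 else X2 - const2 (fst P))"

lemma eval2_uniformizer_poly: "eval2 (uniformizer_poly P) P = 0"
  by (simp add: uniformizer_poly_def)

lemma \<pi>_uniformizer_poly_nonzero: "\<pi> (uniformizer_poly P) \<noteq> 0"
  using x_neq_\<kappa>[of "fst P"] y_neq_\<kappa>[of 0] by (simp add: uniformizer_poly_def x_def y_def \<kappa>_def)

lemma fraction_mem: "eval2 q P \<noteq> 0 \<Longrightarrow> \<pi> p / \<pi> q \<in> local_ring P"
  by (auto simp: place_of_point_def)

lemma \<pi>_mem: "\<pi> p \<in> local_ring P"
  using fraction_mem[of 1 P p] by simp

text \<open>\<open>place_of_point\<close> only asks that the denominator not vanish at the point;
  for a point on the curve this makes it nonzero in the function field, so no division by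
  \<open>0\<close> occurs.\<close>

lemma local_ring_cases:
  assumes "z \<in> local_ring P" and "P \<in> edwards_points a d"
  obtains p q where "eval2 q P \<noteq> 0" "\<pi> q \<noteq> 0" "z = \<pi> p / \<pi> q"
  using assms \<pi>_eq_0_imp_eval2 unfolding place_of_point_def by blast

lemma local_ring_add:
  assumes P: "P \<in> edwards_points a d" and "z \<in> local_ring P" "w \<in> local_ring P"
  shows "z + w \<in> local_ring P"
proof -
  obtain p q where z: "eval2 q P \<noteq> 0" "\<pi> q \<noteq> 0" "z = \<pi> p / \<pi> q"
    using local_ring_cases assms by blast
  obtain p' q' where w: "eval2 q' P \<noteq> 0" "\<pi> q' \<noteq> 0" "w = \<pi> p' / \<pi> q'"
    using local_ring_cases assms by blast
  have "z + w = \<pi> (p * q' + p' * q) / \<pi> (q * q')" using z w by (simp add: field_simps)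
  then show ?thesis using fraction_mem[of "q * q'" P "p * q' + p' * q"] z w by simp
qed

lemma local_ring_mult:
  assumes P: "P \<in> edwards_points a d" and "z \<in> local_ring P" "w \<in> local_ring P"
  shows "z * w \<in> local_ring P"
proof -
  obtain p q where z: "eval2 q P \<noteq> 0" "\<pi> q \<noteq> 0" "z = \<pi> p / \<pi> q"
    using local_ring_cases assms by blast
  obtain p' q' where w: "eval2 q' P \<noteq> 0" "\<pi> q' \<noteq> 0" "w = \<pi> p' / \<pi> q'"
    using local_ring_cases assms by blast
  have "z * w = \<pi> (p * p') / \<pi> (q * q')" using z w by simp
  then show ?thesis using fraction_mem[of "q * q'" P "p * p'"] z w by simp
qed

lemma local_ring_uminus:
  assumes P: "P \<in> edwards_points a d" and "z \<in> local_ring P"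
  shows "- z \<in> local_ring P"
  using local_ring_mult[OF P \<pi>_mem[of "- 1"] assms(2)] by simp

lemma local_ring_unit:
  assumes "P \<in> edwards_points a d" and "eval2 p P \<noteq> 0"
  shows "\<pi> p \<in> units_of_subring (local_ring P)"
  using assms fraction_mem[of p P 1] \<pi>_mem[of p P] \<pi>_eq_0_imp_eval2[OF _ assms(1), of p]
  by (auto simp: units_of_subring_def inverse_eq_divide)

text \<open>The curve equation minus the same equation at \<open>P\<close>, with the term
  \<open>d * x ^ 2 * y ^ 2\<close> changed first in \<open>x\<close> and then in
  \<open>y\<close>.\<close>

lemma points_relation:
  assumes "P \<in> edwards_points a d"
  shows "(x - \<kappa> (fst P)) * ((x + \<kappa> (fst P)) * (\<kappa> a - \<kappa> d * y ^ 2)) =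
    (y - \<kappa> (snd P)) * ((y + \<kappa> (snd P)) * (\<kappa> d * \<kappa> (fst P) ^ 2 - 1))"
proof -
  have "\<kappa> (a * fst P ^ 2 + snd P ^ 2) = \<kappa> (1 + d * fst P ^ 2 * snd P ^ 2)"
    using assms by (cases P) (simp add: points_iff del: \<kappa>_simps \<kappa>_power)
  then have "\<kappa> a * \<kappa> (fst P) ^ 2 + \<kappa> (snd P) ^ 2 = 1 + \<kappa> d * \<kappa> (fst P) ^ 2 * \<kappa> (snd P) ^ 2"
    by simp
  then show ?thesis using curve_equation by algebra
qed

text \<open>\<open>x_poly\<close> and \<open>y_poly\<close> are the cofactors of the coordinate
  differences in the relation above. At \<open>P\<close> they take the values of the partial
  derivatives of the curve equation in \<open>x\<close> and, with opposite sign, in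
  \<open>y\<close>.\<close>

definition x_poly :: "'k \<times> 'k \<Rightarrow> 'k poly poly" where
  "x_poly P = (X2 + const2 (fst P)) * (const2 a - const2 d * Y2 ^ 2)"
definition y_poly :: "'k \<times> 'k \<Rightarrow> 'k poly poly" where
  "y_poly P = (Y2 + const2 (snd P)) * const2 (d * fst P ^ 2 - 1)"

lemma points_relation':
  "P \<in> edwards_points a d \<Longrightarrow> (x - \<kappa> (fst P)) * \<pi> (x_poly P) = (y - \<kappa> (snd P)) * \<pi> (y_poly P)"
  using points_relation[of P] by (simp add: x_poly_def y_poly_def x_def y_def \<kappa>_def)

lemma x_poly_unit:
  assumes "P \<in> edwards_points a d" and "fst P \<noteq> 0"
  shows "\<pi> (x_poly P) \<in> units_of_subring (local_ring P)"
proof -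
  have "eval2 (x_poly P) P = 2 * fst P * (a - d * snd P ^ 2)" by (simp add: x_poly_def)
  also have "\<dots> \<noteq> 0" using assms two y_coeff_nonzero[of "fst P" "snd P"] by simp
  finally show ?thesis using local_ring_unit assms(1) by blast
qed

lemma y_poly_unit:
  assumes "P \<in> edwards_points a d" and "snd P \<noteq> 0"
  shows "\<pi> (y_poly P) \<in> units_of_subring (local_ring P)"
proof -
  have "eval2 (y_poly P) P = - (2 * snd P * (1 - d * fst P ^ 2))"
    by (simp add: y_poly_def algebra_simps)
  also have "\<dots> \<noteq> 0" using assms two x_coeff_nonzero[of "fst P" "snd P"] by simp
  finally show ?thesis using local_ring_unit assms(1) by blast
qed

text \<open>Dividing the relation between the coordinate differences by its unit cofactor expresses
  one of them as a multiple of the other, which is the parameter.\<close>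

lemma coordinates_in_maximal_ideal:
  assumes P: "P \<in> edwards_points a d"
  obtains r s where "r \<in> local_ring P" "s \<in> local_ring P"
    "x - \<kappa> (fst P) = \<pi> (uniformizer_poly P) * r" "y - \<kappa> (snd P) = \<pi> (uniformizer_poly P) * s"
proof (cases "snd P = 0")
  case False
  then have t: "\<pi> (uniformizer_poly P) = x - \<kappa> (fst P)"
    by (simp add: uniformizer_poly_def x_def \<kappa>_def)
  have u: "\<pi> (y_poly P) \<noteq> 0" "inverse (\<pi> (y_poly P)) \<in> local_ring P"
    using y_poly_unit[OF P False] by (auto simp: units_of_subring_def)
  then have "y - \<kappa> (snd P) = \<pi> (uniformizer_poly P) * (\<pi> (x_poly P) * inverse (\<pi> (y_poly P)))"
    using points_relation'[OF P] unfolding t by (simp add: field_simps)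
  moreover have "\<pi> (x_poly P) * inverse (\<pi> (y_poly P)) \<in> local_ring P"
    using u \<pi>_mem local_ring_mult P by blast
  moreover have "x - \<kappa> (fst P) = \<pi> (uniformizer_poly P) * \<pi> 1" using t by simp
  ultimately show thesis using that \<pi>_mem by blast
next
  case True
  then have t: "\<pi> (uniformizer_poly P) = y - \<kappa> (snd P)"
    by (simp add: uniformizer_poly_def y_def)
  have "fst P \<noteq> 0" using P True by (cases P) (auto simp: points_iff)
  then have u: "\<pi> (x_poly P) \<noteq> 0" "inverse (\<pi> (x_poly P)) \<in> local_ring P"
    using x_poly_unit[OF P] by (auto simp: units_of_subring_def)
  then have "x - \<kappa> (fst P) = \<pi> (uniformizer_poly P) * (\<pi> (y_poly P) * inverse (\<pi> (x_poly P)))"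
    using points_relation'[OF P] unfolding t by (simp add: field_simps)
  moreover have "\<pi> (y_poly P) * inverse (\<pi> (x_poly P)) \<in> local_ring P"
    using u \<pi>_mem local_ring_mult P by blast
  moreover have "y - \<kappa> (snd P) = \<pi> (uniformizer_poly P) * \<pi> 1" using t by simp
  ultimately show thesis using that \<pi>_mem by blast
qed

lemma vanishing_poly_multiple:
  assumes P: "P \<in> edwards_points a d" and "eval2 p P = 0"
  obtains w where "w \<in> local_ring P" "\<pi> p = \<pi> (uniformizer_poly P) * w"
proof -
  obtain r s where rs: "p = const2 (eval2 p P) + (X2 - const2 (fst P)) * r + (Y2 - const2 (snd P)) * s"
    by (rule taylor_expansion)
  then have "\<pi> p = (x - \<kappa> (fst P)) * \<pi> r + (y - \<kappa> (snd P)) * \<pi> s"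
    using assms(2) by (subst rs) (simp add: x_def y_def \<kappa>_def)
  moreover obtain r' s' where "r' \<in> local_ring P" "s' \<in> local_ring P"
    "x - \<kappa> (fst P) = \<pi> (uniformizer_poly P) * r'" "y - \<kappa> (snd P) = \<pi> (uniformizer_poly P) * s'"
    using coordinates_in_maximal_ideal[OF P] .
  ultimately have "\<pi> p = \<pi> (uniformizer_poly P) * (r' * \<pi> r + s' * \<pi> s)"
    "r' * \<pi> r + s' * \<pi> s \<in> local_ring P"
    using P by (auto simp: algebra_simps intro!: local_ring_add local_ring_mult \<pi>_mem)
  then show thesis using that by blast
qed

lemma unit_or_multiple:
  assumes P: "P \<in> edwards_points a d" and z: "z \<in> local_ring P"
  shows "z \<in> units_of_subring (local_ring P) \<or> (\<exists>w\<in>local_ring P. z = \<pi> (uniformizer_poly P) * w)"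
proof -
  obtain p q where pq: "eval2 q P \<noteq> 0" "\<pi> q \<noteq> 0" "z = \<pi> p / \<pi> q"
    using local_ring_cases[OF z P] .
  have q: "inverse (\<pi> q) \<in> local_ring P"
    using local_ring_unit[OF P pq(1)] by (simp add: units_of_subring_def)
  show ?thesis
  proof (cases "eval2 p P = 0")
    case True
    then obtain w where "w \<in> local_ring P" "\<pi> p = \<pi> (uniformizer_poly P) * w"
      using vanishing_poly_multiple[OF P] by blast
    then have "w * inverse (\<pi> q) \<in> local_ring P" "z = \<pi> (uniformizer_poly P) * (w * inverse (\<pi> q))"
      using local_ring_mult[OF P _ q] pq(3) by (simp_all add: divide_inverse)
    then show ?thesis by blast
  next
    case False
    then have "\<pi> p \<noteq> 0" using \<pi>_eq_0_imp_eval2 P by blast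
    then have "z \<noteq> 0" "inverse z = \<pi> q / \<pi> p" using pq by auto
    then show ?thesis using z fraction_mem[OF False, of q] by (simp add: units_of_subring_def)
  qed
qed

lemma local_ring_one: "1 \<in> local_ring P"
  using \<pi>_mem[of 1] by simp

lemma local_ring_unit_mult:
  assumes "P \<in> edwards_points a d" "u \<in> units_of_subring (local_ring P)"
    "w \<in> units_of_subring (local_ring P)"
  shows "u * w \<in> units_of_subring (local_ring P)"
  using assms by (simp add: units_of_subring_def local_ring_mult)

lemma local_ring_unit_power:
  assumes "P \<in> edwards_points a d" "u \<in> units_of_subring (local_ring P)"
  shows "u ^ n \<in> units_of_subring (local_ring P)"
proof (induction n)
  case 0
  show ?case by (simp add: units_of_subring_def local_ring_one)
qed (simp add: assms local_ring_unit_mult)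

text \<open>Splitting off the parameter from \<open>z\<close> terminates, because each step lowers
  the exponent \<open>m\<close> in the multiple of \<open>z\<close>.\<close>

lemma divisor_of_uniformizer_power:
  assumes P: "P \<in> edwards_points a d"
    and "z \<in> local_ring P" "w \<in> local_ring P" "u \<in> units_of_subring (local_ring P)"
    and "z * w = \<pi> (uniformizer_poly P) ^ m * u"
  shows "\<exists>n. \<exists>u\<in>units_of_subring (local_ring P). z = u * \<pi> (uniformizer_poly P) ^ n"
  using assms(2,5)
proof (induction m arbitrary: z)
  case 0
  have u: "u \<noteq> 0" "inverse u \<in> local_ring P" using assms(4) by (auto simp: units_of_subring_def)
  have "z * (w * inverse u) = 1" using 0 u by (simp add: mult.assoc[symmetric])
  then have "z \<noteq> 0" "inverse z = w * inverse u" by (auto intro: inverse_unique)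
  moreover have "w * inverse u \<in> local_ring P" using local_ring_mult P assms(3) u by blast
  ultimately have "z \<in> units_of_subring (local_ring P)" using 0 by (simp add: units_of_subring_def)
  then show ?case by (intro exI[of _ 0] bexI[of _ z]) auto
next
  case (Suc m)
  let ?t = "\<pi> (uniformizer_poly P)"
  from unit_or_multiple[OF P Suc.prems(1)] show ?case
  proof
    assume "z \<in> units_of_subring (local_ring P)"
    then show ?case by (intro exI[of _ 0] bexI[of _ z]) auto
  next
    assume "\<exists>w\<in>local_ring P. z = ?t * w"
    then obtain z' where z': "z' \<in> local_ring P" "z = ?t * z'" by blast
    then have "z' * w = ?t ^ m * u"
      using Suc.prems(2) \<pi>_uniformizer_poly_nonzero[of P] by (simp add: mult.assoc)
    then obtain n u' where "u' \<in> units_of_subring (local_ring P)" "z' = u' * ?t ^ n"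
      using Suc.IH z'(1) by blast
    then show ?case using z'(2) by (intro exI[of _ "Suc n"] bexI[of _ u']) auto
  qed
qed

text \<open>\<open>\<pi> p\<close> divides its norm, a nonzero polynomial in \<open>x\<close> in
  which \<open>x - x0\<close> has finite multiplicity. Since \<open>x - x0\<close> is a unit times a
  power of the parameter, \<open>\<pi> p\<close> divides a unit times a power of the
  parameter.\<close>

lemma ex_unit_power_poly:
  assumes P: "P \<in> edwards_points a d" and "\<pi> p \<noteq> 0"
  shows "\<exists>n. \<exists>u\<in>units_of_subring (local_ring P). \<pi> p = u * \<pi> (uniformizer_poly P) ^ n"
proof -
  let ?t = "\<pi> (uniformizer_poly P)"
  obtain p' q where q: "q \<noteq> 0" "\<pi> p * \<pi> p' = \<pi> [:q:]" using ex_norm[OF assms(2)] .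
  obtain q1 where q1: "q = [:- fst P, 1:] ^ order (fst P) q * q1" "\<not> [:- fst P, 1:] dvd q1"
    using order_decomp[OF q(1)] by blast
  have "[:[:- fst P, 1:]:] = X2 - const2 (fst P)" by (simp add: X2_def const2_def)
  then have "\<pi> [:[:- fst P, 1:]:] = x - \<kappa> (fst P)" by (simp add: x_def \<kappa>_def)
  then have eq: "\<pi> [:q:] = (x - \<kappa> (fst P)) ^ order (fst P) q * \<pi> [:q1:]"
    by (subst q1(1)) (simp only: \<pi>_mult_const poly_const_pow[symmetric] \<pi>_power)
  have u1: "\<pi> [:q1:] \<in> units_of_subring (local_ring P)"
    using q1(2) by (intro local_ring_unit[OF P]) (simp add: eval2_def poly_eq_0_iff_dvd)
  have "\<exists>k. \<exists>u\<in>units_of_subring (local_ring P). x - \<kappa> (fst P) = ?t ^ k * u"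
  proof (cases "snd P = 0")
    case False
    then have "x - \<kappa> (fst P) = ?t ^ 1 * 1" by (simp add: uniformizer_poly_def x_def \<kappa>_def)
    then show ?thesis using local_ring_unit[OF P, of 1] by (metis \<pi>_one eval2_simps(2) zero_neq_one)
  next
    case True
    then have "fst P \<noteq> 0" using P True by (cases P) (auto simp: points_iff)
    then have u: "\<pi> (x_poly P) \<in> units_of_subring (local_ring P)" using x_poly_unit[OF P] by blast
    then have nz: "\<pi> (x_poly P) \<noteq> 0" and ui: "inverse (\<pi> (x_poly P)) \<in> units_of_subring (local_ring P)"
      by (auto simp: units_of_subring_def)
    have c: "\<pi> (const2 (d * fst P ^ 2 - 1)) \<in> units_of_subring (local_ring P)"
      using x_coeff_nonzero[of "fst P" "snd P"] P by (intro local_ring_unit) auto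
    \<comment> \<open>\<open>x\<close> ramifies where \<open>y\<close> vanishes: both factors
      \<open>y - y0\<close> and \<open>y + y0\<close> of the relation equal the parameter.\<close>
    have "(x - \<kappa> (fst P)) * \<pi> (x_poly P) = ?t ^ 2 * \<pi> (const2 (d * fst P ^ 2 - 1))"
      using points_relation'[OF P] True
      by (simp add: y_poly_def uniformizer_poly_def y_def power2_eq_square mult.assoc del: const2_simps)
         (simp add: \<kappa>_def mult.assoc)
    then have "x - \<kappa> (fst P) =
        ?t ^ 2 * (\<pi> (const2 (d * fst P ^ 2 - 1)) * inverse (\<pi> (x_poly P)))"
      using nz by (simp add: field_simps)
    then show ?thesis using local_ring_unit_mult[OF P c ui] by blast
  qed
  then obtain k u where u: "u \<in> units_of_subring (local_ring P)" "x - \<kappa> (fst P) = ?t ^ k * u"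
    by blast
  let ?m = "order (fst P) q"
  have "\<pi> p * \<pi> p' = ?t ^ (k * ?m) * (u ^ ?m * \<pi> [:q1:])"
    unfolding q(2) eq u(2) by (simp add: power_mult_distrib power_mult mult.assoc)
  then show ?thesis
    using divisor_of_uniformizer_power[OF P \<pi>_mem \<pi>_mem
        local_ring_unit_mult[OF P local_ring_unit_power[OF P u(1)] u1]] by blast
qed

lemma uniformizer_local_ring:
  assumes P: "P \<in> edwards_points a d"
  shows "uniformizer (local_ring P) (\<pi> (uniformizer_poly P))"
  unfolding uniformizer_def
proof (intro conjI allI impI)
  let ?t = "\<pi> (uniformizer_poly P)"
  show "?t \<in> local_ring P" by (rule \<pi>_mem)
  show t0: "?t \<noteq> 0" by (rule \<pi>_uniformizer_poly_nonzero)
  show "inverse ?t \<notin> local_ring P"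
  proof
    assume "inverse ?t \<in> local_ring P"
    then obtain p q where pq: "eval2 q P \<noteq> 0" "\<pi> q \<noteq> 0" "inverse ?t = \<pi> p / \<pi> q"
      using local_ring_cases P by blast
    then have "\<pi> (q - uniformizer_poly P * p) = 0"
      using t0 by (simp add: field_simps)
    then have "eval2 (q - uniformizer_poly P * p) P = 0" using \<pi>_eq_0_imp_eval2 P by blast
    then show False using pq(1) eval2_uniformizer_poly by simp
  qed
  fix z :: 'f
  assume "z \<noteq> 0"
  obtain p q where pq: "\<pi> q \<noteq> 0" "z = \<pi> p / \<pi> q" using \<pi>_surj by blast
  then have "\<pi> p \<noteq> 0" using \<open>z \<noteq> 0\<close> by auto
  obtain n u where n: "u \<in> units_of_subring (local_ring P)" "\<pi> p = u * ?t ^ n"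
    using ex_unit_power_poly[OF P \<open>\<pi> p \<noteq> 0\<close>] by blast
  obtain m w where m: "w \<in> units_of_subring (local_ring P)" "\<pi> q = w * ?t ^ m"
    using ex_unit_power_poly[OF P pq(1)] by blast
  have wi: "inverse w \<in> units_of_subring (local_ring P)"
    using m(1) by (simp add: units_of_subring_def)
  have "z = (u * inverse w) * (?t ^ n / ?t ^ m)"
    unfolding pq(2) n(2) m(2) by (simp add: divide_inverse)
  also have "?t ^ n / ?t ^ m = ?t powi (int n - int m)"
    using t0 by (simp add: power_int_diff)
  finally show "\<exists>n. \<exists>u\<in>units_of_subring (local_ring P). z = u * ?t powi n"
    using local_ring_unit_mult[OF P n(1) wi] by blast
qed

lemma local_ring_dvr:
  assumes "P \<in> edwards_points a d"
  shows "discrete_valuation_ring (local_ring P)"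
  using assms local_ring_add local_ring_mult local_ring_uminus uniformizer_local_ring
  by unfold_locales blast+

lemma local_ring_place:
  assumes "P \<in> edwards_points a d"
  shows "local_ring P \<in> places \<pi>"
  using assms local_ring_add local_ring_mult uniformizer_local_ring \<pi>_mem
  unfolding places_def by blast

section \<open>Arbitrary places and their comparison with the local rings of points\<close>

lemma place_dvr:
  assumes "R \<in> places \<pi>"
  shows "discrete_valuation_ring R"
proof
  show add: "z + w \<in> R" and mult: "z * w \<in> R" if "z \<in> R" "w \<in> R" for z w
    using assms that by (auto simp: places_def)
  show "\<exists>t. uniformizer R t" using assms by (simp add: places_def)
  have "\<pi> (const2 (- 1)) \<in> R" using assms unfolding places_def by blast
  then have "- 1 \<in> R" by simp
  then show "- z \<in> R" if "z \<in> R" for z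
    using mult[of "- 1" z] that by simp
qed

lemma ord_ge_1_poly_iff:
  assumes P: "P \<in> edwards_points a d"
  shows "discrete_valuation_ring.ord_ge (local_ring P) 1 (\<pi> p) \<longleftrightarrow> eval2 p P = 0"
proof -
  interpret v: discrete_valuation_ring "local_ring P" by (rule local_ring_dvr[OF P])
  show ?thesis
  proof
    assume "eval2 p P = 0"
    then obtain w where "w \<in> local_ring P" "\<pi> p = \<pi> (uniformizer_poly P) * w"
      using vanishing_poly_multiple[OF P] by blast
    moreover have "v.ord_ge 1 (\<pi> (uniformizer_poly P))"
      using v.ord_uniformizer[OF uniformizer_local_ring[OF P]] by (simp add: v.ord_ge_def)
    ultimately show "v.ord_ge 1 (\<pi> p)"
      using v.ord_ge_mult[of 1 _ 0 w] v.mem_iff_ord_ge by auto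
  next
    assume ge: "v.ord_ge 1 (\<pi> p)"
    show "eval2 p P = 0"
    proof (rule ccontr)
      assume "eval2 p P \<noteq> 0"
      then have "\<pi> p \<in> units_of_subring (local_ring P)" by (rule local_ring_unit[OF P])
      then show False using ge v.ord_unit by (auto simp: v.ord_ge_def v.units_iff)
    qed
  qed
qed

lemma local_ring_inject:
  assumes P: "P \<in> edwards_points a d" and Q: "Q \<in> edwards_points a d"
    and "local_ring P = local_ring Q"
  shows "P = Q"
proof -
  have "eval2 p P = 0 \<longleftrightarrow> eval2 p Q = 0" for p
    using ord_ge_1_poly_iff[OF P, of p] ord_ge_1_poly_iff[OF Q, of p] assms(3) by simp
  from this[of "X2 - const2 (fst P)"] this[of "Y2 - const2 (snd P)"]
  show ?thesis by (simp add: prod_eq_iff)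
qed

text \<open>By Taylor expansion the maximal ideal of \<open>R\<close> contains that of the point, so
  \<open>R\<close> dominates the local ring; discrete valuation rings are maximal under
  domination.\<close>

lemma place_eq_local_ring:
  assumes R: "R \<in> places \<pi>" and P: "P \<in> edwards_points a d"
    and x: "discrete_valuation_ring.ord_ge R 1 (x - \<kappa> (fst P))"
    and y: "discrete_valuation_ring.ord_ge R 1 (y - \<kappa> (snd P))"
  shows "R = local_ring P"
proof -
  interpret R: discrete_valuation_ring R by (rule place_dvr[OF R])
  interpret v: discrete_valuation_ring "local_ring P" by (rule local_ring_dvr[OF P])
  have \<kappa>_mem: "\<kappa> c \<in> R" for c using R by (simp add: places_def \<kappa>_def)
  have xy: "x \<in> R" "y \<in> R"
    using R.add_mem[OF _ \<kappa>_mem] x y R.ord_ge_mono[of 1 _ 0] unfolding R.mem_iff_ord_ge[symmetric]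
    by (metis diff_add_cancel zero_le_one)+
  have const: "\<pi> [:A:] \<in> R" for A
  proof (induction A)
    case (pCons c A)
    have "[:pCons c A:] = const2 c + X2 * [:A:]" by (simp add: const2_def X2_def)
    then have "\<pi> [:pCons c A:] = \<kappa> c + x * \<pi> [:A:]" by (simp only: \<pi>_add \<pi>_mult \<kappa>_def x_def)
    then show ?case using pCons \<kappa>_mem xy R.add_mem R.mult_mem by simp
  qed (simp add: R.zero_mem)
  have poly: "\<pi> p \<in> R" for p
  proof (induction p)
    case (pCons A p)
    then show ?case using const xy R.add_mem R.mult_mem by (simp add: \<pi>_pCons[of A p])
  qed (simp add: R.zero_mem)
  have vanishing: "R.ord_ge 1 (\<pi> p)" if "eval2 p P = 0" for p
  proof -
    obtain r s where rs: "p = const2 (eval2 p P) + (X2 - const2 (fst P)) * r + (Y2 - const2 (snd P)) * s"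
      by (rule taylor_expansion)
    have "\<pi> p = (x - \<kappa> (fst P)) * \<pi> r + (y - \<kappa> (snd P)) * \<pi> s"
      using that by (subst rs) (simp add: x_def y_def \<kappa>_def)
    then show ?thesis
      using R.ord_ge_add R.ord_ge_mult[OF x, of 0 "\<pi> r"] R.ord_ge_mult[OF y, of 0 "\<pi> s"] poly
      by (simp add: R.mem_iff_ord_ge)
  qed
  have unit: "\<pi> q \<in> units_of_subring R" if "eval2 q P \<noteq> 0" for q
  proof -
    let ?c = "eval2 q P"
    have "\<kappa> ?c * \<kappa> (inverse ?c) = \<kappa> 1" using that by (metis \<kappa>_simps(4) right_inverse)
    then have "\<kappa> ?c \<in> units_of_subring R" using \<kappa>_mem that inverse_unique[of "\<kappa> ?c" "\<kappa> (inverse ?c)"]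
      by (auto simp: R.units_iff)
    moreover have "R.ord_ge 1 (\<pi> (q - const2 ?c))" by (rule vanishing) simp
    ultimately have "\<kappa> ?c + \<pi> (q - const2 ?c) \<noteq> 0" "R.v (\<kappa> ?c + \<pi> (q - const2 ?c)) = 0"
      using R.ord_add_eq[of "\<kappa> ?c" "\<pi> (q - const2 ?c)"] that by (simp_all add: R.ord_unit)
    then show ?thesis using R.unit_iff[of "\<pi> q"] by (simp add: \<kappa>_def)
  qed
  have sub: "z \<in> R" if z: "z \<in> local_ring P" for z
  proof -
    obtain p q where "eval2 q P \<noteq> 0" "z = \<pi> p / \<pi> q" using local_ring_cases[OF z P] .
    then show ?thesis using unit[of q] poly[of p] R.mult_mem by (simp add: divide_inverse R.units_iff)
  qed
  show "R = local_ring P"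
  proof
    show "local_ring P \<subseteq> R" using sub by blast
    show "R \<subseteq> local_ring P"
    proof
      fix z assume "z \<in> R"
      show "z \<in> local_ring P"
      proof (rule ccontr)
        assume z: "z \<notin> local_ring P"
        then have "z \<noteq> 0" using v.zero_mem by auto
        let ?t = "\<pi> (uniformizer_poly P)"
        \<comment> \<open>As \<open>z\<close> has a pole, \<open>inverse (z * ?t)\<close> still lies
          in the local ring, hence in \<open>R\<close>; multiplying by \<open>z\<close> would put
          \<open>inverse ?t\<close> into \<open>R\<close>.\<close>
        have "v.v z < 0" using z v.mem_iff[OF \<open>z \<noteq> 0\<close>] by simp
        have t: "v.v ?t = 1" "?t \<noteq> 0" using v.ord_uniformizer[OF uniformizer_local_ring[OF P]]
          \<pi>_uniformizer_poly_nonzero by auto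
        then have "v.v (inverse (z * ?t)) \<ge> 0" using \<open>z \<noteq> 0\<close> \<open>v.v z < 0\<close>
          by (simp add: v.ord_inverse v.ord_mult del: inverse_mult_distrib)
        then have "inverse (z * ?t) \<in> R" using sub v.mem_iff[of "inverse (z * ?t)"] t \<open>z \<noteq> 0\<close>
          by auto
        then have "z * inverse (z * ?t) \<in> R" using R.mult_mem \<open>z \<in> R\<close> by blast
        then have "inverse ?t \<in> R" using \<open>z \<noteq> 0\<close> by (simp add: mult.assoc[symmetric])
        moreover have "R.ord_ge 1 ?t" using vanishing eval2_uniformizer_poly by blast
        ultimately show False using t(2) R.mem_iff[of "inverse ?t"]
          by (simp add: R.ord_ge_def R.ord_inverse)
      qed
    qed
  qed
qed

end

section \<open>Intersection multiplicities\<close>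

context edwards_function_field begin

lemma ord_ge_const_iff:
  assumes P: "P \<in> edwards_points a d"
  shows "discrete_valuation_ring.ord_ge (local_ring P) 1 (\<kappa> c) \<longleftrightarrow> c = 0"
  using ord_ge_1_poly_iff[OF P, of "const2 c"] by (simp add: \<kappa>_def)

lemma residue:
  assumes P: "P \<in> edwards_points a d" and z: "z \<in> local_ring P"
  shows "\<exists>c. discrete_valuation_ring.ord_ge (local_ring P) 1 (z - \<kappa> c)"
proof -
  interpret v: discrete_valuation_ring "local_ring P" by (rule local_ring_dvr[OF P])
  obtain p q where pq: "eval2 q P \<noteq> 0" "\<pi> q \<noteq> 0" "z = \<pi> p / \<pi> q" using local_ring_cases[OF z P] .
  define c where "c = eval2 p P / eval2 q P"
  have "z - \<kappa> c = \<pi> (p - const2 c * q) * inverse (\<pi> q)"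
    using pq(2) by (simp add: pq(3) \<kappa>_def field_simps)
  moreover have "v.ord_ge 1 (\<pi> (p - const2 c * q))"
    using ord_ge_1_poly_iff[OF P, of "p - const2 c * q"] pq(1) by (simp add: c_def)
  moreover have "v.ord_ge 0 (inverse (\<pi> q))"
    using local_ring_unit[OF P pq(1)] by (simp add: v.units_iff v.mem_iff_ord_ge)
  ultimately show ?thesis using v.ord_ge_mult[of 1 _ 0] by (metis add.right_neutral)
qed

text \<open>
  The residue field of the local ring at a rational point is \<open>K\<close>, so that its quotient by the
  elements of order at least \<open>n\<close> has dimension \<open>n\<close>; the following two lemmas are the two
  inequalities.
\<close>

lemma dependent_modulo_order:
  assumes P: "P \<in> edwards_points a d"
    and "finite S" and "n < card S" and "\<And>i. i \<in> S \<Longrightarrow> u i \<in> local_ring P"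
  shows "\<exists>c. (\<exists>i\<in>S. c i \<noteq> 0) \<and>
    discrete_valuation_ring.ord_ge (local_ring P) (int n) (\<Sum>i\<in>S. \<kappa> (c i) * u i)"
proof -
  interpret v: discrete_valuation_ring "local_ring P" by (rule local_ring_dvr[OF P])
  let ?t = "\<pi> (uniformizer_poly P)"
  have t: "?t \<noteq> 0" "v.v ?t = 1"
    using v.ord_uniformizer[OF uniformizer_local_ring[OF P]] \<pi>_uniformizer_poly_nonzero by auto
  have mem: "\<kappa> c \<in> local_ring P" for c by (simp add: \<kappa>_def \<pi>_mem)
  have div: "z / ?t \<in> local_ring P" if "v.ord_ge 1 z" for z
    using that t v.mem_iff[of "z / ?t"] v.zero_mem by (cases "z = 0") (simp_all add: v.ord_ge_def v.ord_divide)
  have mult: "v.ord_ge (int (Suc m)) (?t * z)" if "v.ord_ge (int m) z" for m z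
    using v.ord_ge_mult[of 1 ?t "int m" z] t that by (simp add: v.ord_ge_def)
  show ?thesis using assms(2-4)
  proof (induction n arbitrary: S u)
    case 0
    then have "S \<noteq> {}" by auto
    moreover have "(\<Sum>i\<in>S. u i) \<in> local_ring P"
      using 0(1,3) by (induction S rule: finite_induct) (auto intro: v.zero_mem v.add_mem)
    ultimately show ?case by (intro exI[of _ "\<lambda>_. 1"]) (auto simp: v.mem_iff_ord_ge)
  next
    case (Suc n)
    have "\<exists>\<rho>. \<forall>i\<in>S. v.ord_ge 1 (u i - \<kappa> (\<rho> i))"
      using residue[OF P Suc.prems(3)] by (intro bchoice) blast
    then obtain \<rho> where \<rho>: "\<And>i. i \<in> S \<Longrightarrow> v.ord_ge 1 (u i - \<kappa> (\<rho> i))" by blast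
    show ?case
    proof (cases "\<exists>k\<in>S. \<rho> k \<noteq> 0")
      case False
      \<comment> \<open>All residues vanish, so every \<open>u i\<close> is divisible by the
        parameter, and dividing lowers the order by one.\<close>
      then have "u i / ?t \<in> local_ring P" if "i \<in> S" for i
        using \<rho>[OF that] that div by simp
      then obtain c where c: "\<exists>i\<in>S. c i \<noteq> 0" "v.ord_ge (int n) (\<Sum>i\<in>S. \<kappa> (c i) * (u i / ?t))"
        using Suc.IH[of S "\<lambda>i. u i / ?t"] Suc.prems by auto
      have "(\<Sum>i\<in>S. \<kappa> (c i) * u i) = ?t * (\<Sum>i\<in>S. \<kappa> (c i) * (u i / ?t))"
        using t(1) by (simp add: sum_distrib_left)
      then show ?thesis using c mult by (intro exI[of _ c]) simp
    next
      case True
      then obtain k where k: "k \<in> S" "\<rho> k \<noteq> 0" by blast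
      \<comment> \<open>An elimination step: multiples of \<open>u k\<close>, whose residue is
        nonzero, cancel the other residues. This costs one vector and gains one power of the
        parameter.\<close>
      define r where "r i = \<rho> i / \<rho> k" for i
      define w where "w i = (u i - \<kappa> (r i) * u k) / ?t" for i
      have "w i \<in> local_ring P" if "i \<in> S - {k}" for i
      proof -
        have "u i - \<kappa> (r i) * u k = (u i - \<kappa> (\<rho> i)) - \<kappa> (r i) * (u k - \<kappa> (\<rho> k))"
          using k(2) \<kappa>_simps(4)[of "r i" "\<rho> k"] by (simp add: r_def algebra_simps)
        moreover have "v.ord_ge 1 (u i - \<kappa> (\<rho> i))" using that \<rho> by blast
        moreover have "v.ord_ge 1 (\<kappa> (r i) * (u k - \<kappa> (\<rho> k)))"
          using v.ord_ge_mult[of 0 "\<kappa> (r i)" 1 "u k - \<kappa> (\<rho> k)"] \<rho>[OF k(1)] mem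
          by (simp add: v.mem_iff_ord_ge)
        ultimately show ?thesis unfolding w_def using v.ord_ge_diff by (intro div) metis
      qed
      moreover have "n < card (S - {k})" using Suc.prems k(1) by simp
      ultimately obtain c where c: "\<exists>i\<in>S - {k}. c i \<noteq> 0"
        "v.ord_ge (int n) (\<Sum>i\<in>S - {k}. \<kappa> (c i) * w i)"
        using Suc.IH[of "S - {k}" w] Suc.prems by auto
      \<comment> \<open>The coefficient at \<open>k\<close> collects the multiples of
        \<open>u k\<close> subtracted in the elimination.\<close>
      define c' where "c' i = (if i = k then - (\<Sum>i\<in>S - {k}. c i * r i) else c i)" for i
      have \<kappa>_sum: "\<kappa> (\<Sum>i\<in>A. h i) = (\<Sum>i\<in>A. \<kappa> (h i))" for A and h :: "'b \<Rightarrow> 'k"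
        by (induction A rule: infinite_finite_induct) auto
      have "(\<Sum>i\<in>S. \<kappa> (c' i) * u i) = \<kappa> (c' k) * u k + (\<Sum>i\<in>S - {k}. \<kappa> (c' i) * u i)"
        using Suc.prems(1) k(1) by (rule sum.remove)
      also have "(\<Sum>i\<in>S - {k}. \<kappa> (c' i) * u i) = (\<Sum>i\<in>S - {k}. \<kappa> (c i) * u i)"
        by (intro sum.cong) (auto simp: c'_def)
      also have "\<kappa> (c' k) * u k + \<dots> = (\<Sum>i\<in>S - {k}. \<kappa> (c i) * (u i - \<kappa> (r i) * u k))"
        by (simp add: c'_def \<kappa>_sum sum_distrib_right sum_distrib_left sum_subtractf algebra_simps)
      also have "\<dots> = ?t * (\<Sum>i\<in>S - {k}. \<kappa> (c i) * w i)"
        using t(1) by (simp add: sum_distrib_left w_def)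
      finally have "v.ord_ge (int (Suc n)) (\<Sum>i\<in>S. \<kappa> (c' i) * u i)" using mult[OF c(2)] by simp
      moreover have "\<exists>i\<in>S. c' i \<noteq> 0" using c(1) by (auto simp: c'_def)
      ultimately show ?thesis by blast
    qed
  qed
qed

lemma uniformizer_powers_independent:
  assumes P: "P \<in> edwards_points a d"
    and "discrete_valuation_ring.ord_ge (local_ring P) (int n)
      (\<Sum>i<n. \<kappa> (c i) * \<pi> (uniformizer_poly P) ^ i)"
  shows "\<forall>i<n. c i = 0"
proof -
  interpret v: discrete_valuation_ring "local_ring P" by (rule local_ring_dvr[OF P])
  let ?t = "\<pi> (uniformizer_poly P)"
  have t: "?t \<noteq> 0" "v.v ?t = 1"
    using v.ord_uniformizer[OF uniformizer_local_ring[OF P]] \<pi>_uniformizer_poly_nonzero by auto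
  show ?thesis using assms(2)
  proof (induction n arbitrary: c)
    case (Suc n)
    \<comment> \<open>All terms except the first are divisible by the parameter, so
      \<open>c 0\<close> is the residue of the sum and has to vanish; the rest is handled by the
      induction.\<close>
    define s where "s = (\<Sum>i<n. \<kappa> (c (Suc i)) * ?t ^ i)"
    have eq: "(\<Sum>i<Suc n. \<kappa> (c i) * ?t ^ i) = \<kappa> (c 0) + ?t * s"
      by (subst sum.lessThan_Suc_shift) (simp add: s_def sum_distrib_left algebra_simps)
    have s: "s = \<pi> (\<Sum>i<n. const2 (c (Suc i)) * uniformizer_poly P ^ i)"
      unfolding s_def by (induction n) (simp_all add: \<kappa>_def)
    then have "s \<in> local_ring P" by (simp only: \<pi>_mem)
    then have "v.ord_ge 0 s" by (simp add: v.mem_iff_ord_ge)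
    then have ts: "v.ord_ge 1 (?t * s)" using v.ord_ge_mult[of 1 ?t 0 s] t by (simp add: v.ord_ge_def)
    have "v.ord_ge 1 (\<kappa> (c 0) + ?t * s)"
      using Suc.prems unfolding eq by (rule v.ord_ge_mono) simp
    from v.ord_ge_diff[OF this ts] have c0: "c 0 = 0" using ord_ge_const_iff[OF P] by simp
    have "v.ord_ge (int n) s"
      using Suc.prems t unfolding eq c0 by (cases "s = 0") (simp_all add: v.ord_ge_def v.ord_mult)
    then have "\<forall>i<n. c (Suc i) = 0" unfolding s_def by (rule Suc.IH)
    then show ?case using c0 less_Suc_eq_0_disj by auto
  qed simp
qed

text \<open>\<open>w\<close> is the image of \<open>z\<close> under the map from the local ring of the plane to that of the curve.\<close>

definition represents :: "'k \<times> 'k \<Rightarrow> 'k poly poly fract \<Rightarrow> 'f \<Rightarrow> bool" where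
  "represents P z w \<longleftrightarrow> (\<exists>p q. eval2 q P \<noteq> 0 \<and> z = Fract p q \<and> w = \<pi> p / \<pi> q)"

lemma represents_sum:
  fixes c :: "nat \<Rightarrow> 'k"
  assumes P: "P \<in> edwards_points a d" and "\<And>i. i < n \<Longrightarrow> represents P (u i) (w i)"
  shows "represents P (\<Sum>i<n. Fract (const2 (c i)) 1 * u i) (\<Sum>i<n. \<kappa> (c i) * w i)"
  using assms(2)
proof (induction n)
  case 0
  have "represents P (Fract 0 1) (\<pi> 0 / \<pi> 1)"
    unfolding represents_def by (intro exI[of _ 0] exI[of _ 1]) simp
  then show ?case by (simp add: Zero_fract_def)
next
  case (Suc n)
  then obtain p q where pq: "eval2 q P \<noteq> 0" "(\<Sum>i<n. Fract (const2 (c i)) 1 * u i) = Fract p q"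
    "(\<Sum>i<n. \<kappa> (c i) * w i) = \<pi> p / \<pi> q"
    unfolding represents_def by force
  obtain p' q' where pq': "eval2 q' P \<noteq> 0" "u n = Fract p' q'" "w n = \<pi> p' / \<pi> q'"
    using Suc.prems[of n] unfolding represents_def by auto
  have nz: "\<pi> q \<noteq> 0" "\<pi> q' \<noteq> 0" "q \<noteq> 0" "q' \<noteq> 0" using pq(1) pq'(1) \<pi>_eq_0_imp_eval2[OF _ P] by auto
  show ?case unfolding represents_def
  proof (intro exI conjI)
    show "eval2 (q * q') P \<noteq> 0" using pq(1) pq'(1) by simp
    show "(\<Sum>i<Suc n. Fract (const2 (c i)) 1 * u i) = Fract (p * q' + const2 (c n) * p' * q) (q * q')"
      using nz by (simp add: pq pq')
    show "(\<Sum>i<Suc n. \<kappa> (c i) * w i) = \<pi> (p * q' + const2 (c n) * p' * q) / \<pi> (q * q')"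
      using nz pq(3) pq'(3) unfolding \<kappa>_def by (simp add: field_simps)
  qed
qed

text \<open>The kernel of the map to the curve is generated by the curve polynomial. So the ideal
  generated by it and \<open>p\<close> is the preimage of the ideal generated by
  \<open>\<pi> p\<close>, which is given by a bound on the order.\<close>

lemma plane_ideal_iff:
  assumes P: "P \<in> edwards_points a d" and nz: "\<pi> p \<noteq> 0" and "represents P z w"
  shows "z \<in> {Fract (curve_poly a d) 1 * r + Fract p 1 * s | r s.
      r \<in> plane_local_ring P \<and> s \<in> plane_local_ring P} \<longleftrightarrow>
    discrete_valuation_ring.ord_ge (local_ring P) (ord_at (local_ring P) (\<pi> p)) w"
    (is "z \<in> ?I \<longleftrightarrow> _")
proof -
  interpret v: discrete_valuation_ring "local_ring P" by (rule local_ring_dvr[OF P])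
  obtain p0 q0 where pq: "eval2 q0 P \<noteq> 0" "z = Fract p0 q0" "w = \<pi> p0 / \<pi> q0"
    using assms(3) unfolding represents_def by blast
  have q0: "\<pi> q0 \<noteq> 0" "q0 \<noteq> 0" using pq(1) \<pi>_eq_0_imp_eval2[OF _ P] by auto
  have f: "\<pi> (curve_poly a d) = 0" by (simp add: \<pi>_eq_0_iff)
  show ?thesis
  proof
    assume "z \<in> ?I"
    then obtain r1 r2 s1 s2 where *: "eval2 r2 P \<noteq> 0" "eval2 s2 P \<noteq> 0"
      "z = Fract (curve_poly a d) 1 * Fract r1 r2 + Fract p 1 * Fract s1 s2"
      unfolding plane_local_ring_def by blast
    have rs: "\<pi> r2 \<noteq> 0" "r2 \<noteq> 0" "\<pi> s2 \<noteq> 0" "s2 \<noteq> 0" using * \<pi>_eq_0_imp_eval2[OF _ P] by auto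
    have "p0 * (r2 * s2) = (curve_poly a d * r1 * s2 + p * s1 * r2) * q0"
      using *(3) rs q0 unfolding pq(2) by (simp add: eq_fract mult.commute)
    then have "\<pi> (p0 * (r2 * s2)) = \<pi> ((curve_poly a d * r1 * s2 + p * s1 * r2) * q0)" by simp
    then have "w = \<pi> p * (\<pi> s1 / \<pi> s2)" using rs q0 f by (simp add: pq(3) field_simps)
    moreover have "v.ord_ge 0 (\<pi> s1 / \<pi> s2)" using fraction_mem[OF *(2)] v.mem_iff_ord_ge by blast
    ultimately show "v.ord_ge (v.v (\<pi> p)) w"
      using v.ord_ge_mult[of "v.v (\<pi> p)" "\<pi> p" 0 "\<pi> s1 / \<pi> s2"] by (simp add: v.ord_ge_def)
  next
    assume "v.ord_ge (v.v (\<pi> p)) w"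
    then have "w / \<pi> p \<in> local_ring P"
      using v.mem_iff[of "w / \<pi> p"] v.zero_mem nz by (cases "w = 0") (auto simp: v.ord_ge_def v.ord_divide)
    then obtain s1 s2 where s: "eval2 s2 P \<noteq> 0" "\<pi> s2 \<noteq> 0" "w / \<pi> p = \<pi> s1 / \<pi> s2"
      using local_ring_cases[OF _ P] by blast
    have "\<pi> (p0 * s2 - p * s1 * q0) = 0" using s(2,3) q0 nz by (simp add: pq(3) field_simps)
    \<comment> \<open>The quotient \<open>h\<close> supplies the component along the curve
      polynomial.\<close>
    then obtain h where h: "p0 * s2 - p * s1 * q0 = curve_poly a d * h"
      unfolding \<pi>_eq_0_iff by (elim dvdE)
    have "s2 \<noteq> 0" using s(1) by auto
    have "z = Fract (curve_poly a d * h + p * s1 * q0) (q0 * s2)"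
      unfolding pq(2) using q0 \<open>s2 \<noteq> 0\<close> h[symmetric] by (simp add: eq_fract)
    also have "\<dots> = Fract (curve_poly a d) 1 * Fract h (q0 * s2) + Fract p 1 * Fract s1 s2"
      using q0 \<open>s2 \<noteq> 0\<close> by (simp add: eq_fract algebra_simps)
    moreover have "Fract h (q0 * s2) \<in> plane_local_ring P" "Fract s1 s2 \<in> plane_local_ring P"
      using pq(1) s(1) unfolding plane_local_ring_def by (force, blast)
    ultimately show "z \<in> ?I" by blast
  qed
qed

text \<open>The quotient of the plane local ring is carried over to the curve, where the functions
  modulo those of order at least \<open>m\<close> have dimension \<open>m\<close>. A comparison with
  \<open>n\<close> suffices, since \<open>conic_through\<close> asks for lower bounds.\<close>

theorem intersection_mult_iff:
  assumes P: "P \<in> edwards_points a d" and nz: "\<pi> (dehomogenize G) \<noteq> 0"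
  shows "enat n \<le> intersection_mult (edwards_quartic a d) G P \<longleftrightarrow>
    int n \<le> ord_at (local_ring P) (\<pi> (dehomogenize G))"
proof -
  interpret v: discrete_valuation_ring "local_ring P" by (rule local_ring_dvr[OF P])
  define p where "p = dehomogenize G"
  define I where "I = {Fract (curve_poly a d) 1 * r + Fract p 1 * s | r s.
      r \<in> plane_local_ring P \<and> s \<in> plane_local_ring P}"
  define A where "A = {enat n | n. \<exists>u :: nat \<Rightarrow> 'k poly poly fract. (\<forall>i<n. u i \<in> plane_local_ring P) \<and>
    (\<forall>c. (\<Sum>i<n. Fract (const2 (c i)) 1 * u i) \<in> I \<longrightarrow> (\<forall>i<n. c i = 0))}"
  have eq: "intersection_mult (edwards_quartic a d) G P = Sup A"
    unfolding intersection_mult_def quotient_dim_def A_def I_def p_def ..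
  have nz: "\<pi> p \<noteq> 0" using nz by (simp add: p_def)
  have pos: "0 \<le> v.v (\<pi> p)" using v.mem_iff[OF nz] \<pi>_mem by simp
  note ideal = plane_ideal_iff[OF P nz, folded I_def]
  show ?thesis unfolding eq p_def[symmetric]
  proof
    assume n: "int n \<le> v.v (\<pi> p)"
    \<comment> \<open>The powers of the parameter witness the lower bound for the dimension.\<close>
    define u where "u i = Fract (uniformizer_poly P ^ i) 1" for i :: nat
    have "\<forall>i<n. u i \<in> plane_local_ring P"
    proof (intro allI impI)
      show "u i \<in> plane_local_ring P" for i
        unfolding u_def plane_local_ring_def
        by (intro CollectI exI[of _ "uniformizer_poly P ^ i"] exI[of _ 1]) simp
    qed
    moreover have "\<forall>i<n. c i = 0" if "(\<Sum>i<n. Fract (const2 (c i)) 1 * u i) \<in> I" for c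
    proof -
      have "represents P (u i) (\<pi> (uniformizer_poly P) ^ i)" for i
        unfolding represents_def u_def
        by (intro exI[of _ "uniformizer_poly P ^ i"] exI[of _ 1]) simp
      then have "represents P (\<Sum>i<n. Fract (const2 (c i)) 1 * u i)
          (\<Sum>i<n. \<kappa> (c i) * \<pi> (uniformizer_poly P) ^ i)"
        by (intro represents_sum[OF P])
      then have "v.ord_ge (v.v (\<pi> p)) (\<Sum>i<n. \<kappa> (c i) * \<pi> (uniformizer_poly P) ^ i)"
        using that ideal by blast
      then have "v.ord_ge (int n) (\<Sum>i<n. \<kappa> (c i) * \<pi> (uniformizer_poly P) ^ i)"
        using n by (rule v.ord_ge_mono)
      then show ?thesis by (rule uniformizer_powers_independent[OF P])
    qed
    ultimately have "enat n \<in> A" unfolding A_def by blast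
    then show "enat n \<le> Sup A" by (rule Sup_upper)
  next
    assume le: "enat n \<le> Sup A"
    have "Sup A \<le> enat (nat (v.v (\<pi> p)))"
    proof (rule Sup_least)
      fix m assume "m \<in> A"
      then obtain k u where k: "m = enat k" "\<forall>i<k. u i \<in> plane_local_ring P"
        "\<And>c. (\<Sum>i<k. Fract (const2 (c i)) 1 * u i) \<in> I \<Longrightarrow> \<forall>i<k. c i = 0"
        unfolding A_def by blast
      have "\<forall>i\<in>{..<k}. \<exists>w. represents P (u i) w"
        using k(2) unfolding plane_local_ring_def represents_def by blast
      then obtain w where w: "\<forall>i\<in>{..<k}. represents P (u i) (w i)" by (rule bchoice[elim_format]) blast
      show "m \<le> enat (nat (v.v (\<pi> p)))"
      proof (rule ccontr)
        assume "\<not> ?thesis"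
        then have "nat (v.v (\<pi> p)) < card {..<k}" using k(1) by simp
        moreover have "w i \<in> local_ring P" if "i \<in> {..<k}" for i
          using bspec[OF w that] fraction_mem[of _ P] unfolding represents_def by auto
        ultimately obtain c where c: "\<exists>i\<in>{..<k}. c i \<noteq> 0"
          "v.ord_ge (v.v (\<pi> p)) (\<Sum>i<k. \<kappa> (c i) * w i)"
          using dependent_modulo_order[OF P, of "{..<k}" "nat (v.v (\<pi> p))" w] pos by auto
        have "represents P (\<Sum>i<k. Fract (const2 (c i)) 1 * u i) (\<Sum>i<k. \<kappa> (c i) * w i)"
          using w by (intro represents_sum[OF P]) simp
        then show False using ideal c k(3) by blast
      qed
    qed
    with le have "enat n \<le> enat (nat (v.v (\<pi> p)))" by (rule order_trans)
    then show "int n \<le> v.v (\<pi> p)" using pos by simp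
  qed
qed

end

section \<open>The sign automorphisms and the norms\<close>

definition flip_y :: "'k::field poly poly \<Rightarrow> 'k poly poly" where
  "flip_y p = pcompose p [:0, - 1:]"

definition flip_x :: "'k::field poly poly \<Rightarrow> 'k poly poly" where
  "flip_x = map_poly (\<lambda>A. pcompose A [:0, - 1:])"

lemma map_poly_add_hom:
  assumes "h 0 = 0" "\<And>A B. h (A + B) = h A + h B"
  shows "map_poly h (p + q) = map_poly h p + map_poly h q"
  by (rule poly_eqI) (simp add: coeff_map_poly assms)

lemma map_poly_mult_hom:
  fixes h :: "'a::comm_semiring_1 \<Rightarrow> 'b::comm_semiring_1"
  assumes 0: "h 0 = 0" and add: "\<And>A B. h (A + B) = h A + h B" and mult: "\<And>A B. h (A * B) = h A * h B"
  shows "map_poly h (p * q) = map_poly h p * map_poly h q"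
proof (induction p)
  case (pCons A p)
  have "map_poly h (smult A q) = smult (h A) (map_poly h q)"
    by (rule poly_eqI) (simp add: coeff_map_poly 0 mult)
  then show ?case
    using pCons by (simp add: map_poly_pCons 0 map_poly_add_hom[OF 0 add])
qed simp

lemma flip_y_hom:
  "flip_y 1 = 1" "flip_y (p + q) = flip_y p + flip_y q" "flip_y (p * q) = flip_y p * flip_y q"
  "flip_y (flip_y p) = p"
  by (simp_all add: flip_y_def pcompose_1 pcompose_add pcompose_mult pcompose_assoc[symmetric]
      pcompose_pCons)

lemma flip_x_hom:
  fixes p :: "'k::field poly poly"
  shows "flip_x 1 = (1 :: 'k poly poly)" "flip_x (p + q) = flip_x p + flip_x q"
  "flip_x (p * q) = flip_x p * flip_x q" "flip_x (flip_x p) = p"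
proof -
  show "flip_x 1 = (1 :: 'k poly poly)" by (simp add: flip_x_def pcompose_1)
  show "flip_x (p + q) = flip_x p + flip_x q" unfolding flip_x_def
    by (rule map_poly_add_hom) (simp_all add: pcompose_add)
  show "flip_x (p * q) = flip_x p * flip_x q" unfolding flip_x_def
    by (rule map_poly_mult_hom) (simp_all add: pcompose_add pcompose_mult)
  show "flip_x (flip_x p) = p" unfolding flip_x_def
    by (rule poly_eqI) (simp add: coeff_map_poly pcompose_assoc[symmetric] pcompose_pCons)
qed

lemma eval2_flip_y: "eval2 (flip_y p) P = eval2 p (fst P, - snd P)"
  by (simp add: eval2_def flip_y_def poly_pcompose)

lemma eval2_flip_x: "eval2 (flip_x p) P = eval2 p (- fst P, snd P)"
proof -
  have "poly (flip_x p) [:s:] = pcompose (poly p [:s:]) [:0, - 1:]" for s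
    unfolding flip_x_def
    by (induction p) (simp_all add: map_poly_pCons pcompose_add pcompose_smult)
  then show ?thesis by (simp add: eval2_def poly_pcompose)
qed

lemma flip_curve_poly: "flip_y (curve_poly a d) = curve_poly a d" "flip_x (curve_poly a d) = curve_poly a d"
  by (simp_all add: curve_poly_pCons flip_y_def flip_x_def map_poly_pCons pcompose_pCons)

definition conic :: "'k::comm_ring_1 \<Rightarrow> 'k \<Rightarrow> 'k \<Rightarrow> 'k poly poly" where
  "conic c e g = const2 c * (1 + Y2) + X2 * (const2 e * Y2 + const2 g)"

lemma dehomogenize_conic_poly: "dehomogenize (conic_poly c e g) = conic c e g"
  by (simp add: dehomogenize_def conic_poly_def conic_def const3_def const2_def VX_def VY_def VZ_def
      X2_def Y2_def algebra_simps)

lemma conic_pCons: "conic c e g = [:[:c, g:], [:c, e:]:]"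
  by (simp add: conic_def const2_def X2_def Y2_def one_pCons)

text \<open>The sign change of \<open>x\<close> stays within the family of conics. That of
  \<open>y\<close> does not, since it moves the base point to \<open>(0, 1)\<close>; this conjugate
  is therefore kept as \<open>flip_y (conic c e g)\<close>.\<close>

lemma flip_conic: "flip_x (conic c e g) = conic c (- e) (- g)"
  "flip_y (conic c e g) = const2 c * (1 - Y2) + X2 * (const2 g - const2 e * Y2)"
  by (simp_all add: conic_pCons flip_y_def flip_x_def map_poly_pCons pcompose_pCons
      const2_def X2_def Y2_def one_pCons)

context edwards_function_field begin

text \<open>\<open>\<pi> \<circ> s\<close> presents the same field as function field of the same
  curve, and its local ring at \<open>P\<close> is \<open>local_ring Q\<close>. Intersection
  multiplicities do not depend on the presentation, so both orders equal the same
  multiplicity.\<close>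

lemma ord_automorphism:
  assumes hom: "s 1 = 1" "\<And>p q. s (p + q) = s p + s q" "\<And>p q. s (p * q) = s p * s q"
    and inv: "\<And>p. s (s p) = p"
    and f: "s (curve_poly a d) = curve_poly a d"
    and ev: "\<And>p. eval2 (s p) Q = eval2 p P"
    and P: "P \<in> edwards_points a d" and nz: "\<pi> p \<noteq> 0"
  shows "ord_at (local_ring Q) (\<pi> (s p)) = ord_at (local_ring P) (\<pi> p)" and "\<pi> (s p) \<noteq> 0"
    and "Q \<in> edwards_points a d"
proof -
  show Q: "Q \<in> edwards_points a d" using ev[of "curve_poly a d"] P f by (simp flip: eval2_curve_poly)
  have dvd: "curve_poly a d dvd s q \<longleftrightarrow> curve_poly a d dvd q" for q
  proof
    assume "curve_poly a d dvd s q"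
    then obtain h where "s q = curve_poly a d * h" by (elim dvdE)
    then have "q = curve_poly a d * s h" using inv[of q] by (simp add: hom f)
    then show "curve_poly a d dvd q" by simp
  next
    assume "curve_poly a d dvd q"
    then show "curve_poly a d dvd s q" by (auto elim!: dvdE simp: hom f)
  qed
  show nz': "\<pi> (s p) \<noteq> 0" using nz unfolding \<pi>_eq_0_iff dvd .
  interpret s: edwards_function_field a d "\<pi> \<circ> s"
  proof
    have "\<exists>p q. \<pi> (s q) \<noteq> 0 \<and> z = \<pi> (s p) / \<pi> (s q)" for z
    proof -
      obtain p q where "\<pi> q \<noteq> 0" "z = \<pi> p / \<pi> q" using \<pi>_surj by blast
      then show ?thesis by (intro exI[of _ "s p"] exI[of _ "s q"]) (simp add: inv)
    qed
    then show "is_function_field (curve_poly a d) (\<pi> \<circ> s)"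
      unfolding is_function_field_def by (simp add: hom \<pi>_eq_0_iff dvd)
  qed
  have "place_of_point (\<pi> \<circ> s) P = local_ring Q"
  proof (intro equalityI subsetI)
    fix z assume "z \<in> place_of_point (\<pi> \<circ> s) P"
    then obtain p q where "z = \<pi> (s p) / \<pi> (s q)" "eval2 q P \<noteq> 0"
      unfolding place_of_point_def by auto
    then show "z \<in> local_ring Q" using fraction_mem[of "s q" Q "s p"] ev by simp
  next
    fix z assume "z \<in> local_ring Q"
    then obtain p q where "z = \<pi> p / \<pi> q" "eval2 q Q \<noteq> 0"
      unfolding place_of_point_def by auto
    then show "z \<in> place_of_point (\<pi> \<circ> s) P"
      unfolding place_of_point_def using ev[of "s q"]
      by (intro CollectI exI[of _ "s p"] exI[of _ "s q"]) (simp add: inv)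
  qed
  \<comment> \<open>\<open>[:p:]\<close> is a polynomial in three variables with dehomogenization
    \<open>p\<close>, so that intersection multiplicities apply to \<open>p\<close>.\<close>
  moreover have "dehomogenize [:p:] = p" by (simp add: dehomogenize_def)
  ultimately have *: "int n \<le> ord_at (local_ring Q) (\<pi> (s p)) \<longleftrightarrow> int n \<le> ord_at (local_ring P) (\<pi> p)" for n
    using s.intersection_mult_iff[OF P, of "[:p:]" n] intersection_mult_iff[OF P, of "[:p:]" n] nz nz'
    by simp
  have "0 \<le> ord_at (local_ring Q) (\<pi> (s p))" "0 \<le> ord_at (local_ring P) (\<pi> p)"
    using discrete_valuation_ring.mem_iff[OF local_ring_dvr[OF Q] nz'] \<pi>_mem
      discrete_valuation_ring.mem_iff[OF local_ring_dvr[OF P] nz] by auto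
  then show "ord_at (local_ring Q) (\<pi> (s p)) = ord_at (local_ring P) (\<pi> p)"
    using *[of "nat (ord_at (local_ring Q) (\<pi> (s p)))"] *[of "nat (ord_at (local_ring P) (\<pi> p))"]
    by simp
qed

definition F :: "'k \<Rightarrow> 'k \<Rightarrow> 'k \<Rightarrow> 'f" where
  "F c e g = \<pi> (conic c e g)"

lemma F_eq: "F c e g = \<kappa> c * (1 + y) + x * (\<kappa> e * y + \<kappa> g)"
  by (simp add: F_def conic_def x_def y_def \<kappa>_def)

lemma F_nonzero: "(c, e, g) \<noteq> (0, 0, 0) \<Longrightarrow> F c e g \<noteq> 0"
  using \<pi>_linear_eq_0[of "[:c, g:]" "[:c, e:]"] by (auto simp: F_def conic_pCons)

abbreviation ord_pt :: "'k \<times> 'k \<Rightarrow> 'f \<Rightarrow> int" where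
  "ord_pt P \<equiv> ord_at (local_ring P)"

section \<open>Norms of the conic and orders of the coordinate functions\<close>

lemma flip_points:
  assumes "P \<in> edwards_points a d"
  shows "(- fst P, snd P) \<in> edwards_points a d" "(fst P, - snd P) \<in> edwards_points a d"
  using assms by (cases P; simp add: points_iff)+

lemma ord_flip_x:
  assumes "P \<in> edwards_points a d" and "(c, e, g) \<noteq> (0, 0, 0)"
  shows "ord_pt P (F c (- e) (- g)) = ord_pt (- fst P, snd P) (F c e g)"
  using ord_automorphism(1)[OF flip_x_hom flip_curve_poly(2), where P = "(- fst P, snd P)" and Q = P
      and p = "conic c e g"] flip_points(1)[OF assms(1)] F_nonzero[OF assms(2)]
  by (simp add: eval2_flip_x flip_conic F_def)

lemma ord_flip_y:
  assumes "P \<in> edwards_points a d" and "(c, e, g) \<noteq> (0, 0, 0)"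
  shows "\<pi> (flip_y (conic c e g)) \<noteq> 0"
    and "ord_pt P (\<pi> (flip_y (conic c e g))) = ord_pt (fst P, - snd P) (F c e g)"
  using ord_automorphism(1,2)[OF flip_y_hom flip_curve_poly(1), where P = "(fst P, - snd P)" and Q = P
      and p = "conic c e g"] flip_points(2)[OF assms(1)] F_nonzero[OF assms(2)]
  by (simp_all add: eval2_flip_y F_def)

text \<open>Splitting \<open>F\<close> into even and odd part in \<open>x\<close> gives a difference
  of squares, and \<open>x ^ 2 * (a - d * y ^ 2) = 1 - y ^ 2\<close> eliminates
  \<open>x\<close>.\<close>

lemma norm_x_flip:
  assumes "norm_cubic_y a d c e g r s t"
  shows "F c e g * F c (- e) (- g) * (\<kappa> a - \<kappa> d * y ^ 2) =
    \<kappa> (e ^ 2 - d * c ^ 2) * (1 + y) * ((y - \<kappa> r) * (y - \<kappa> s) * (y - \<kappa> t))"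
proof -
  have "F c e g * F c (- e) (- g) * (\<kappa> a - \<kappa> d * y ^ 2) =
      (\<kappa> c * (1 + y)) ^ 2 * (\<kappa> a - \<kappa> d * y ^ 2) - x ^ 2 * (\<kappa> a - \<kappa> d * y ^ 2) * (\<kappa> e * y + \<kappa> g) ^ 2"
    unfolding F_eq by (simp add: algebra_simps power2_eq_square)
  also have "x ^ 2 * (\<kappa> a - \<kappa> d * y ^ 2) = 1 - y ^ 2" using curve_equation by algebra
  also have "(\<kappa> c * (1 + y)) ^ 2 * (\<kappa> a - \<kappa> d * y ^ 2) - (1 - y ^ 2) * (\<kappa> e * y + \<kappa> g) ^ 2 =
    (1 + y) * (\<kappa> (e ^ 2 - d * c ^ 2) * y ^ 3 + \<kappa> (2 * e * g - e ^ 2 - d * c ^ 2) * y ^ 2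
      + \<kappa> (g ^ 2 - 2 * e * g + a * c ^ 2) * y + \<kappa> (a * c ^ 2 - g ^ 2))"
    unfolding \<kappa>_simps \<kappa>_power \<kappa>_2 by algebra
  also have "\<dots> = (1 + y) * (\<kappa> (e ^ 2 - d * c ^ 2) * ((y - \<kappa> r) * (y - \<kappa> s) * (y - \<kappa> t)))"
  proof -
    define l where "l = e ^ 2 - d * c ^ 2"
    have *: "2 * e * g - e ^ 2 - d * c ^ 2 = - l * (r + s + t)"
      "g ^ 2 - 2 * e * g + a * c ^ 2 = l * (r * s + r * t + s * t)" "a * c ^ 2 - g ^ 2 = - l * r * s * t"
      using assms unfolding norm_cubic_y_def cubic_with_roots_def l_def by blast+
    show ?thesis unfolding * l_def[symmetric] \<kappa>_simps by algebra
  qed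
  finally show ?thesis by (simp only: mult_ac)
qed

text \<open>Here the parts of \<open>F\<close> are \<open>c + g * x\<close> and
  \<open>(c + e * x) * y\<close>.\<close>

lemma norm_y_flip:
  assumes "norm_cubic_x a d c e g r s t"
  shows "F c e g * \<pi> (flip_y (conic c e g)) * (1 - \<kappa> d * x ^ 2) =
    \<kappa> (a * e ^ 2 - d * g ^ 2) * x * ((x - \<kappa> r) * (x - \<kappa> s) * (x - \<kappa> t))"
proof -
  have "F c e g * \<pi> (flip_y (conic c e g)) * (1 - \<kappa> d * x ^ 2) =
      (\<kappa> c + x * \<kappa> g) ^ 2 * (1 - \<kappa> d * x ^ 2) - y ^ 2 * (1 - \<kappa> d * x ^ 2) * (\<kappa> c + x * \<kappa> e) ^ 2"
    unfolding F_eq flip_conic by (simp add: x_def y_def \<kappa>_def algebra_simps power2_eq_square)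
  also have "y ^ 2 * (1 - \<kappa> d * x ^ 2) = 1 - \<kappa> a * x ^ 2" using curve_equation by algebra
  also have "(\<kappa> c + x * \<kappa> g) ^ 2 * (1 - \<kappa> d * x ^ 2) - (1 - \<kappa> a * x ^ 2) * (\<kappa> c + x * \<kappa> e) ^ 2 =
    x * (\<kappa> (a * e ^ 2 - d * g ^ 2) * x ^ 3 + \<kappa> (2 * c * (a * e - d * g)) * x ^ 2
      + \<kappa> (g ^ 2 - e ^ 2 + (a - d) * c ^ 2) * x + \<kappa> (2 * c * (g - e)))"
    unfolding \<kappa>_simps \<kappa>_power \<kappa>_2 by algebra
  also have "\<dots> = x * (\<kappa> (a * e ^ 2 - d * g ^ 2) * ((x - \<kappa> r) * (x - \<kappa> s) * (x - \<kappa> t)))"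
  proof -
    define l where "l = a * e ^ 2 - d * g ^ 2"
    have *: "2 * c * (a * e - d * g) = - l * (r + s + t)"
      "g ^ 2 - e ^ 2 + (a - d) * c ^ 2 = l * (r * s + r * t + s * t)" "2 * c * (g - e) = - l * r * s * t"
      using assms unfolding norm_cubic_x_def cubic_with_roots_def l_def by blast+
    show ?thesis unfolding * l_def[symmetric] \<kappa>_simps by algebra
  qed
  finally show ?thesis by (simp only: mult_ac)
qed

lemma ord_pt_unit: "P \<in> edwards_points a d \<Longrightarrow> eval2 p P \<noteq> 0 \<Longrightarrow> ord_pt P (\<pi> p) = 0"
  using local_ring_unit discrete_valuation_ring.ord_unit[OF local_ring_dvr] by blast

text \<open>\<open>x\<close> ramifies where \<open>y = 0\<close>, and \<open>y\<close> where
  \<open>x = 0\<close>. One difference is the parameter, and the orders in the relation between the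
  differences give the other.\<close>

lemma ord_coordinates:
  assumes P: "P \<in> edwards_points a d"
  shows "ord_pt P (x - \<kappa> (fst P)) = (if snd P = 0 then 2 else 1)"
    and "ord_pt P (y - \<kappa> (snd P)) = (if fst P = 0 then 2 else 1)"
proof -
  interpret v: discrete_valuation_ring "local_ring P" by (rule local_ring_dvr[OF P])
  have t: "v.v (\<pi> (uniformizer_poly P)) = 1" by (rule v.ord_uniformizer[OF uniformizer_local_ring[OF P]])
  have tx: "v.v (x - \<kappa> (fst P)) = 1" if "snd P \<noteq> 0"
    using t that by (simp add: uniformizer_poly_def x_def \<kappa>_def)
  have ty: "v.v (y - \<kappa> (snd P)) = 1" if "snd P = 0"
    using t that by (simp add: uniformizer_poly_def y_def)
  note rel = points_relation'[OF P]
  have nz: "x - \<kappa> (fst P) \<noteq> 0" "y - \<kappa> (snd P) \<noteq> 0" by (rule x_neq_\<kappa> y_neq_\<kappa>)+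
  have ux: "\<pi> (x_poly P) \<noteq> 0" "v.v (\<pi> (x_poly P)) = 0" if "fst P \<noteq> 0"
    using x_poly_unit[OF P that] v.ord_unit by (auto simp: v.units_iff)
  have uy: "\<pi> (y_poly P) \<noteq> 0" "v.v (\<pi> (y_poly P)) = 0" if "snd P \<noteq> 0"
    using y_poly_unit[OF P that] v.ord_unit by (auto simp: v.units_iff)
  have ya: "eval2 (const2 a - const2 d * Y2 ^ 2) P \<noteq> 0"
    using y_coeff_nonzero[of "fst P" "snd P"] P by simp
  have xa: "eval2 (const2 (d * fst P ^ 2 - 1)) P \<noteq> 0"
    using x_coeff_nonzero[of "fst P" "snd P"] P by simp
  show "v.v (x - \<kappa> (fst P)) = (if snd P = 0 then 2 else 1)"
  proof (cases "snd P = 0")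
    case True
    then have "fst P \<noteq> 0" using P by (cases P) (auto simp: points_iff)
    have "\<pi> (y_poly P) = (y - \<kappa> (snd P)) * \<pi> (const2 (d * fst P ^ 2 - 1))"
      using True by (simp add: y_poly_def y_def)
    moreover have "\<pi> (const2 (d * fst P ^ 2 - 1)) \<noteq> 0" using xa \<pi>_eq_0_imp_eval2[OF _ P] by blast
    ultimately have "v.v (\<pi> (y_poly P)) = 1" "\<pi> (y_poly P) \<noteq> 0"
      using v.ord_mult[OF nz(2)] ty[OF True] ord_pt_unit[OF P xa] nz(2) by simp_all
    then show ?thesis using arg_cong[OF rel, of v.v] ux[OF \<open>fst P \<noteq> 0\<close>] ty[OF True] nz True
      by (simp add: v.ord_mult)
  next
    case False
    then show ?thesis using tx by simp
  qed
  show "v.v (y - \<kappa> (snd P)) = (if fst P = 0 then 2 else 1)"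
  proof (cases "snd P = 0")
    case True
    then have "fst P \<noteq> 0" using P by (cases P) (auto simp: points_iff)
    then show ?thesis using ty True by simp
  next
    case False
    show ?thesis
    proof (cases "fst P = 0")
      case True
      have "\<pi> (x_poly P) = (x - \<kappa> (fst P)) * \<pi> (const2 a - const2 d * Y2 ^ 2)"
        using True by (simp add: x_poly_def x_def)
      moreover have "\<pi> (const2 a - const2 d * Y2 ^ 2) \<noteq> 0" using ya \<pi>_eq_0_imp_eval2[OF _ P] by blast
      ultimately have "v.v (\<pi> (x_poly P)) = 1" "\<pi> (x_poly P) \<noteq> 0"
        using v.ord_mult[OF nz(1)] tx[OF False] ord_pt_unit[OF P ya] nz(1) by (simp_all del: \<pi>_diff)
      then show ?thesis using arg_cong[OF rel, of v.v] uy[OF False] tx[OF False] nz True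
        by (simp add: v.ord_mult)
    next
      case False': False
      then show ?thesis using arg_cong[OF rel, of v.v] uy[OF False] ux[OF False'] tx[OF False] nz
        by (simp add: v.ord_mult)
    qed
  qed
qed

text \<open>The rational points in the fibre of \<open>y\<close> through \<open>P\<close> are
  \<open>P\<close> and \<open>-P\<close>. If they coincide, the point is ramified and the two
  indicators add up to the order \<open>2\<close>.\<close>

lemma ord_y_minus:
  assumes Q: "Q \<in> edwards_points a d" and P: "P \<in> edwards_points a d"
  shows "ord_pt Q (y - \<kappa> (snd P)) = of_bool (Q = P) + of_bool (Q = (- fst P, snd P))"
proof (cases "snd P = snd Q")
  case True
  then have "fst Q = fst P \<or> fst Q = - fst P" using P Q True by (metis prod.collapse same_y)
  moreover have "fst P = - fst P \<longleftrightarrow> fst P = 0" using two by (simp add: eq_neg_iff_add_eq_0 flip: mult_2)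
  ultimately show ?thesis using ord_coordinates(2)[OF Q] True by (auto simp: prod_eq_iff)
next
  case False
  then have "eval2 (Y2 - const2 (snd P)) Q \<noteq> 0" by simp
  from ord_pt_unit[OF Q this] False show ?thesis by (auto simp: y_def \<kappa>_def)
qed

lemma ord_x_minus:
  assumes Q: "Q \<in> edwards_points a d" and P: "P \<in> edwards_points a d"
  shows "ord_pt Q (x - \<kappa> (fst P)) = of_bool (Q = P) + of_bool (Q = (fst P, - snd P))"
proof (cases "fst P = fst Q")
  case True
  then have "snd Q = snd P \<or> snd Q = - snd P" using P Q True by (metis prod.collapse same_x)
  moreover have "snd P = - snd P \<longleftrightarrow> snd P = 0" using two by (simp add: eq_neg_iff_add_eq_0 flip: mult_2)
  ultimately show ?thesis using ord_coordinates(1)[OF Q] True by (auto simp: prod_eq_iff)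
next
  case False
  then have "eval2 (X2 - const2 (fst P)) Q \<noteq> 0" by simp
  from ord_pt_unit[OF Q this] False show ?thesis by (auto simp: x_def \<kappa>_def)
qed

end

section \<open>Characterization of the conic\<close>

lemma conic_poly_pCons:
  "conic_poly c e g = [:[:0, [:0, e:]:], [:[:0, g:], [:c:]:], [:[:c:]:]:]"
  by (simp add: conic_poly_def const3_def VX_def VY_def VZ_def power2_eq_square)

lemma homogeneous_2_pCons:
  fixes G :: "'k::comm_ring_1 poly poly poly"
  assumes "homogeneous 2 G"
  obtains p q r s t u where "G = [:[:[:0, 0, p:], [:0, q:], [:r:]:], [:[:0, s:], [:t:]:], [:[:u:]:]:]"
proof -
  define m where "m i j k = coeff (coeff (coeff G k) j) i" for i j k
  have 0: "m i j k = 0" if "i + j + k \<noteq> 2" for i j k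
    using assms that unfolding homogeneous_def m_def by blast
  have "G = [:[:[:0, 0, m 2 0 0:], [:0, m 1 1 0:], [:m 0 2 0:]:],
      [:[:0, m 1 0 1:], [:m 0 1 1:]:], [:[:m 0 0 2:]:]:]" (is "G = ?H")
  proof (intro poly_eqI)
    fix k j i
    have "m i j k = coeff (coeff (coeff ?H k) j) i"
      using 0[of i j k] by (auto simp: coeff_pCons numeral_2_eq_2 split: nat.splits)
    then show "coeff (coeff (coeff G k) j) i = coeff (coeff (coeff ?H k) j) i" by (simp add: m_def)
  qed
  then show thesis by (rule that)
qed

lemma homogeneous_conic_poly: "homogeneous 2 (conic_poly c e g)"
  unfolding homogeneous_def conic_poly_pCons by (auto simp: coeff_pCons split: nat.splits)

lemma conic_poly_eq_0_iff: "conic_poly c e g = 0 \<longleftrightarrow> (c, e, g) = (0, 0, 0)"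
  by (auto simp: conic_poly_pCons)

lemma eval3_conic_poly: "eval3 (conic_poly c e g) 1 0 0 = 0" "eval3 (conic_poly c e g) 0 1 0 = 0"
  by (simp_all add: conic_poly_pCons eval3_def)

lemma const3_mult_conic_poly: "const3 l * conic_poly c e g = conic_poly (l * c) (l * e) (l * g)"
  by (simp add: conic_poly_pCons const3_def)

text \<open>The two points at infinity remove \<open>X ^ 2\<close> and \<open>Y ^ 2\<close>, and
  \<open>(0, -1)\<close> equates the coefficients of \<open>Y * Z\<close> and
  \<open>Z ^ 2\<close>.\<close>

lemma homogeneous_2_conic_poly:
  assumes "homogeneous 2 G" "eval3 G 1 0 0 = 0" "eval3 G 0 1 0 = 0"
    and "eval2 (dehomogenize G) (0, - 1) = 0"
  obtains c e g where "G = conic_poly c e g"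
proof -
  obtain p q r s t u where G: "G = [:[:[:0, 0, p:], [:0, q:], [:r:]:], [:[:0, s:], [:t:]:], [:[:u:]:]:]"
    using homogeneous_2_pCons[OF assms(1)] .
  have "p = 0" "r = 0" using assms(2,3) by (simp_all add: G eval3_def)
  moreover have "t = u" using assms(4) \<open>r = 0\<close> by (simp add: G dehomogenize_def eval2_def)
  ultimately have "G = conic_poly u q s" by (simp add: G conic_poly_pCons)
  then show thesis by (rule that)
qed

lemma eval2_conic: "eval2 (conic c e g) P = 0 \<longleftrightarrow> on_conic c e g P"
  by (simp add: conic_def on_conic_def)

context edwards_function_field begin

section \<open>Multiplicities of the conic at rational points as linear conditions\<close>

lemma order_two_point: "(0, - 1) \<in> edwards_points a d" and neutral_point: "(0, 1) \<in> edwards_points a d"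
  by (simp_all add: points_iff)

lemma ord_conic_nonneg:
  assumes P: "P \<in> edwards_points a d" and nz: "(c, e, g) \<noteq> (0, 0, 0)"
  shows "0 \<le> ord_pt P (F c e g)"
  using discrete_valuation_ring.mem_iff[OF local_ring_dvr[OF P] F_nonzero[OF nz]] \<pi>_mem
  by (simp add: F_def)

lemma ord_conic_ge_1:
  assumes P: "P \<in> edwards_points a d" and nz: "(c, e, g) \<noteq> (0, 0, 0)"
  shows "1 \<le> ord_pt P (F c e g) \<longleftrightarrow> on_conic c e g P"
proof -
  interpret v: discrete_valuation_ring "local_ring P" by (rule local_ring_dvr[OF P])
  show ?thesis using ord_ge_1_poly_iff[OF P, of "conic c e g"] F_nonzero[OF nz]
    by (simp add: eval2_conic v.ord_ge_def F_def)
qed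

text \<open>At a smooth point of the curve, order two means that the linear part of
  \<open>\<phi>\<close> is proportional to that of the curve equation.\<close>

lemma ord_conic_ge_2:
  assumes P: "P \<in> edwards_points a d" and nz: "(c, e, g) \<noteq> (0, 0, 0)"
  shows "2 \<le> ord_pt P (F c e g) \<longleftrightarrow> on_conic c e g P \<and> tangent_conic a d c e g P"
proof (cases "on_conic c e g P")
  case False
  then show ?thesis using ord_conic_ge_1[OF P nz] by auto
next
  case True
  interpret v: discrete_valuation_ring "local_ring P" by (rule local_ring_dvr[OF P])
  obtain x0 y0 where P0: "P = (x0, y0)" by (cases P)
  define \<xi> where "\<xi> = x - \<kappa> x0"
  define \<zeta> where "\<zeta> = y - \<kappa> y0"
  \<comment> \<open>\<open>fx\<close> and \<open>fy\<close> are the partial derivatives of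
    \<open>\<phi>\<close> at the point.\<close>
  define fx where "fx = e * y0 + g"
  define fy where "fy = c + e * x0"
  have nz0: "\<xi> \<noteq> 0" "\<zeta> \<noteq> 0" unfolding \<xi>_def \<zeta>_def by (rule x_neq_\<kappa> y_neq_\<kappa>)+
  have ord: "v.v \<xi> = (if y0 = 0 then 2 else 1)" "v.v \<zeta> = (if x0 = 0 then 2 else 1)"
    using ord_coordinates[OF P] unfolding \<xi>_def \<zeta>_def P0 by simp_all
  have mem: "v.ord_ge 0 (\<kappa> b)" for b using \<pi>_mem[of "const2 b" P] by (simp add: \<kappa>_def v.mem_iff_ord_ge)
  have "F c e g = \<kappa> (c * (1 + y0) + x0 * (e * y0 + g)) + \<kappa> fx * \<xi> + \<kappa> fy * \<zeta> + \<kappa> e * (\<xi> * \<zeta>)"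
    unfolding F_eq fx_def fy_def \<xi>_def \<zeta>_def by (simp add: algebra_simps)
  then have taylor: "F c e g = \<kappa> fx * \<xi> + \<kappa> fy * \<zeta> + \<kappa> e * (\<xi> * \<zeta>)"
    using True by (simp add: P0 on_conic_def del: \<kappa>_simps(3,4))
  have F: "2 \<le> v.v (F c e g) \<longleftrightarrow> v.ord_ge 2 (F c e g)" using F_nonzero[OF nz] by (simp add: v.ord_ge_def)
  show ?thesis
  proof (cases "y0 = 0")
    case y0: True
    then have "x0 \<noteq> 0" using P P0 by (auto simp: points_iff)
    \<comment> \<open>\<open>\<xi>\<close> has order two here, so only
      \<open>\<kappa> fy * \<zeta>\<close> survives modulo order two.\<close>
    have rest: "v.ord_ge 2 (\<kappa> fx * \<xi> + \<kappa> e * (\<xi> * \<zeta>))"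
    proof (rule v.ord_ge_add)
      show "v.ord_ge 2 (\<kappa> fx * \<xi>)"
        using v.ord_ge_mult[OF mem, of 2 \<xi> fx] ord y0 by (simp add: v.ord_ge_def)
      have "v.ord_ge 3 (\<xi> * \<zeta>)"
        using v.ord_ge_mult[of 2 \<xi> 1 \<zeta>] ord y0 \<open>x0 \<noteq> 0\<close> by (simp add: v.ord_ge_def)
      then show "v.ord_ge 2 (\<kappa> e * (\<xi> * \<zeta>))"
        using v.ord_ge_mult[OF mem, of 3 "\<xi> * \<zeta>" e] v.ord_ge_mono by fastforce
    qed
    have eq: "F c e g = \<kappa> fy * \<zeta> + (\<kappa> fx * \<xi> + \<kappa> e * (\<xi> * \<zeta>))" unfolding taylor by simp
    have "v.ord_ge 2 (F c e g) \<longleftrightarrow> v.ord_ge 2 (\<kappa> fy * \<zeta>)"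
      unfolding eq using v.ord_ge_add[OF _ rest, of "\<kappa> fy * \<zeta>"] v.ord_ge_diff[OF _ rest] by fastforce
    also have "\<dots> \<longleftrightarrow> fy = 0"
    proof (cases "fy = 0")
      case False
      then have "v.v (\<kappa> fy) = 0" using ord_pt_unit[OF P, of "const2 fy"] by (simp add: \<kappa>_def)
      then show ?thesis using False nz0 ord \<open>x0 \<noteq> 0\<close> by (simp add: v.ord_ge_def v.ord_mult)
    qed simp
    also have "\<dots> \<longleftrightarrow> tangent_conic a d c e g P"
      using \<open>x0 \<noteq> 0\<close> y0 a_nonzero by (simp add: P0 tangent_conic_def fy_def)
    finally show ?thesis using F True by simp
  next
    case y0: False
    have unit: "\<pi> (y_poly P) \<in> units_of_subring (local_ring P)" using y_poly_unit[OF P] y0 P0 by simp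
    \<comment> \<open>Multiplying by the unit \<open>\<pi> (y_poly P)\<close> exchanges
      \<open>\<zeta>\<close> for the parameter \<open>\<xi>\<close>. The value of \<open>w\<close>
      at the point is the Jacobian determinant of the curve equation and
      \<open>\<phi>\<close>.\<close>
    define w where "w = \<kappa> fx * \<pi> (y_poly P) + \<kappa> fy * \<pi> (x_poly P)"
    define z where "z = w + \<zeta> * (\<kappa> e * \<pi> (y_poly P))"
    have rel: "\<xi> * \<pi> (x_poly P) = \<zeta> * \<pi> (y_poly P)"
      using points_relation'[OF P] by (simp add: \<xi>_def \<zeta>_def P0)
    have eq: "F c e g * \<pi> (y_poly P) = \<xi> * z"
    proof -
      have "F c e g * \<pi> (y_poly P) = \<xi> * (\<kappa> fx * \<pi> (y_poly P) + \<zeta> * (\<kappa> e * \<pi> (y_poly P)))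
          + \<kappa> fy * (\<zeta> * \<pi> (y_poly P))"
        unfolding taylor by (simp add: algebra_simps)
      then show ?thesis unfolding rel[symmetric] w_def z_def by (simp add: algebra_simps)
    qed
    have "v.ord_ge 2 (F c e g) \<longleftrightarrow> v.ord_ge 2 (F c e g * \<pi> (y_poly P))"
      using unit v.ord_unit[OF unit] F_nonzero[OF nz] by (simp add: v.ord_ge_def v.ord_mult v.units_iff)
    also have "\<dots> \<longleftrightarrow> v.ord_ge 1 z"
      unfolding eq using nz0 ord y0 by (cases "z = 0") (auto simp: v.ord_ge_def v.ord_mult)
    also have "\<dots> \<longleftrightarrow> v.ord_ge 1 w"
    proof -
      have "\<kappa> e * \<pi> (y_poly P) \<in> local_ring P" using v.mult_mem \<pi>_mem by (simp add: \<kappa>_def)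
      moreover have "v.ord_ge 1 \<zeta>" using ord by (simp add: v.ord_ge_def)
      ultimately have "v.ord_ge 1 (\<zeta> * (\<kappa> e * \<pi> (y_poly P)))"
        using v.ord_ge_mult[of 1 \<zeta> 0 "\<kappa> e * \<pi> (y_poly P)"] by (simp add: v.mem_iff_ord_ge)
      then show ?thesis using v.ord_ge_add[of 1 w] v.ord_ge_diff[of 1 z] unfolding z_def by fastforce
    qed
    also have "w = \<pi> (const2 fx * y_poly P + const2 fy * x_poly P)"
      by (simp add: w_def \<kappa>_def)
    also have "v.ord_ge 1 \<dots> \<longleftrightarrow> eval2 (const2 fx * y_poly P + const2 fy * x_poly P) P = 0"
      by (rule ord_ge_1_poly_iff[OF P])
    also have "eval2 (const2 fx * y_poly P + const2 fy * x_poly P) P =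
        2 * (x0 * (a - d * y0 ^ 2) * fy - y0 * (1 - d * x0 ^ 2) * fx)"
      by (simp add: x_poly_def y_poly_def P0 algebra_simps)
    also have "\<dots> = 0 \<longleftrightarrow> tangent_conic a d c e g P"
      using two by (auto simp: tangent_conic_def P0 fx_def fy_def)
    finally show ?thesis using F True by simp
  qed
qed

text \<open>At \<open>(0, -1)\<close> the function \<open>y + 1\<close> has order two. For
  \<open>e = g\<close> it splits off from \<open>\<phi>\<close> with cofactor
  \<open>c + e * x\<close>, which vanishes there exactly when \<open>c = 0\<close>.\<close>

lemma ord_conic_order_two_point:
  assumes nz: "(c, e, g) \<noteq> (0, 0, 0)"
  shows "1 \<le> ord_pt (0, - 1) (F c e g)"
    and "2 \<le> ord_pt (0, - 1) (F c e g) \<longleftrightarrow> e = g"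
    and "3 \<le> ord_pt (0, - 1) (F c e g) \<longleftrightarrow> e = g \<and> c = 0"
proof -
  let ?O = "(0, - 1) :: 'k \<times> 'k"
  interpret v: discrete_valuation_ring "local_ring ?O" by (rule local_ring_dvr[OF order_two_point])
  show "1 \<le> v.v (F c e g)" using ord_conic_ge_1[OF order_two_point nz] by (simp add: on_conic_def)
  show two: "2 \<le> v.v (F c e g) \<longleftrightarrow> e = g"
    using ord_conic_ge_2[OF order_two_point nz] by (auto simp: on_conic_def tangent_conic_def)
  show "3 \<le> v.v (F c e g) \<longleftrightarrow> e = g \<and> c = 0"
  proof (cases "e = g")
    case True
    define w where "w = \<pi> (const2 c + const2 e * X2)"
    have eq: "F c e g = (y - \<kappa> (- 1)) * w"
      by (simp add: F_eq True w_def \<kappa>_def x_def algebra_simps)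
    have y: "v.v (y - \<kappa> (- 1)) = 2" using ord_coordinates(2)[OF order_two_point] by simp
    have "w \<noteq> 0" using F_nonzero[OF nz] eq by auto
    have "3 \<le> v.v (F c e g) \<longleftrightarrow> v.ord_ge 1 w"
      unfolding eq v.ord_mult[OF y_neq_\<kappa> \<open>w \<noteq> 0\<close>] y using \<open>w \<noteq> 0\<close> by (auto simp: v.ord_ge_def)
    also have "\<dots> \<longleftrightarrow> c = 0" unfolding w_def ord_ge_1_poly_iff[OF order_two_point] by simp
    finally show ?thesis using True by simp
  next
    case False
    then show ?thesis using two by auto
  qed
qed

text \<open>The first form supplies the lower bounds on orders for the divisor, the second the
  linear system that determines the conic.\<close>

theorem conic_through_iff:
  assumes P1: "P1 \<in> edwards_points a d" and P2: "P2 \<in> edwards_points a d"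
  shows "conic_through a d P1 P2 (conic_poly c e g) \<longleftrightarrow>
      (c, e, g) \<noteq> (0, 0, 0) \<and>
      (\<forall>P \<in> {(0, - 1), P1, P2}. int (count_list [(0, - 1), P1, P2] P) \<le> ord_pt P (F c e g))"
    and "conic_through a d P1 P2 (conic_poly c e g) \<longleftrightarrow>
      (c, e, g) \<noteq> (0, 0, 0) \<and> conic_conditions a d P1 P2 c e g"
proof -
  let ?O = "(0, - 1) :: 'k \<times> 'k"
  have *: "enat n \<le> intersection_mult (edwards_quartic a d) (conic_poly c e g) P \<longleftrightarrow>
      int n \<le> ord_pt P (F c e g)" if "(c, e, g) \<noteq> (0, 0, 0)" "P \<in> edwards_points a d" for n P
    using intersection_mult_iff[OF that(2), of "conic_poly c e g" n] F_nonzero[OF that(1)]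
    by (simp add: dehomogenize_conic_poly F_def)
  show 1: "conic_through a d P1 P2 (conic_poly c e g) \<longleftrightarrow>
      (c, e, g) \<noteq> (0, 0, 0) \<and>
      (\<forall>P \<in> {?O, P1, P2}. int (count_list [?O, P1, P2] P) \<le> ord_pt P (F c e g))"
  proof (cases "(c, e, g) = (0, 0, 0)")
    case True
    then show ?thesis by (simp add: conic_through_def conic_poly_eq_0_iff)
  next
    case False
    have "enat (count_list [?O, P1, P2] P) \<le> intersection_mult (edwards_quartic a d) (conic_poly c e g) P
        \<longleftrightarrow> int (count_list [?O, P1, P2] P) \<le> ord_pt P (F c e g)" if "P \<in> {?O, P1, P2}" for P
      using *[OF False] that P1 P2 order_two_point by blast
    then show ?thesis
      unfolding conic_through_def conic_poly_eq_0_iff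
      by (simp only: False homogeneous_conic_poly eval3_conic_poly simp_thms cong: ball_cong)
  qed
  have "(\<forall>P \<in> {?O, P1, P2}. int (count_list [?O, P1, P2] P) \<le> ord_pt P (F c e g)) \<longleftrightarrow>
      conic_conditions a d P1 P2 c e g" if nz: "(c, e, g) \<noteq> (0, 0, 0)"
  proof -
    note O = ord_conic_order_two_point[OF nz]
    note ge1 = ord_conic_ge_1[OF P1 nz] ord_conic_ge_1[OF P2 nz]
    note ge2 = ord_conic_ge_2[OF P1 nz] ord_conic_ge_2[OF P2 nz]
    have on: "on_conic c e g ?O" by (simp add: on_conic_def)
    have tan: "tangent_conic a d c e g ?O \<longleftrightarrow> e = g" by (auto simp: tangent_conic_def)
    \<comment> \<open>The coincidences among the three listed points decide which order is demanded
      at each.\<close>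
    consider "P1 = ?O" "P2 = ?O" | "P1 = ?O" "P2 \<noteq> ?O" | "P1 \<noteq> ?O" "P2 = ?O"
      | "P1 \<noteq> ?O" "P2 \<noteq> ?O" "P1 = P2" | "P1 \<noteq> ?O" "P2 \<noteq> ?O" "P1 \<noteq> P2" by blast
    then show ?thesis
    proof cases
      case 1
      then show ?thesis using O on tan by (auto simp: conic_conditions_def)
    next
      case 2
      then show ?thesis using O on ge1 by (auto simp: conic_conditions_def)
    next
      case 3
      then show ?thesis using O on ge1 by (auto simp: conic_conditions_def)
    next
      case 4
      then show ?thesis using O ge2 by (auto simp: conic_conditions_def)
    next
      case 5
      then show ?thesis using O ge1 by (auto simp: conic_conditions_def)
    qed
  qed
  then show "conic_through a d P1 P2 (conic_poly c e g) \<longleftrightarrow>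
      (c, e, g) \<noteq> (0, 0, 0) \<and> conic_conditions a d P1 P2 c e g"
    using 1 by blast
qed

lemma conic_through_is_conic_poly:
  assumes "conic_through a d P1 P2 G"
  obtains c e g where "G = conic_poly c e g"
proof -
  let ?O = "(0, - 1) :: 'k \<times> 'k"
  have G: "homogeneous 2 G" "eval3 G 1 0 0 = 0" "eval3 G 0 1 0 = 0"
    and "enat (count_list [?O, P1, P2] ?O) \<le> intersection_mult (edwards_quartic a d) G ?O"
    using assms by (simp_all add: conic_through_def)
  moreover have "enat 1 \<le> enat (count_list [?O, P1, P2] ?O)" by simp
  ultimately have m: "enat 1 \<le> intersection_mult (edwards_quartic a d) G ?O" by (metis order_trans)
  have "eval2 (dehomogenize G) ?O = 0"
  proof (cases "\<pi> (dehomogenize G) = 0")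
    case True
    \<comment> \<open>A polynomial that vanishes on the whole curve has no meaningful order, but its
      vanishing at the point is immediate.\<close>
    then show ?thesis using \<pi>_eq_0_imp_eval2 order_two_point by blast
  next
    case False
    interpret v: discrete_valuation_ring "local_ring ?O" by (rule local_ring_dvr[OF order_two_point])
    show ?thesis using intersection_mult_iff[OF order_two_point False, of 1] m
      ord_ge_1_poly_iff[OF order_two_point, of "dehomogenize G"] False by (simp add: v.ord_ge_def)
  qed
  then show thesis using homogeneous_2_conic_poly[OF G] that by blast
qed

end

section \<open>The divisor\<close>

context edwards_function_field begin

abbreviation neg :: "'k \<times> 'k \<Rightarrow> 'k \<times> 'k" where
  "neg P \<equiv> (- fst P, snd P)"

lemma minus_eq_self: "(z :: 'k) = - z \<longleftrightarrow> z = 0" "- z = z \<longleftrightarrow> z = 0"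
proof -
  show "z = - z \<longleftrightarrow> z = 0" using two by (simp add: eq_neg_iff_add_eq_0 flip: mult_2)
  then show "- z = z \<longleftrightarrow> z = 0" by metis
qed

text \<open>
  The norms give \<open>k(Q) + k(-Q) = 0 = k(Q) + k(\<tau>Q)\<close> for the difference \<open>k\<close> of the two sides,
  where \<open>\<tau>(x, y) = (x, -y)\<close>. Since \<open>k\<close> is nonnegative away from \<open>-P3\<close> by assumption and
  \<open>-\<tau>Q \<noteq> Q\<close>, it vanishes.
\<close>

lemma ord_conic_points:
  assumes P: "P1 \<in> edwards_points a d" "P2 \<in> edwards_points a d" "P3 \<in> edwards_points a d"
    and nz: "(c, e, g) \<noteq> (0, 0, 0)"
    and ny: "norm_cubic_y a d c e g (snd P1) (snd P2) (snd P3)"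
    and nx: "norm_cubic_x a d c e g (fst P1) (fst P2) (- fst P3)"
    and ge: "\<And>Q. Q \<in> edwards_points a d \<Longrightarrow>
      of_bool (Q = (0, - 1)) + of_bool (Q = P1) + of_bool (Q = P2) \<le> ord_pt Q (F c e g)"
    and Q: "Q \<in> edwards_points a d"
  shows "ord_pt Q (F c e g) =
    of_bool (Q = (0, - 1)) + of_bool (Q = P1) + of_bool (Q = P2) + of_bool (Q = neg P3)"
proof -
  define k where "k Q = ord_pt Q (F c e g)
    - (of_bool (Q = (0, - 1)) + of_bool (Q = P1) + of_bool (Q = P2) + of_bool (Q = neg P3))" for Q
  have nP3: "neg P3 \<in> edwards_points a d" using flip_points(1)[OF P(3)] .
  have neg: "k Q + k (neg Q) = 0" if Q: "Q \<in> edwards_points a d" for Q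
  proof -
    interpret v: discrete_valuation_ring "local_ring Q" by (rule local_ring_dvr[OF Q])
    have nz': "F c e g \<noteq> 0" "F c (- e) (- g) \<noteq> 0" using F_nonzero nz by auto
    have C: "\<kappa> (e ^ 2 - d * c ^ 2) \<noteq> 0" "v.v (\<kappa> (e ^ 2 - d * c ^ 2)) = 0"
      using norm_cubic_y_lead_nonzero[OF ny nz] ord_pt_unit[OF Q, of "const2 (e ^ 2 - d * c ^ 2)"]
      unfolding \<kappa>_eq_0_iff by (simp_all add: \<kappa>_def del: const2_simps)
    have "eval2 (const2 a - const2 d * Y2 ^ 2) Q \<noteq> 0"
      using y_coeff_nonzero[of "fst Q" "snd Q"] Q by simp
    then have A: "\<kappa> a - \<kappa> d * y ^ 2 \<noteq> 0" "v.v (\<kappa> a - \<kappa> d * y ^ 2) = 0"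
      using ord_pt_unit[OF Q, of "const2 a - const2 d * Y2 ^ 2"]
        \<pi>_eq_0_imp_eval2[OF _ Q, of "const2 a - const2 d * Y2 ^ 2"]
      by (auto simp: \<kappa>_def y_def)
    \<comment> \<open>The factor of \<open>P3\<close> is written with \<open>neg P3\<close>, which
      has the same \<open>y\<close>-coordinate, so that both norms refer to the same remaining
      zero.\<close>
    have "v.v (F c e g * F c (- e) (- g) * (\<kappa> a - \<kappa> d * y ^ 2)) = v.v (\<kappa> (e ^ 2 - d * c ^ 2) *
        (y - \<kappa> (- 1)) * ((y - \<kappa> (snd P1)) * (y - \<kappa> (snd P2)) * (y - \<kappa> (snd (neg P3)))))"
      using norm_x_flip[OF ny] by (simp add: add.commute del: \<kappa>_simps)
         (simp add: add.commute)
    then have "v.v (F c e g) + v.v (F c (- e) (- g)) = v.v (y - \<kappa> (snd (0 :: 'k, - 1 :: 'k)))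
        + v.v (y - \<kappa> (snd P1)) + v.v (y - \<kappa> (snd P2)) + v.v (y - \<kappa> (snd (neg P3)))"
      using nz' A C y_neq_\<kappa> by (simp add: v.ord_mult del: \<kappa>_simps)
    then have sum: "v.v (F c e g) + v.v (F c (- e) (- g)) =
        of_bool (Q = (0, - 1)) + of_bool (Q = neg (0, - 1)) + (of_bool (Q = P1) + of_bool (Q = neg P1))
        + (of_bool (Q = P2) + of_bool (Q = neg P2)) + (of_bool (Q = neg P3) + of_bool (Q = neg (neg P3)))"
      unfolding ord_y_minus[OF Q order_two_point] ord_y_minus[OF Q P(1)] ord_y_minus[OF Q P(2)]
        ord_y_minus[OF Q nP3] by simp
    \<comment> \<open>Moving the negation to \<open>Q\<close> turns these indicators into those of
      \<open>k (neg Q)\<close>.\<close>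
    have swap: "Q = neg S \<longleftrightarrow> neg Q = S" for S by auto
    show ?thesis
      using sum unfolding swap[of "(0, - 1)"] swap[of P1] swap[of P2] swap[of "neg P3"]
        ord_flip_x[OF Q nz] k_def by linarith
  qed
  have flip: "k Q + k (fst Q, - snd Q) = 0" if Q: "Q \<in> edwards_points a d" for Q
  proof -
    interpret v: discrete_valuation_ring "local_ring Q" by (rule local_ring_dvr[OF Q])
    have nz': "F c e g \<noteq> 0" "\<pi> (flip_y (conic c e g)) \<noteq> 0" using F_nonzero[OF nz] ord_flip_y(1)[OF Q nz] .
    have C: "\<kappa> (a * e ^ 2 - d * g ^ 2) \<noteq> 0" "v.v (\<kappa> (a * e ^ 2 - d * g ^ 2)) = 0"
      using norm_cubic_x_lead_nonzero[OF nx nz] ord_pt_unit[OF Q, of "const2 (a * e ^ 2 - d * g ^ 2)"]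
      unfolding \<kappa>_eq_0_iff by (simp_all add: \<kappa>_def del: const2_simps)
    have "eval2 (1 - const2 d * X2 ^ 2) Q \<noteq> 0"
      using x_coeff_nonzero[of "fst Q" "snd Q"] Q by simp
    then have A: "1 - \<kappa> d * x ^ 2 \<noteq> 0" "v.v (1 - \<kappa> d * x ^ 2) = 0"
      using ord_pt_unit[OF Q, of "1 - const2 d * X2 ^ 2"]
        \<pi>_eq_0_imp_eval2[OF _ Q, of "1 - const2 d * X2 ^ 2"]
      by (auto simp: \<kappa>_def x_def)
    have "v.v (F c e g * \<pi> (flip_y (conic c e g)) * (1 - \<kappa> d * x ^ 2)) = v.v (\<kappa> (a * e ^ 2 - d * g ^ 2) *
        (x - \<kappa> 0) * ((x - \<kappa> (fst P1)) * (x - \<kappa> (fst P2)) * (x - \<kappa> (fst (neg P3)))))"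
      using norm_y_flip[OF nx] by simp
    then have "v.v (F c e g) + v.v (\<pi> (flip_y (conic c e g))) = v.v (x - \<kappa> (fst (0 :: 'k, - 1 :: 'k)))
        + v.v (x - \<kappa> (fst P1)) + v.v (x - \<kappa> (fst P2)) + v.v (x - \<kappa> (fst (neg P3)))"
      using nz' A C x_neq_\<kappa> by (simp add: v.ord_mult del: \<kappa>_simps)
    then have sum: "v.v (F c e g) + v.v (\<pi> (flip_y (conic c e g))) =
        of_bool (Q = (0, - 1)) + of_bool (Q = (fst (0 :: 'k, - 1 :: 'k), - snd (0 :: 'k, - 1 :: 'k)))
        + (of_bool (Q = P1) + of_bool (Q = (fst P1, - snd P1)))
        + (of_bool (Q = P2) + of_bool (Q = (fst P2, - snd P2)))
        + (of_bool (Q = neg P3) + of_bool (Q = (fst (neg P3), - snd (neg P3))))"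
      unfolding ord_x_minus[OF Q order_two_point] ord_x_minus[OF Q P(1)] ord_x_minus[OF Q P(2)]
        ord_x_minus[OF Q nP3] by simp
    have swap: "Q = (fst S, - snd S) \<longleftrightarrow> (fst Q, - snd Q) = S" for S by auto
    show ?thesis
      using sum unfolding swap[of "(0, - 1)"] swap[of P1] swap[of P2] swap[of "neg P3"]
        ord_flip_y(2)[OF Q nz] k_def by linarith
  qed
  have ge': "0 \<le> k Q" if "Q \<in> edwards_points a d" "Q \<noteq> neg P3" for Q
    using ge[OF that(1)] that(2) by (simp add: k_def)
  have nonneg: "0 \<le> k Q" if Q: "Q \<in> edwards_points a d" for Q
  proof (cases "Q = neg P3")
    case True
    define Q' where "Q' = (fst Q, - snd Q)"
    have Q': "Q' \<in> edwards_points a d" using flip_points(2)[OF Q] by (simp add: Q'_def)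
    have "k Q = k (neg Q')" using flip[OF Q] neg[OF Q'] by (simp add: Q'_def)
    moreover have "neg Q' \<noteq> neg P3"
    proof
      assume "neg Q' = neg P3"
      then have "neg Q' = Q" using True by simp
      then have "fst Q = 0" "snd Q = 0" by (auto simp: Q'_def prod_eq_iff minus_eq_self)
      then show False using Q by (cases Q) (simp add: points_iff)
    qed
    ultimately show ?thesis using ge'[OF flip_points(1)[OF Q']] by simp
  next
    case False
    then show ?thesis using ge' Q by blast
  qed
  have "k Q = 0" using neg[OF Q] nonneg[OF Q] nonneg[OF flip_points(1)[OF Q]] by simp
  then show ?thesis by (simp add: k_def)
qed

text \<open>In the residue field \<open>y\<close> takes the value \<open>snd P\<close>, so the curve
  equation forces \<open>x ^ 2\<close> to take the value \<open>fst P ^ 2\<close>; the maximal ideal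
  is prime.\<close>

lemma place_over_y:
  assumes R: "R \<in> places \<pi>" and xR: "x \<in> R" and yR: "y \<in> R" and P: "P \<in> edwards_points a d"
    and y: "discrete_valuation_ring.ord_ge R 1 (y - \<kappa> (snd P))"
  shows "R = local_ring P \<or> R = local_ring (neg P)"
proof -
  interpret v: discrete_valuation_ring R by (rule place_dvr[OF R])
  have \<kappa>_mem: "\<kappa> b \<in> R" for b using R by (simp add: places_def \<kappa>_def)
  let ?b = "a - d * snd P ^ 2"
  have b: "?b \<noteq> 0" using y_coeff_nonzero[of "fst P" "snd P"] P by simp
  have sub: "z - w \<in> R" if "z \<in> R" "w \<in> R" for z w
    using v.add_mem[OF that(1) v.uminus_mem[OF that(2)]] by simp
  \<comment> \<open>The added multiple of \<open>(y ^ 2 - y0 ^ 2) * (x ^ 2 - x0 ^ 2)\<close> by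
    \<open>d\<close> replaces the factor \<open>a - d * y ^ 2\<close> by the nonzero constant
    \<open>?b\<close>.\<close>
  have "v.ord_ge 1 ((y - \<kappa> (snd P)) * ((y + \<kappa> (snd P)) * (\<kappa> d * \<kappa> (fst P) ^ 2 - 1)
      + \<kappa> d * (y + \<kappa> (snd P)) * (x - \<kappa> (fst P)) * (x + \<kappa> (fst P))))"
    using v.ord_ge_mult[OF y, of 0] xR yR \<kappa>_mem
    by (simp add: v.mem_iff_ord_ge[symmetric] v.add_mem v.mult_mem v.power_mem v.one_mem sub)
  also have "(y - \<kappa> (snd P)) * ((y + \<kappa> (snd P)) * (\<kappa> d * \<kappa> (fst P) ^ 2 - 1)
      + \<kappa> d * (y + \<kappa> (snd P)) * (x - \<kappa> (fst P)) * (x + \<kappa> (fst P))) =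
      (x - \<kappa> (fst P)) * (x + \<kappa> (fst P)) * \<kappa> ?b"
    using points_relation[OF P] by (simp add: algebra_simps power2_eq_square)
  finally have "v.ord_ge (1 + 0) (((x - \<kappa> (fst P)) * (x + \<kappa> (fst P)) * \<kappa> ?b) * \<kappa> (inverse ?b))"
    using \<kappa>_mem by (intro v.ord_ge_mult) (simp_all add: v.mem_iff_ord_ge[symmetric])
  moreover have "\<kappa> ?b * \<kappa> (inverse ?b) = 1" using b \<kappa>_simps(2,4) by (metis right_inverse)
  ultimately have "v.ord_ge 1 ((x - \<kappa> (fst P)) * (x + \<kappa> (fst P)))" by (simp only: mult.assoc) simp
  then have "v.ord_ge 1 (x - \<kappa> (fst P)) \<or> v.ord_ge 1 (x + \<kappa> (fst P))"
    using xR \<kappa>_mem by (intro v.ord_ge_1_mult) (auto intro: v.add_mem sub)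
  then show ?thesis
    using place_eq_local_ring[OF R P _ y] place_eq_local_ring[OF R flip_points(1)[OF P]] y by auto
qed

text \<open>The right-hand side is the order of \<open>l1 * l2\<close>. In each case it bounds the
  orders of \<open>F\<close> and of its conjugate from below, while the norm shows that they sum to
  twice this bound.\<close>

lemma ord_conic_other_places:
  assumes R: "R \<in> places \<pi>" "\<And>P. P \<in> edwards_points a d \<Longrightarrow> R \<noteq> local_ring P"
    and P: "P1 \<in> edwards_points a d" "P2 \<in> edwards_points a d" "P3 \<in> edwards_points a d"
    and nz: "(c, e, g) \<noteq> (0, 0, 0)"
    and ny: "norm_cubic_y a d c e g (snd P1) (snd P2) (snd P3)"
  shows "ord_at R (F c e g) = ord_at R x + ord_at R (y - \<kappa> (snd P3))"
proof -
  interpret v: discrete_valuation_ring R by (rule place_dvr[OF R(1)])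
  have \<kappa>_mem: "\<kappa> b \<in> R" for b using R(1) by (simp add: places_def \<kappa>_def)
  have \<kappa>_ord: "v.v (\<kappa> b) = 0" if "b \<noteq> 0" for b
  proof -
    have "\<kappa> b * \<kappa> (inverse b) = 1" using that \<kappa>_simps(2,4) by (metis right_inverse)
    then have "inverse (\<kappa> b) = \<kappa> (inverse b)" by (rule inverse_unique)
    then show ?thesis using v.ord_unit[of "\<kappa> b"] \<kappa>_mem that by (simp add: v.units_iff)
  qed
  have sub: "z - w \<in> R" if "z \<in> R" "w \<in> R" for z w
    using v.add_mem[OF that(1) v.uminus_mem[OF that(2)]] by simp
  have F0: "F c e g \<noteq> 0" "F c (- e) (- g) \<noteq> 0" using F_nonzero nz by auto
  have x0: "x \<noteq> 0" and y0: "y \<noteq> 0" using x_neq_\<kappa>[of 0] y_neq_\<kappa>[of 0] by simp_all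
  let ?D = "\<kappa> a - \<kappa> d * y ^ 2"
  have xD: "x ^ 2 * ?D = - ((y - \<kappa> 1) * (y - \<kappa> (- 1)))"
    using curve_equation by (simp add: algebra_simps power2_eq_square)
  have D0: "?D \<noteq> 0" using xD y_neq_\<kappa> by (metis mult_eq_0_iff neg_equal_0_iff_equal mult_zero_right)
  have ord_xD: "2 * v.v x + v.v ?D = v.v (y - \<kappa> 1) + v.v (y - \<kappa> (- 1))"
    using arg_cong[OF xD, of v.v] x0 D0 y_neq_\<kappa> by (simp add: v.ord_mult v.ord_power del: \<kappa>_simps)
  have C: "\<kappa> (e ^ 2 - d * c ^ 2) \<noteq> 0" "v.v (\<kappa> (e ^ 2 - d * c ^ 2)) = 0"
    using norm_cubic_y_lead_nonzero[OF ny nz] \<kappa>_ord unfolding \<kappa>_eq_0_iff by blast+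
  have "F c e g * F c (- e) (- g) * ?D = \<kappa> (e ^ 2 - d * c ^ 2) * (y - \<kappa> (- 1)) *
      ((y - \<kappa> (snd P1)) * (y - \<kappa> (snd P2)) * (y - \<kappa> (snd P3)))"
    using norm_x_flip[OF ny] by (simp add: add.commute)
  from arg_cong[OF this, of v.v]
  have norm: "v.v (F c e g) + v.v (F c (- e) (- g)) + v.v ?D = v.v (y - \<kappa> (- 1))
      + v.v (y - \<kappa> (snd P1)) + v.v (y - \<kappa> (snd P2)) + v.v (y - \<kappa> (snd P3))"
    using F0 D0 C y_neq_\<kappa> by (simp add: v.ord_mult del: \<kappa>_simps)
  show ?thesis
  proof (cases "y \<in> R")
    case False
    \<comment> \<open>Places over \<open>(0 : 1 : 0)\<close>: \<open>y - b\<close> has the order of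
      \<open>y\<close> for every constant \<open>b\<close>, and \<open>a - d * y ^ 2\<close> twice
      that order, so \<open>x\<close> is a unit.\<close>
    define n where "n = v.v y"
    have n: "n < 0" using False v.mem_iff[OF y0] by (simp add: n_def)
    have y: "v.v (y - \<kappa> b) = n" for b
      using v.ord_add_eq(2)[OF y0, of "- \<kappa> b"] \<kappa>_mem[of b] n v.ord_ge_mono[of 0 "\<kappa> b" "n + 1"]
      by (simp add: n_def v.mem_iff_ord_ge)
    have dy: "- (\<kappa> d * y ^ 2) \<noteq> 0" "v.v (- (\<kappa> d * y ^ 2)) = 2 * n"
      using d_nonzero y0 \<kappa>_ord[OF d_nonzero] by (simp_all add: v.ord_mult v.ord_power n_def)
    have "v.v (- (\<kappa> d * y ^ 2) + \<kappa> a) = 2 * n"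
      using v.ord_add_eq(2)[OF dy(1), of "\<kappa> a"] \<kappa>_mem[of a] n dy(2) v.ord_ge_mono[of 0 "\<kappa> a" "2 * n + 1"]
      by (simp add: v.mem_iff_ord_ge)
    then have D: "v.v ?D = 2 * n" by simp
    then have x: "v.v x = 0" using ord_xD unfolding y by simp
    have F_ge: "n \<le> v.v (F c e' g')" if "F c e' g' \<noteq> 0" for e' g'
    proof -
      have ge: "v.ord_ge n (\<kappa> b)" for b
        using \<kappa>_mem[of b] n v.ord_ge_mono[of 0 "\<kappa> b" n] by (simp add: v.mem_iff_ord_ge)
      have y_ge: "v.ord_ge n (\<kappa> b * y)" for b
        using v.ord_ge_mult[of 0 "\<kappa> b" n y] \<kappa>_mem[of b] by (simp add: v.mem_iff_ord_ge v.ord_ge_def n_def)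
      have "v.ord_ge n (\<kappa> c + \<kappa> c * y + x * (\<kappa> e' * y + \<kappa> g'))"
        using v.ord_ge_mult[of 0 x n "\<kappa> e' * y + \<kappa> g'"] x
        by (intro v.ord_ge_add ge y_ge) (simp add: v.ord_ge_add ge y_ge v.ord_ge_def[of 0 x])
      then show ?thesis using that by (simp add: F_eq v.ord_ge_def algebra_simps)
    qed
    have "v.v (F c e g) + v.v (F c (- e) (- g)) = 2 * n" using norm unfolding D y by simp
    then have "v.v (F c e g) = n" using F_ge[OF F0(1)] F_ge[OF F0(2)] by simp
    then show ?thesis using x y by simp
  next
    case yR: True
    have y_mem: "y - \<kappa> b \<in> R" for b using yR \<kappa>_mem sub by blast
    have y_ge: "0 \<le> v.v (y - \<kappa> b)" for b using v.mem_iff[OF y_neq_\<kappa>] y_mem by blast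
    have D_mem: "?D \<in> R" using yR \<kappa>_mem by (intro sub v.mult_mem v.power_mem)
    show ?thesis
    proof (cases "x \<in> R")
      case False
      \<comment> \<open>Places over \<open>(1 : 0 : 0)\<close>: a pole of \<open>x\<close> forces
        \<open>a - d * y ^ 2\<close> to vanish, which keeps \<open>y\<close> away from the
        \<open>y\<close>-coordinates of rational points.\<close>
      define m where "m = v.v x"
      have m: "m < 0" using False v.mem_iff[OF x0] by (simp add: m_def)
      have "0 \<le> v.v (y - \<kappa> 1)" "0 \<le> v.v (y - \<kappa> (- 1))" by (rule y_ge)+
      then have D1: "v.ord_ge 1 ?D" using ord_xD m by (simp add: v.ord_ge_def m_def)
      have y: "v.v (y - \<kappa> b) = 0" if "a - d * b ^ 2 \<noteq> 0" for b
      proof (rule ccontr)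
        assume "v.v (y - \<kappa> b) \<noteq> 0"
        then have "v.ord_ge 1 (y - \<kappa> b)" using y_ge[of b] by (simp add: v.ord_ge_def)
        moreover have "\<kappa> d * (y + \<kappa> b) \<in> R" using yR \<kappa>_mem by (intro v.mult_mem v.add_mem)
        ultimately have "v.ord_ge 1 ((y - \<kappa> b) * (\<kappa> d * (y + \<kappa> b)))"
          using v.ord_ge_mult[of 1 "y - \<kappa> b" 0] by (simp add: v.mem_iff_ord_ge)
        from v.ord_ge_add[OF D1 this] have "v.ord_ge 1 (\<kappa> (a - d * b ^ 2))"
          by (simp add: algebra_simps power2_eq_square)
        then show False using that \<kappa>_ord[OF that] unfolding v.ord_ge_def \<kappa>_eq_0_iff by simp
      qed
      have yP: "v.v (y - \<kappa> (snd S)) = 0" if "S \<in> edwards_points a d" for S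
        using y y_coeff_nonzero[of "fst S" "snd S"] that by simp
      have "v.v (y - \<kappa> 1) = 0" "v.v (y - \<kappa> (- 1)) = 0" using yP[OF neutral_point] yP[OF order_two_point] by simp_all
      then have D: "v.v ?D = - 2 * m" and y1: "v.v (y - \<kappa> (- 1)) = 0" using ord_xD m_def by simp_all
      have F_ge: "m \<le> v.v (F c e' g')" if "F c e' g' \<noteq> 0" for e' g'
      proof -
        have "\<kappa> c * (1 + y) \<in> R" "\<kappa> e' * y + \<kappa> g' \<in> R"
          using yR \<kappa>_mem by (auto intro!: v.add_mem v.mult_mem v.one_mem)
        moreover have "v.ord_ge m x" by (simp add: v.ord_ge_def m_def)
        ultimately have "v.ord_ge m (\<kappa> c * (1 + y))" "v.ord_ge m (x * (\<kappa> e' * y + \<kappa> g'))"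
          using m v.ord_ge_mono[of 0 "\<kappa> c * (1 + y)" m]
            v.ord_ge_mult[of m x 0 "\<kappa> e' * y + \<kappa> g'"]
          by (simp_all add: v.mem_iff_ord_ge)
        then show ?thesis using v.ord_ge_add that by (fastforce simp: F_eq v.ord_ge_def)
      qed
      have "v.v (F c e g) + v.v (F c (- e) (- g)) = 2 * m" using norm D y1 yP P by simp
      then have "v.v (F c e g) = m" using F_ge[OF F0(1)] F_ge[OF F0(2)] by simp
      then show ?thesis using yP[OF P(3)] by (simp add: m_def)
    next
      case xR: True
      \<comment> \<open>Both coordinates are regular, but the place belongs to no rational point;
        hence \<open>y\<close> differs in the residue field from the \<open>y\<close>-coordinates of
        all rational points.\<close>
      have yP: "v.v (y - \<kappa> (snd S)) = 0" if "S \<in> edwards_points a d" for S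
      proof (rule ccontr)
        assume "v.v (y - \<kappa> (snd S)) \<noteq> 0"
        then have "v.ord_ge 1 (y - \<kappa> (snd S))" using y_ge[of "snd S"] by (simp add: v.ord_ge_def)
        then show False using place_over_y[OF R(1) xR yR that] R(2) that flip_points(1)[OF that] by blast
      qed
      have y1: "v.v (y - \<kappa> 1) = 0" "v.v (y - \<kappa> (- 1)) = 0"
        using yP[OF neutral_point] yP[OF order_two_point] by simp_all
      moreover have "0 \<le> v.v x" "0 \<le> v.v ?D" using v.mem_iff x0 D0 xR D_mem by blast+
      ultimately have x: "v.v x = 0" and D: "v.v ?D = 0" using ord_xD by linarith+
      have F_ge: "0 \<le> v.v (F c e' g')" if "F c e' g' \<noteq> 0" for e' g'
      proof -
        have "F c e' g' \<in> R" unfolding F_eq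
          using xR yR \<kappa>_mem by (intro v.add_mem v.mult_mem v.one_mem)
        then show ?thesis using v.mem_iff[OF that] by blast
      qed
      have "v.v (F c e g) + v.v (F c (- e) (- g)) = 0" using norm D y1 yP P by simp
      then have "v.v (F c e g) = 0" using F_ge[OF F0(1)] F_ge[OF F0(2)] by simp
      then show ?thesis using x yP[OF P(3)] by simp
    qed
  qed
qed

text \<open>The orders are identified with \<open>Poly_Mapping.lookup\<close> of the claimed
  divisor. The finite support on which \<open>Abs_poly_mapping\<close> depends comes with this
  identification.\<close>

theorem divisor_of_conic:
  assumes P: "P1 \<in> edwards_points a d" "P2 \<in> edwards_points a d" "P3 \<in> edwards_points a d"
    and nz: "(c, e, g) \<noteq> (0, 0, 0)"
    and ny: "norm_cubic_y a d c e g (snd P1) (snd P2) (snd P3)"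
    and nx: "norm_cubic_x a d c e g (fst P1) (fst P2) (- fst P3)"
    and ge: "\<And>Q. Q \<in> edwards_points a d \<Longrightarrow>
      of_bool (Q = (0, - 1)) + of_bool (Q = P1) + of_bool (Q = P2) \<le> ord_pt Q (F c e g)"
    and Z: "Z \<noteq> 0"
  shows "divisor_of \<pi> (F c e g / (\<kappa> Z * (y - \<kappa> (snd P3)) * x)) =
    point_divisor \<pi> P1 + point_divisor \<pi> P2 - point_divisor \<pi> P3 - point_divisor \<pi> (0, 1)"
    (is "divisor_of \<pi> ?z = ?D")
proof -
  have x0: "x \<noteq> 0" using x_neq_\<kappa>[of 0] by simp
  have ord: "ord_at R ?z = ord_at R (F c e g) - ord_at R (y - \<kappa> (snd P3)) - ord_at R x"
    if "R \<in> places \<pi>" for R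
  proof -
    interpret v: discrete_valuation_ring R by (rule place_dvr[OF that])
    have "\<kappa> Z \<in> R" "\<kappa> (inverse Z) \<in> R" using that by (simp_all add: places_def \<kappa>_def)
    moreover have "inverse (\<kappa> Z) = \<kappa> (inverse Z)"
      using Z \<kappa>_simps(2,4) by (intro inverse_unique) (metis right_inverse)
    ultimately have "v.v (\<kappa> Z) = 0" using Z v.ord_unit[of "\<kappa> Z"] by (simp add: v.units_iff)
    then show ?thesis using F_nonzero[OF nz] x0 y_neq_\<kappa> Z by (simp add: v.ord_divide v.ord_mult)
  qed
  have lookup: "Poly_Mapping.lookup ?D R =
      of_bool (R = local_ring P1) + of_bool (R = local_ring P2) - of_bool (R = local_ring P3)
      - of_bool (R = local_ring (0, 1))" for R
    by (simp add: point_divisor_def lookup_add lookup_minus)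
  have "(if R \<in> places \<pi> then ord_at R ?z else 0) = Poly_Mapping.lookup ?D R" for R
  proof (cases "\<exists>Q \<in> edwards_points a d. R = local_ring Q")
    case True
    then obtain Q where Q: "Q \<in> edwards_points a d" and R: "R = local_ring Q" by blast
    have eq: "R = local_ring S \<longleftrightarrow> Q = S" if "S \<in> edwards_points a d" for S
      using local_ring_inject[OF Q that] R by auto
    have "ord_pt Q x = of_bool (Q = (0, 1)) + of_bool (Q = (0, - 1))"
      using ord_x_minus[OF Q neutral_point] by simp
    then have "ord_at R ?z = of_bool (Q = P1) + of_bool (Q = P2) - of_bool (Q = P3) - of_bool (Q = (0, 1))"
      using ord[OF local_ring_place[OF Q]] ord_conic_points[OF P nz ny nx ge Q] ord_y_minus[OF Q P(3)]
      by (simp add: R)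
    then show ?thesis
      unfolding lookup eq[OF P(1)] eq[OF P(2)] eq[OF P(3)] eq[OF neutral_point]
      using local_ring_place[OF Q] by (simp add: R)
  next
    case False
    then have "Poly_Mapping.lookup ?D R = 0" unfolding lookup using P neutral_point by auto
    moreover have "ord_at R ?z = 0" if "R \<in> places \<pi>"
      using ord[OF that] ord_conic_other_places[OF that _ P nz ny] False by auto
    ultimately show ?thesis by simp
  qed
  then have "(\<lambda>R. if R \<in> places \<pi> then ord_at R ?z else 0) = Poly_Mapping.lookup ?D" by blast
  then show ?thesis unfolding divisor_of_def by (simp add: lookup_inverse)
qed

end

theorem theorem2:
  fixes a d X3 Y3 Z3 :: "'k::field"
    and P1 P2 :: "'k \<times> 'k"
    and \<pi> :: "'k poly poly \<Rightarrow> 'f::field"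
  assumes "(2::'k) \<noteq> 0" and "a \<noteq> 0" and "d \<noteq> 0" and "a \<noteq> d"
    and "is_function_field (dehomogenize (edwards_quartic a d)) \<pi>"
    and "P1 \<in> edwards_points a d" and "P2 \<in> edwards_points a d"
    and "Z3 \<noteq> 0" and "edwards_add a d P1 P2 = Some (X3 / Z3, Y3 / Z3)"
  shows "(\<exists>cZZ cXY cXZ. conic_through a d P1 P2 (conic_poly cZZ cXY cXZ)) \<and>
    (\<forall>\<phi> \<psi>. conic_through a d P1 P2 \<phi> \<and> conic_through a d P1 P2 \<psi> \<longrightarrow>
      (\<exists>c. c \<noteq> 0 \<and> \<psi> = const3 c * \<phi>)) \<and>
    (\<forall>cZZ cXY cXZ. conic_through a d P1 P2 (conic_poly cZZ cXY cXZ) \<longrightarrow>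
      (let l1 = const3 Z3 * VY - const3 Y3 * VZ; l2 = VX in
        divisor_of \<pi> (ratio \<pi> (conic_poly cZZ cXY cXZ) (l1 * l2)) =
          point_divisor \<pi> P1 + point_divisor \<pi> P2
          - point_divisor \<pi> (X3 / Z3, Y3 / Z3) - point_divisor \<pi> (0, 1)))"
proof -
  interpret edwards_function_field a d \<pi>
    using assms by unfold_locales
  note P = assms(6,7) and add = assms(9)
  define P3 where "P3 = (X3 / Z3, Y3 / Z3)"
  have P3: "P3 \<in> edwards_points a d"
    using edwards_add_closed[of "fst P1" "snd P1" "fst P2" "snd P2"] P add by (simp add: P3_def)
  obtain c0 e0 g0 where nz0: "(c0, e0, g0) \<noteq> (0, 0, 0)"
    and conditions: "\<And>c e g. conic_conditions a d P1 P2 c e g \<longleftrightarrow>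
      (\<exists>l. c = l * c0 \<and> e = l * e0 \<and> g = l * g0)"
    and ny0: "norm_cubic_y a d c0 e0 g0 (snd P1) (snd P2) (Y3 / Z3)"
    and nx0: "norm_cubic_x a d c0 e0 g0 (fst P1) (fst P2) (- (X3 / Z3))"
  proof (rule conic_solution[OF P add], goal_cases)
    case (1 c0 e0 g0)
    show thesis by (rule that[OF 1(2-5)])
  qed
  \<comment> \<open>The conics in question are exactly the nonzero multiples of one of them, which
    settles existence and uniqueness.\<close>
  have through_iff: "conic_through a d P1 P2 (conic_poly c e g) \<longleftrightarrow>
      (\<exists>l. l \<noteq> 0 \<and> c = l * c0 \<and> e = l * e0 \<and> g = l * g0)" for c e g
    unfolding conic_through_iff(2)[OF P] conditions using nz0 by auto
  have "conic_through a d P1 P2 (conic_poly c0 e0 g0)"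
    unfolding through_iff by (intro exI[of _ 1]) simp
  moreover have "\<exists>c. c \<noteq> 0 \<and> \<psi> = const3 c * \<phi>"
    if through: "conic_through a d P1 P2 \<phi>" "conic_through a d P1 P2 \<psi>" for \<phi> \<psi>
  proof -
    obtain c e g where \<phi>: "\<phi> = conic_poly c e g" by (rule conic_through_is_conic_poly[OF through(1)])
    obtain c' e' g' where \<psi>: "\<psi> = conic_poly c' e' g'" by (rule conic_through_is_conic_poly[OF through(2)])
    obtain l where l: "l \<noteq> 0" "c = l * c0" "e = l * e0" "g = l * g0"
      using through(1) unfolding \<phi> through_iff by blast
    obtain l' where l': "l' \<noteq> 0" "c' = l' * c0" "e' = l' * e0" "g' = l' * g0"
      using through(2) unfolding \<psi> through_iff by blast
    have "\<psi> = const3 (l' / l) * \<phi>"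
      unfolding \<phi> \<psi> const3_mult_conic_poly l l' using l(1) by simp
    then show ?thesis using l(1) l'(1) by (intro exI[of _ "l' / l"]) simp
  qed
  moreover have "divisor_of \<pi> (ratio \<pi> (conic_poly c e g) ((const3 Z3 * VY - const3 Y3 * VZ) * VX)) =
      point_divisor \<pi> P1 + point_divisor \<pi> P2 - point_divisor \<pi> P3 - point_divisor \<pi> (0, 1)"
    if through: "conic_through a d P1 P2 (conic_poly c e g)" for c e g
  proof -
    obtain l where l: "l \<noteq> 0" "c = l * c0" "e = l * e0" "g = l * g0"
      using through unfolding through_iff by blast
    have nz: "(c, e, g) \<noteq> (0, 0, 0)" using nz0 l by auto
    have mult: "\<And>Q. Q \<in> {(0, - 1), P1, P2} \<Longrightarrow>
        int (count_list [(0, - 1), P1, P2] Q) \<le> ord_pt Q (F c e g)"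
      using through unfolding conic_through_iff(1)[OF P] by blast
    \<comment> \<open>Multiplicities in the list are sums of indicators; at points outside the list
      the bound is \<open>0\<close>.\<close>
    have ge: "of_bool (Q = (0, - 1)) + of_bool (Q = P1) + of_bool (Q = P2) \<le> ord_pt Q (F c e g)"
      if "Q \<in> edwards_points a d" for Q
    proof (cases "Q \<in> {(0, - 1), P1, P2}")
      case True
      have "int (count_list [(0, - 1), P1, P2] Q) =
          of_bool (Q = (0, - 1)) + of_bool (Q = P1) + of_bool (Q = P2)" by auto
      then show ?thesis using mult[OF True] by simp
    next
      case False
      then show ?thesis using ord_conic_nonneg[OF that nz] by simp
    qed
    have "dehomogenize ((const3 Z3 * VY - const3 Y3 * VZ) * VX) = (const2 Z3 * Y2 - const2 Y3) * X2"
      by (simp add: dehomogenize_def const3_def const2_def VX_def VY_def VZ_def X2_def Y2_def)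
    \<comment> \<open>\<open>l1\<close> is a nonzero constant times \<open>y\<close> minus the
      \<open>y\<close>-coordinate of \<open>P3\<close>.\<close>
    moreover have "\<kappa> Z3 * y - \<kappa> Y3 = \<kappa> Z3 * (y - \<kappa> (Y3 / Z3))"
      using \<kappa>_simps(4)[of Z3 "Y3 / Z3"] assms(8) by (simp add: right_diff_distrib del: \<kappa>_simps)
    ultimately have ratio: "ratio \<pi> (conic_poly c e g) ((const3 Z3 * VY - const3 Y3 * VZ) * VX) =
        F c e g / (\<kappa> Z3 * (y - \<kappa> (snd P3)) * x)"
      by (simp add: ratio_def dehomogenize_conic_poly F_def P3_def \<kappa>_def x_def y_def)
    have ny: "norm_cubic_y a d c e g (snd P1) (snd P2) (snd P3)"
      using norm_cubic_y_scale[OF ny0, of l] unfolding l(2-4) P3_def snd_conv .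
    have nx: "norm_cubic_x a d c e g (fst P1) (fst P2) (- fst P3)"
      using norm_cubic_x_scale[OF nx0, of l] unfolding l(2-4) P3_def fst_conv .
    show ?thesis unfolding ratio by (rule divisor_of_conic[OF P P3 nz ny nx ge assms(8)])
  qed
  ultimately show ?thesis unfolding P3_def Let_def by blast
qed

end
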